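(* Let $N,m\ge1$ be integers, $p,q>0$ and $\alpha\in(0,N)$. Consider the problem $$(P)\qquad\begin{cases}\dfrac{\partial u}{\partial t}+(-\Delta)^m u\ \ge\ (|x|^{-\alpha}\ast|u|^p)|u|^q & \text{in }\mathbb R^{N+1}_+=\mathbb R^N\times(0,\infty),\\[2mm] u(x,0)=u_0(x) & \text{in }\mathbb R^N.\end{cases}$$ (i) If $0<\alpha<m$ and $$2<p+q\le\frac{2N+2m}{N+\alpha},$$ then $(P)$ has no nontrivial nonnegative weak solutions. (ii) If $N>2m$ and $$\min\{p,q\}>\frac{N-\alpha}{N-2m}\quad\text{and}\quad p+q>\frac{2N-\alpha}{N-2m},$$ then $(P)$ has positive solutions (for suitable initial data $u_0$).
   Context: Write $\mathbb R^{N+1}_+=\mathbb R^N\times(0,\infty)$. The convolution is $(|x|^{-\alpha}\ast|u|^p)(x,t)=\int_{\mathbb R^N}|x-y|^{-\alpha}|u(y,t)|^p\,dy$, required to be finite for almost all $(x,t)\in\mathbb R^{N+1}_+$. Weak solution: given $u_0\in L^1_{\rm loc}(\mathbb R^N)$, a weak solution of $(P)$ is a function $u\in L^p_{\rm loc}$ such that $(|x|^{-\alpha}\ast|u|^p)|u|^q\in L^1_{\rm loc}$ (local integrability being understood on $\mathbb R^N\times[0,\infty)$) and, for every nonnegative $\varphi\in C_c^\infty(\mathbb R^N\times\mathbb R)$, $$-\int_{\mathbb R^N}u_0(x)\varphi(x,0)\,dx+\int_{\mathbb R^{N+1}_+}u\Big[-\frac{\partial\varphi}{\partial t}+(-\Delta)^m\varphi\Big]dx\,dt\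 \ge\ \int_{\mathbb R^{N+1}_+}(|x|^{-\alpha}\ast|u|^p)|u|^q\varphi\,dx\,dt,$$ with the integrals in this inequality well defined. Nontrivial means not identically zero (a.e.). Any classical solution is a weak solution. *)

theory Defs
  imports "HOL-Analysis.Analysis"
begin

definition partial :: "'b::euclidean_space \<Rightarrow> ('b \<Rightarrow> real) \<Rightarrow> 'b \<Rightarrow> real" where
  "partial b f = (\<lambda>z. frechet_derivative f (at z) b)"

fun C_class :: "nat \<Rightarrow> ('b::euclidean_space \<Rightarrow> real) \<Rightarrow> bool" where
  "C_class 0 f \<longleftrightarrow> continuous_on UNIV f"
| "C_class (Suc k) f \<longleftrightarrow>
     (\<forall>z. f differentiable (at z)) \<and> (\<forall>b\<in>Basis. C_class k (partial b f))"

definition test_function :: "('b::euclidean_space \<Rightarrow> real) \<Rightarrow> bool" where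
  "test_function f \<longleftrightarrow> (\<forall>k. C_class k f) \<and> compact (closure {z. f z \<noteq> 0})"

definition time_deriv :: "('a::euclidean_space \<times> real \<Rightarrow> real) \<Rightarrow> 'a \<times> real \<Rightarrow> real" where
  "time_deriv f = partial (0, 1) f"

(* The Laplacian acts on the space variable only. *)
definition laplacian :: "('a::euclidean_space \<times> real \<Rightarrow> real) \<Rightarrow> 'a \<times> real \<Rightarrow> real" where
  "laplacian f = (\<lambda>z. \<Sum>b\<in>Basis. partial (b, 0) (partial (b, 0) f) z)"

definition polyharmonic ::
    "nat \<Rightarrow> ('a::euclidean_space \<times> real \<Rightarrow> real) \<Rightarrow> 'a \<times> real \<Rightarrow> real" where
  "polyharmonic m f = ((\<lambda>g z. - laplacian g z) ^^ m) f"

definition halfspace :: "('a::euclidean_space \<times> real) set" where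
  "halfspace = UNIV \<times> {0<..}"

definition locally_integrable_on :: "('b::euclidean_space \<Rightarrow> real) \<Rightarrow> 'b set \<Rightarrow> bool" where
  "locally_integrable_on f S \<longleftrightarrow> (\<forall>K. compact K \<and> K \<subseteq> S \<longrightarrow> set_integrable lebesgue K f)"

(* At y = x the kernel has the value 0 powr (-\<alpha>) = 0, on a null set of points y. *)
definition riesz_integrand ::
    "real \<Rightarrow> real \<Rightarrow> ('a::euclidean_space \<times> real \<Rightarrow> real) \<Rightarrow> 'a \<times> real \<Rightarrow> 'a \<Rightarrow> real" where
  "riesz_integrand \<alpha> p u = (\<lambda>(x, t) y. norm (x - y) powr (-\<alpha>) * \<bar>u (y, t)\<bar> powr p)"

definition riesz_conv ::
    "real \<Rightarrow> real \<Rightarrow> ('a::euclidean_space \<times> real \<Rightarrow> real) \<Rightarrow> 'a \<times> real \<Rightarrow> real" where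
  "riesz_conv \<alpha> p u z = (LINT y|lebesgue. riesz_integrand \<alpha> p u z y)"

(* The Bochner integral of a non-integrable function is 0, so finiteness of the convolution
   and convergence of the integrals in the inequality are separate conditions. Only the values
   of u for t > 0 matter: the slice t = 0 is a null set in the space-time integrals. *)
definition weak_solution ::
    "nat \<Rightarrow> real \<Rightarrow> real \<Rightarrow> real \<Rightarrow> ('a::euclidean_space \<Rightarrow> real) \<Rightarrow> ('a \<times> real \<Rightarrow> real) \<Rightarrow> bool" where
  "weak_solution m \<alpha> p q u\<^sub>0 u \<longleftrightarrow>
     locally_integrable_on u\<^sub>0 UNIV \<and>
     u \<in> borel_measurable (lebesgue_on halfspace) \<and>
     locally_integrable_on (\<lambda>z. \<bar>u z\<bar> powr p) (UNIV \<times> {0..}) \<and>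
     (AE z in lebesgue. z \<in> halfspace \<longrightarrow> integrable lebesgue (riesz_integrand \<alpha> p u z)) \<and>
     locally_integrable_on (\<lambda>z. riesz_conv \<alpha> p u z * \<bar>u z\<bar> powr q) (UNIV \<times> {0..}) \<and>
     (\<forall>\<phi>. test_function \<phi> \<and> (\<forall>z. 0 \<le> \<phi> z) \<longrightarrow>
        integrable lebesgue (\<lambda>x. u\<^sub>0 x * \<phi> (x, 0)) \<and>
        set_integrable lebesgue halfspace (\<lambda>z. u z * (- time_deriv \<phi> z + polyharmonic m \<phi> z)) \<and>
        set_integrable lebesgue halfspace (\<lambda>z. riesz_conv \<alpha> p u z * \<bar>u z\<bar> powr q * \<phi> z) \<and>
        - (LINT x|lebesgue. u\<^sub>0 x * \<phi> (x, 0))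
          + (LINT z:halfspace|lebesgue. u z * (- time_deriv \<phi> z + polyharmonic m \<phi> z))
        \<ge> (LINT z:halfspace|lebesgue. riesz_conv \<alpha> p u z * \<bar>u z\<bar> powr q * \<phi> z))"

end

theory Submission
  imports Defs
begin

text \<open>
  Nonexistence. Put \<open>s = (p + q) / 2\<close>. Test with \<open>\<phi>(x,t) = \<Phi>(x/R, t/R^(2m)) * exp(-1/t)\<close>. As \<open>u\<close>
  is nonnegative, the increasing factor \<open>exp(-1/t)\<close> only helps, and it removes the initial datum.
  On the support of \<open>\<phi>\<close> the kernel is at least \<open>(4R) powr (-\<alpha>)\<close>, so Cauchy--Schwarz bounds the
  nonlinear term below by that constant times \<open>J = \<integral>(\<integral>u^s \<phi> dx)^2 dt\<close>. Young's inequality in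
  \<open>x\<close> and in \<open>t\<close>, with weights \<open>K R^(m-\<alpha>)\<close> and \<open>M R^m\<close>, bounds the linear term and gives
  \<open>J \<le> C (K M J' + K / M + K^(-1/(s-1)))\<close>, where \<open>J'\<close> is the part of \<open>J\<close> living where \<open>\<Phi>\<close> is not
  constant; the bound on \<open>p + q\<close> is what makes \<open>C\<close> independent of \<open>R\<close>. A small \<open>K M\<close> shows that \<open>J\<close>
  stays bounded, hence \<open>J' \<rightarrow> 0\<close> as \<open>R \<rightarrow> \<infinity>\<close>, and then suitable \<open>K\<close>, \<open>M\<close> force \<open>J \<rightarrow> 0\<close>.

  Existence. The stationary function \<open>u = \<epsilon> (1 + |x|^2)^(-a)\<close>, with \<open>2 a\<close> slightly below \<open>N - 2m\<close>,
  works for small \<open>\<epsilon>\<close>: \<open>(-\<Delta>)^m u\<close> is a combination of the functions \<open>(1 + |x|^2)^(-a-m-k)\<close>,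
  \<open>0 \<le> k \<le> m\<close>, with nonnegative coefficients, the one with \<open>k = 0\<close> being positive, and the
  right-hand side decays at least as fast as \<open>(1 + |x|^2)^(-a-m)\<close>.
\<close>

subsection \<open>Smooth functions and a cutoff\<close>

definition smooth :: "('b::euclidean_space \<Rightarrow> real) \<Rightarrow> bool" where
  "smooth f \<longleftrightarrow> (\<forall>k. C_class k f)"

lemma partial_eq: "(f has_derivative f') (at z) \<Longrightarrow> partial b f z = f' b"
  by (simp add: partial_def flip: frechet_derivative_at)

text \<open>Replaces the \<open>frechet_derivative\<close> hidden in \<open>partial\<close> by an
  explicit derivative, so that an induction on \<open>k\<close> only has to recognise a derivative
  formula.\<close>

lemma C_class_SucI:
  assumes "\<And>z. (f has_derivative f' z) (at z)" "\<And>b. b \<in> Basis \<Longrightarrow> C_class k (\<lambda>z. f' z b)"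
  shows "C_class (Suc k) f"
proof -
  have "partial b f = (\<lambda>z. f' z b)" for b
    using assms(1) by (intro ext partial_eq)
  then show ?thesis
    using assms by (auto simp: differentiable_def)
qed

lemma C_class_Suc_has_derivative:
  assumes "C_class (Suc k) f"
  shows "(f has_derivative (\<lambda>h. partial h f z)) (at z)"
  using assms by (auto simp: partial_def frechet_derivative_works)

lemma C_class_Suc_partial: "C_class (Suc k) f \<Longrightarrow> b \<in> Basis \<Longrightarrow> C_class k (partial b f)"
  by simp

lemma C_class_continuous: "C_class k f \<Longrightarrow> continuous_on UNIV f"
  by (cases k)
    (simp_all add: continuous_at_imp_continuous_on differentiable_imp_continuous_within)

text \<open>The product and chain rules leave undifferentiated factors, so their inductions on
  \<open>k\<close> need this descent for those factors.\<close>

lemma C_class_mono: "C_class (Suc k) f \<Longrightarrow> C_class k f"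
proof (induction k arbitrary: f)
  case 0
  then show ?case
    using C_class_continuous by (metis C_class.simps(1))
next
  case (Suc k)
  then show ?case by (auto simp del: C_class.simps(1))
qed

lemma C_class_const: "C_class k (\<lambda>z. c)"
  by (induction k arbitrary: c) (auto intro!: C_class_SucI[OF has_derivative_const] simp del: C_class.simps(2))

lemma C_class_linear:
  assumes "bounded_linear f"
  shows "C_class k f"
proof (cases k)
  case 0
  then show ?thesis using assms by (simp add: linear_continuous_on)
next
  case (Suc n)
  then show ?thesis
    using C_class_SucI[OF bounded_linear_imp_has_derivative[OF assms] C_class_const] by simp
qed

lemma C_class_add: "C_class k f \<Longrightarrow> C_class k g \<Longrightarrow> C_class k (\<lambda>z. f z + g z)"
proof (induction k arbitrary: f g)
  case 0
  then show ?case by (simp add: continuous_on_add continuous_on_mult)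
next
  case (Suc k)
  show ?case
  proof (rule C_class_SucI)
    show "((\<lambda>z. f z + g z) has_derivative (\<lambda>h. partial h f z + partial h g z)) (at z)" for z
      by (intro has_derivative_add C_class_Suc_has_derivative[OF Suc.prems(1)]
          C_class_Suc_has_derivative[OF Suc.prems(2)])
  qed (use Suc in auto)
qed

lemma C_class_mult: "C_class k f \<Longrightarrow> C_class k g \<Longrightarrow> C_class k (\<lambda>z. f z * g z)"
proof (induction k arbitrary: f g)
  case 0
  then show ?case by (simp add: continuous_on_add continuous_on_mult)
next
  case (Suc k)
  show ?case
  proof (rule C_class_SucI)
    show "((\<lambda>z. f z * g z) has_derivative (\<lambda>h. f z * partial h g z + partial h f z * g z)) (at z)" for z
      by (intro has_derivative_mult C_class_Suc_has_derivative[OF Suc.prems(1)]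
          C_class_Suc_has_derivative[OF Suc.prems(2)])
    show "C_class k (\<lambda>z. f z * partial b g z + partial b f z * g z)" if "b \<in> Basis" for b
      by (intro C_class_add Suc.IH C_class_Suc_partial[OF _ that] Suc.prems C_class_mono[OF Suc.prems(1)]
          C_class_mono[OF Suc.prems(2)])
  qed
qed

lemma C_class_compose:
  fixes F :: "real \<Rightarrow> real"
  shows "C_class k F \<Longrightarrow> C_class k g \<Longrightarrow> C_class k (\<lambda>z. F (g z))"
proof (induction k arbitrary: F g)
  case 0
  then show ?case using continuous_on_compose2[of UNIV F UNIV g] by simp
next
  case (Suc k)
  have lin: "partial (h::real) F y = h * partial 1 F y" for h y
    using linear_scale[OF has_derivative_linear[OF C_class_Suc_has_derivative[OF Suc.prems(1)]], of h 1 y]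
    by simp
  show ?case
  proof (rule C_class_SucI)
    show "((\<lambda>z. F (g z)) has_derivative (\<lambda>h. partial 1 F (g z) * partial h g z)) (at z)" for z
      using has_derivative_compose[OF C_class_Suc_has_derivative[OF Suc.prems(2)]
          C_class_Suc_has_derivative[OF Suc.prems(1)], of z] lin[of "partial _ g z"]
      by (simp add: mult.commute)
    show "C_class k (\<lambda>z. partial 1 F (g z) * partial b g z)" if "b \<in> Basis" for b
      by (rule C_class_mult[OF Suc.IH[OF C_class_Suc_partial[OF Suc.prems(1)]
              C_class_mono[OF Suc.prems(2)]] C_class_Suc_partial[OF Suc.prems(2) that]]) simp
  qed
qed

lemma smooth_has_derivative: "smooth f \<Longrightarrow> (f has_derivative (\<lambda>h. partial h f z)) (at z)"
  using C_class_Suc_has_derivative smooth_def by blast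

lemma smooth_partial: "smooth f \<Longrightarrow> b \<in> Basis \<Longrightarrow> smooth (partial b f)"
  unfolding smooth_def using C_class_Suc_partial by blast

lemma smooth_continuous: "smooth f \<Longrightarrow> continuous_on UNIV f"
  unfolding smooth_def using C_class_continuous by blast

lemma smooth_const [intro, simp]: "smooth (\<lambda>z. c)"
  by (simp add: smooth_def C_class_const)

lemma smooth_linear: "bounded_linear f \<Longrightarrow> smooth f"
  by (simp add: smooth_def C_class_linear)

lemma smooth_add [intro]: "smooth f \<Longrightarrow> smooth g \<Longrightarrow> smooth (\<lambda>z. f z + g z)"
  by (simp add: smooth_def C_class_add)

lemma smooth_mult [intro]: "smooth f \<Longrightarrow> smooth g \<Longrightarrow> smooth (\<lambda>z. f z * g z)"
  by (simp add: smooth_def C_class_mult)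

lemma smooth_minus [intro]: "smooth f \<Longrightarrow> smooth (\<lambda>z. - f z)"
  using smooth_mult[of "\<lambda>z. -1" f] by simp

lemma smooth_diff [intro]: "smooth f \<Longrightarrow> smooth g \<Longrightarrow> smooth (\<lambda>z. f z - g z)"
  using smooth_add[of f "\<lambda>z. - g z"] by (simp add: smooth_minus)

lemma smooth_power [intro]: "smooth f \<Longrightarrow> smooth (\<lambda>z. f z ^ n)"
  by (induction n) (auto intro!: smooth_mult)

lemma smooth_sum: "(\<And>i. i \<in> I \<Longrightarrow> smooth (f i)) \<Longrightarrow> smooth (\<lambda>z. \<Sum>i\<in>I. f i z)"
  by (induction I rule: infinite_finite_induct) auto

lemma smooth_compose: "smooth F \<Longrightarrow> smooth g \<Longrightarrow> smooth (\<lambda>z. F (g z))" for F :: "real \<Rightarrow> real"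
  by (simp add: smooth_def C_class_compose)

lemma smooth_inner: "bounded_linear L \<Longrightarrow> smooth (\<lambda>z. inner (L z) (L z))"
  for L :: "'b::euclidean_space \<Rightarrow> 'c::euclidean_space"
  by (subst euclidean_inner)
    (intro smooth_sum smooth_mult smooth_linear bounded_linear_inner_left_comp, auto)

lemma partial_cmult: "smooth f \<Longrightarrow> partial b (\<lambda>z. c * f z) = (\<lambda>z. c * partial b f z)"
  by (rule ext, rule partial_eq) (intro has_derivative_mult_right smooth_has_derivative)

lemma partial_mult:
  "smooth f \<Longrightarrow> smooth g \<Longrightarrow>
    partial b (\<lambda>z. f z * g z) = (\<lambda>z. f z * partial b g z + partial b f z * g z)"
  by (rule ext, rule partial_eq) (intro has_derivative_mult smooth_has_derivative)

lemma partial_sum: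
  "(\<And>i. i \<in> I \<Longrightarrow> smooth (f i)) \<Longrightarrow>
    partial b (\<lambda>z. \<Sum>i\<in>I. f i z) = (\<lambda>z. \<Sum>i\<in>I. partial b (f i) z)"
  by (rule ext, rule partial_eq) (intro has_derivative_sum smooth_has_derivative)

lemma smooth_deriv:
  fixes F :: "real \<Rightarrow> real"
  assumes "smooth F"
  shows "smooth (deriv F)" and "(F has_real_derivative deriv F y) (at y)"
proof -
  show *: "(F has_real_derivative deriv F y) (at y)" for y
    using smooth_has_derivative[OF assms(1)] differentiableI DERIV_deriv_iff_real_differentiable
    by metis
  then have "partial 1 F = deriv F"
    by (intro ext) (simp add: has_field_derivative_def partial_eq[OF *[unfolded has_field_derivative_def]])
  then show "smooth (deriv F)"
    using smooth_partial[OF assms, of 1] by simp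
qed

section \<open>Smoothness under the space-time operators\<close>

lemma Basis_prodI [intro, simp]: "b \<in> Basis \<Longrightarrow> (b, 0) \<in> Basis" "(0, 1::real) \<in> Basis"
  by (auto simp: Basis_prod_def)

lemma laplacian_smooth [intro]: "smooth f \<Longrightarrow> smooth (laplacian f)"
  unfolding laplacian_def by (intro smooth_sum smooth_partial) auto

lemma time_deriv_smooth [intro]: "smooth f \<Longrightarrow> smooth (time_deriv f)"
  unfolding time_deriv_def by (intro smooth_partial) auto

lemma polyharmonic_0 [simp]: "polyharmonic 0 f = f"
  by (simp add: polyharmonic_def)

lemma polyharmonic_Suc: "polyharmonic (Suc m) f = (\<lambda>z. - laplacian (polyharmonic m f) z)"
  by (simp add: polyharmonic_def)

lemma polyharmonic_Suc': "polyharmonic (Suc m) f = polyharmonic m (\<lambda>z. - laplacian f z)"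
  by (simp only: polyharmonic_def funpow_Suc_right comp_def)

lemma polyharmonic_smooth [intro]: "smooth f \<Longrightarrow> smooth (polyharmonic m f)"
  by (induction m) (auto simp: polyharmonic_Suc)

text \<open>The usual function exp(-1/x) is the case \<open>n = 0\<close>. Carrying the powers of
  \<open>1 / x\<close> makes the family closed under differentiation, see \<open>flat_DERIV\<close>,
  and smoothness becomes an induction over all \<open>n\<close> at once.\<close>

definition flat :: "nat \<Rightarrow> real \<Rightarrow> real" where
  "flat n x = (if x > 0 then (1 / x) ^ n * exp (- (1 / x)) else 0)"

lemma flat_tendsto_0: "(flat n \<longlongrightarrow> 0) (at 0)"
proof -
  have lim: "((\<lambda>x. flat n x) \<longlongrightarrow> 0) (at_right 0)"
  proof (rule Lim_transform_eventually)
    show "((\<lambda>x. (inverse x) ^ n / exp (inverse x)) \<longlongrightarrow> (0::real)) (at_right 0)"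
      by (rule filterlim_compose[OF tendsto_power_div_exp_0 filterlim_inverse_at_top_right])
    show "\<forall>\<^sub>F x in at_right 0. inverse x ^ n / exp (inverse x) = flat n x"
      by (auto simp: flat_def exp_minus field_simps eventually_at_filter)
  qed
  have "((\<lambda>x. flat n x) \<longlongrightarrow> 0) (at_left 0)"
    by (rule tendsto_eventually) (auto simp: flat_def eventually_at_filter)
  with lim show ?thesis by (simp add: filterlim_at_split)
qed

lemma flat_DERIV: "(flat n has_real_derivative (- real n * flat (Suc n) x + flat (Suc (Suc n)) x)) (at x)"
proof -
  consider "x > 0" | "x < 0" | "x = 0" by linarith
  then show ?thesis
  proof cases
    case 1
    have "((\<lambda>x. (1 / x) ^ n * exp (- (1 / x))) has_real_derivative
        (- real n * flat (Suc n) x + flat (Suc (Suc n)) x)) (at x)"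
      using 1 by (auto intro!: derivative_eq_intros simp: flat_def power2_eq_square)
        (cases n; simp add: field_simps)
    then show ?thesis
      by (rule has_field_derivative_transform_within[where d = x]) (use 1 in \<open>auto simp: flat_def dist_real_def\<close>)
  next
    case 2
    have "((\<lambda>x. 0) has_real_derivative (- real n * flat (Suc n) x + flat (Suc (Suc n)) x)) (at x)"
      using 2 by (simp add: flat_def)
    then show ?thesis
      by (rule has_field_derivative_transform_within[where d = "-x"]) (use 2 in \<open>auto simp: flat_def dist_real_def\<close>)
  next
    case 3
    \<comment> \<open>For nonzero \<open>h\<close> the difference quotient is
      \<open>flat (Suc n) h\<close>, so the limit for the next index gives the derivative at the
      gluing point.\<close>
    have "((\<lambda>h. flat n h / h) \<longlongrightarrow> 0) (at 0)"
      by (rule Lim_transform_eventually[OF flat_tendsto_0[of "Suc n"]])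
        (auto simp: flat_def eventually_at_filter)
    then show ?thesis
      unfolding 3 by (simp add: DERIV_def) (simp add: flat_def)
  qed
qed

lemma smooth_flat: "smooth (flat n)"
  unfolding smooth_def
proof
  fix k show "C_class k (flat n)"
  proof (induction k arbitrary: n)
    case 0
    then show ?case
      using flat_DERIV by (auto intro!: continuous_at_imp_continuous_on DERIV_isCont)
  next
    case (Suc k)
    have "C_class k (\<lambda>z. (- real n * flat (Suc n) z + flat (Suc (Suc n)) z) * b)" for b
      by (intro C_class_mult C_class_add C_class_const Suc.IH)
    then show ?case
      using flat_DERIV by (intro C_class_SucI) (auto simp: has_field_derivative_def)
  qed
qed

lemma flat_0: "flat 0 x = (if x > 0 then exp (- (1 / x)) else 0)"
  by (simp add: flat_def)

lemma flat_0_nonneg: "0 \<le> flat 0 x" by (simp add: flat_0)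

lemma flat_0_le_1: "flat 0 x \<le> 1" by (simp add: flat_0)

lemma flat_0_mono: "x \<le> y \<Longrightarrow> flat 0 x \<le> flat 0 y"
  by (auto simp: flat_0 frac_le)

text \<open>As \<open>flat 0 1\<close> is 1/e, the factors \<open>exp 1\<close> normalise the values
  at 1. For \<open>x \<le> 1\<close> the inner term vanishes and the value is 1; for
  \<open>x \<ge> 2\<close> the inner term is at least 1 and the outer argument is nonpositive.
  Nesting avoids a quotient of smooth functions.\<close>

definition cutoff :: "real \<Rightarrow> real" where
  "cutoff x = exp 1 * flat 0 (1 - exp 1 * flat 0 (x - 1))"

lemma smooth_cutoff: "smooth cutoff"
proof -
  have id: "smooth (\<lambda>x::real. x)"
    by (rule smooth_linear) (rule bounded_linear_ident)
  show ?thesis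
    unfolding cutoff_def[abs_def]
    by (intro smooth_mult smooth_const smooth_compose[OF smooth_flat] smooth_diff id)
qed

lemma cutoff_nonneg: "0 \<le> cutoff x"
  by (simp add: cutoff_def flat_0_nonneg)

lemma cutoff_le_1: "cutoff x \<le> 1"
proof -
  have "flat 0 (1 - exp 1 * flat 0 (x - 1)) \<le> flat 0 1"
    by (rule flat_0_mono) (simp add: flat_0_nonneg)
  also have "\<dots> = 1 / exp 1" by (simp add: flat_0 exp_minus divide_inverse)
  finally show ?thesis by (simp add: cutoff_def field_simps)
qed

lemma cutoff_eq_1: "x \<le> 1 \<Longrightarrow> cutoff x = 1"
  by (simp add: cutoff_def flat_0 flip: exp_add)

lemma cutoff_eq_0:
  assumes "2 \<le> x" shows "cutoff x = 0"
proof -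
  have "flat 0 1 \<le> flat 0 (x - 1)"
    using assms by (intro flat_0_mono) auto
  moreover have "flat 0 1 = 1 / exp 1" by (simp add: flat_0 exp_minus divide_inverse)
  ultimately have "1 - exp 1 * flat 0 (x - 1) \<le> 0" by (simp add: field_simps)
  then show ?thesis by (simp add: cutoff_def flat_0)
qed

subsection \<open>Integration by parts on the half-space\<close>

text \<open>Equivalent to compactness of the closed support, in a form that passes to products,
  derivatives and finite sums without topological arguments.\<close>

definition bounded_support :: "('b::euclidean_space \<Rightarrow> real) \<Rightarrow> bool" where
  "bounded_support f \<longleftrightarrow> (\<exists>r. \<forall>z. r < norm z \<longrightarrow> f z = 0)"

lemma test_function_iff: "test_function f \<longleftrightarrow> smooth f \<and> bounded_support f"
proof -
  have "compact (closure {z. f z \<noteq> 0}) \<longleftrightarrow> bounded_support f"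
    unfolding compact_closure bounded_support_def bounded_iff
    by (auto simp: not_le) (metis linorder_not_le)+
  then show ?thesis by (simp add: test_function_def smooth_def)
qed

text \<open>The constant is arbitrary: 0 serves for supports, 1 for the plateau of the
  cutoff.\<close>

lemma partial_eq_0_open:
  assumes "open U" "z \<in> U" "\<And>w. w \<in> U \<Longrightarrow> f w = c"
  shows "partial b f z = 0"
proof -
  have "(f has_derivative (\<lambda>_. 0)) (at z)"
    by (rule has_derivative_transform_within_open[OF has_derivative_const assms(1,2)])
      (simp add: assms(3))
  then show ?thesis by (simp add: partial_eq)
qed

lemma bounded_support_partial [intro]:
  fixes f :: "'b::euclidean_space \<Rightarrow> real"
  assumes "bounded_support f" shows "bounded_support (partial b f)"
proof -
  obtain r where r: "\<And>z. r < norm z \<Longrightarrow> f z = 0"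
    using assms by (auto simp: bounded_support_def)
  have "open {z :: 'b. r < norm z}"
    by (intro open_Collect_less continuous_intros)
  then show ?thesis
    unfolding bounded_support_def using partial_eq_0_open[of "{z. r < norm z}" _ f 0] r by blast
qed

lemma bounded_support_mult [intro]: "bounded_support g \<Longrightarrow> bounded_support (\<lambda>z. f z * g z)"
  by (auto simp: bounded_support_def)

lemma bounded_support_minus [intro]: "bounded_support g \<Longrightarrow> bounded_support (\<lambda>z. - g z)"
  by (auto simp: bounded_support_def)

lemma bounded_support_sum:
  assumes "finite I" "\<And>i. i \<in> I \<Longrightarrow> bounded_support (f i)"
  shows "bounded_support (\<lambda>z. \<Sum>i\<in>I. f i z)"
proof -
  obtain r where r: "\<And>i z. i \<in> I \<Longrightarrow> r i < norm z \<Longrightarrow> f i z = 0"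
    using assms(2) unfolding bounded_support_def by metis
  have "f i z = 0" if "Max (insert 0 (r ` I)) < norm z" "i \<in> I" for i z
    using that assms(1) r by simp
  then show ?thesis
    unfolding bounded_support_def by (intro exI[of _ "Max (insert 0 (r ` I))"]) simp
qed

lemma bounded_support_laplacian [intro]: "bounded_support f \<Longrightarrow> bounded_support (laplacian f)"
  unfolding laplacian_def by (intro bounded_support_sum) auto

lemma bounded_support_polyharmonic [intro]:
  "bounded_support f \<Longrightarrow> bounded_support (polyharmonic m f)"
  by (induction m) (auto simp: polyharmonic_Suc)

lemma smooth_borel [measurable_dest]: "smooth f \<Longrightarrow> f \<in> borel_measurable borel"
  using smooth_continuous borel_measurable_continuous_onI by blast

lemma integrable_bounded_support:
  fixes f :: "'b::euclidean_space \<Rightarrow> real"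
  assumes "continuous_on UNIV f" "bounded_support f"
  shows "integrable lborel f"
proof -
  obtain r where r: "\<And>z. r < norm z \<Longrightarrow> f z = 0"
    using assms by (auto simp: bounded_support_def)
  have "integrable lborel (\<lambda>x. indicator (cball 0 r) x *\<^sub>R f x)"
    by (intro borel_integrable_compact) (auto intro: continuous_on_subset[OF assms(1)])
  also have "(\<lambda>x. indicator (cball 0 r) x *\<^sub>R f x) = f"
    using r by (force simp: indicator_def)
  finally show ?thesis .
qed

lemma bounded_of_bounded_support:
  fixes f :: "'b::euclidean_space \<Rightarrow> real"
  assumes "continuous_on UNIV f" "bounded_support f"
  obtains B where "0 \<le> B" "\<And>z. \<bar>f z\<bar> \<le> B"
proof -
  obtain r where r: "\<And>z. r < norm z \<Longrightarrow> f z = 0"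
    using assms by (auto simp: bounded_support_def)
  have "compact (f ` cball 0 r)"
    by (intro compact_continuous_image) (auto intro: continuous_on_subset[OF assms(1)])
  then obtain B where B: "\<And>z. norm z \<le> r \<Longrightarrow> \<bar>f z\<bar> \<le> B"
    using compact_imp_bounded[of "f ` cball 0 r"] by (fastforce simp: bounded_iff)
  have "\<bar>f z\<bar> \<le> max B 0" for z
    using B[of z] r[of z] by (cases "norm z \<le> r") auto
  then show ?thesis by (intro that[of "max B 0"]) auto
qed

lemma halfspace_borel [measurable]: "halfspace \<in> sets (borel :: ('a::euclidean_space \<times> real) measure)"
  unfolding halfspace_def by (intro borel_open open_Times) auto

lemma in_halfspace [simp]: "(x, t) \<in> halfspace \<longleftrightarrow> 0 < t"
  by (auto simp: halfspace_def)

lemma mem_halfspace_iff: "z \<in> halfspace \<longleftrightarrow> 0 < snd z"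
  by (cases z) simp

text \<open>Taken over \<open>lborel\<close>, where Fubini and translation invariance are at hand;
  \<open>set_lebesgue_halfspace\<close> returns to \<open>lebesgue\<close>.\<close>

definition half_integral :: "('a::euclidean_space \<times> real \<Rightarrow> real) \<Rightarrow> real" where
  "half_integral f = (LINT z|lborel. indicator halfspace z * f z)"

lemma integrable_half: "integrable lborel f \<Longrightarrow> integrable lborel (\<lambda>z. indicator halfspace z * f z)"
  for f :: "'a::euclidean_space \<times> real \<Rightarrow> real"
  using integrable_mult_indicator[of halfspace lborel f] by simp

lemma integrable_half_smooth:
  fixes f g :: "'a::euclidean_space \<times> real \<Rightarrow> real"
  assumes "smooth f" "smooth g" "bounded_support g"
  shows "integrable lborel (\<lambda>z. indicator halfspace z * (f z * g z))"
  by (intro integrable_half integrable_bounded_support smooth_continuous smooth_mult assms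
      bounded_support_mult)

lemma half_integral_add:
  assumes "integrable lborel (\<lambda>z. indicator halfspace z * f z)"
    "integrable lborel (\<lambda>z. indicator halfspace z * g z)"
  shows "half_integral (\<lambda>z. f z + g z) = half_integral f + half_integral g"
  unfolding half_integral_def using Bochner_Integration.integral_add[OF assms]
  by (simp add: algebra_simps)

lemma half_integral_cmult: "half_integral (\<lambda>z. c * f z) = c * half_integral f"
  unfolding half_integral_def by (simp add: mult.left_commute)

lemma half_integral_minus: "half_integral (\<lambda>z. - f z) = - half_integral f"
  using half_integral_cmult[of "-1" f] by simp

lemma half_integral_sum:
  "finite I \<Longrightarrow> (\<And>i. i \<in> I \<Longrightarrow> integrable lborel (\<lambda>z. indicator halfspace z * f i z)) \<Longrightarrow>
    half_integral (\<lambda>z. \<Sum>i\<in>I. f i z) = (\<Sum>i\<in>I. half_integral (f i))"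
  unfolding half_integral_def sum_distrib_left by (rule Bochner_Integration.integral_sum)

lemma DERIV_line:
  fixes f :: "'b::euclidean_space \<Rightarrow> real"
  assumes "smooth f"
  shows "((\<lambda>t. f (z + t *\<^sub>R b)) has_real_derivative partial b f (z + t *\<^sub>R b)) (at t)"
proof -
  have lin: "partial (h *\<^sub>R b) f w = h * partial b f w" for h w
    using linear_scale[OF has_derivative_linear[OF smooth_has_derivative[OF assms]]] by simp
  have "((\<lambda>t. z + t *\<^sub>R b) has_derivative (\<lambda>h. h *\<^sub>R b)) (at t)"
    by (auto intro!: derivative_eq_intros)
  from has_derivative_compose[OF this smooth_has_derivative[OF assms]]
  show ?thesis by (simp add: has_field_derivative_def lin mult.commute[of _ "partial b f _"])
qed

text \<open>The half-space is invariant under spatial translations, so the difference quotients of \<open>F\<close>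
  have integral zero.\<close>

lemma half_integral_partial:
  fixes F :: "'a::euclidean_space \<times> real \<Rightarrow> real"
  assumes F: "smooth F" "bounded_support F" and b: "b \<in> Basis"
  shows "half_integral (partial (b, 0) F) = 0"
proof -
  let ?e = "(b, 0) :: 'a \<times> real"
  have e: "?e \<in> Basis" "norm ?e = 1" using b by (auto simp: norm_Pair)
  define h where "h n = inverse (real (Suc n))" for n
  have h: "0 < h n" "h n \<le> 1" for n by (auto simp: h_def field_simps)
  have h0: "h \<longlonglongrightarrow> 0" unfolding h_def by (rule LIMSEQ_inverse_real_of_nat)
  have cont: "continuous_on UNIV (partial ?e F)"
    using F e(1) by (intro smooth_continuous smooth_partial)
  obtain B where B: "0 \<le> B" "\<And>z. \<bar>partial ?e F z\<bar> \<le> B"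
    using bounded_of_bounded_support[OF cont bounded_support_partial[OF F(2)]] by blast
  obtain r where r: "\<And>z. r < norm z \<Longrightarrow> F z = 0"
    using F(2) by (auto simp: bounded_support_def)
  have Fi: "integrable lborel F" using F smooth_continuous by (blast intro: integrable_bounded_support)
  note [measurable] = F(1)[THEN smooth_borel] smooth_partial[OF F(1) e(1), THEN smooth_borel]
  define s where "s n z = indicator halfspace z * ((F (z + h n *\<^sub>R ?e) - F z) / h n)" for n z
  \<comment> \<open>As \<open>h n \<le> 1\<close> and \<open>?e\<close> is a unit vector, a shift
    moves the support by at most 1, so one ball of radius \<open>r + 1\<close> carries all the
    difference quotients.\<close>
  have quot: "\<bar>(F (z + h n *\<^sub>R ?e) - F z) / h n\<bar> \<le> B * indicator (cball 0 (r + 1)) z" for n z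
  proof (cases "norm z \<le> r + 1")
    case True
    obtain y where "F (z + h n *\<^sub>R ?e) - F (z + 0 *\<^sub>R ?e) = (h n - 0) * partial ?e F (z + y *\<^sub>R ?e)"
      using MVT2[of 0 "h n" "\<lambda>t. F (z + t *\<^sub>R ?e)", OF h(1) DERIV_line[OF F(1)]] by blast
    then show ?thesis
      using B(2) h(1)[of n] True by (simp add: abs_mult del: scaleR_Pair)
  next
    case False
    have "norm (z + h n *\<^sub>R ?e) \<ge> norm z - 1"
      using norm_diff_ineq[of z "h n *\<^sub>R ?e"] h[of n] e(2) by (simp del: scaleR_Pair)
    then show ?thesis using False r by (simp del: scaleR_Pair)
  qed
  have "(\<lambda>n. LINT z|lborel. s n z) \<longlonglongrightarrow> (LINT z|lborel. indicator halfspace z * partial ?e F z)"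
  proof (rule integral_dominated_convergence)
    show "integrable lborel (\<lambda>z. B * indicator (cball 0 (r + 1)) z :: real)"
      by (intro integrable_mult_right integrable_real_indicator emeasure_lborel_cball_finite) auto
    show "AE z in lborel. norm (s n z) \<le> B * indicator (cball 0 (r + 1)) z" for n
    proof (intro AE_I2)
      fix z
      have "norm (s n z) \<le> \<bar>(F (z + h n *\<^sub>R ?e) - F z) / h n\<bar>"
        by (simp add: s_def indicator_def del: scaleR_Pair)
      then show "norm (s n z) \<le> B * indicator (cball 0 (r + 1)) z"
        using quot[of z n] by (rule order_trans)
    qed
    have "(\<lambda>n. (F (z + h n *\<^sub>R ?e) - F z) / h n) \<longlonglongrightarrow> partial ?e F z" for z
    proof -
      have "((\<lambda>t. (F (z + t *\<^sub>R ?e) - F z) / t) \<longlongrightarrow> partial ?e F z) (at 0)"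
        using DERIV_line[OF F(1), of z ?e 0] by (simp add: DERIV_def del: scaleR_Pair)
      moreover have "filterlim h (at 0) sequentially"
        using h h0 by (auto simp: filterlim_at order_less_imp_not_eq2)
      ultimately show ?thesis by (rule filterlim_compose)
    qed
    then show "AE z in lborel. (\<lambda>n. s n z) \<longlonglongrightarrow> indicator halfspace z * partial ?e F z"
      unfolding s_def by (intro AE_I2 tendsto_mult tendsto_const) auto
  qed (auto simp: s_def)
  moreover have "(LINT z|lborel. s n z) = 0" for n
  proof -
    define G where "G z = indicator halfspace z * F z" for z
    have G: "integrable lborel G" unfolding G_def using Fi by (rule integrable_half)
    have [measurable]: "G \<in> borel_measurable borel" unfolding G_def by measurable
    have Gt: "integrable lborel (\<lambda>z. G (h n *\<^sub>R ?e + z))"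
      "(LINT z|lborel. G (h n *\<^sub>R ?e + z)) = (LINT z|lborel. G z)"
    proof -
      have "integrable (distr lborel borel ((+) (h n *\<^sub>R ?e))) G"
        using G by (simp add: lborel_distr_plus)
      then show "integrable lborel (\<lambda>z. G (h n *\<^sub>R ?e + z))"
        by (subst (asm) integrable_distr_eq) auto
      have "(LINT z|distr lborel borel ((+) (h n *\<^sub>R ?e)). G z) = (LINT z|lborel. G z)"
        by (simp only: lborel_distr_plus)
      then show "(LINT z|lborel. G (h n *\<^sub>R ?e + z)) = (LINT z|lborel. G z)"
        by (subst (asm) integral_distr) auto
    qed
    have "s n z = (G (h n *\<^sub>R ?e + z) - G z) / h n" for z
      by (auto simp: s_def G_def indicator_def mem_halfspace_iff add.commute)
    then show ?thesis using G Gt by simp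
  qed
  ultimately show ?thesis
    unfolding half_integral_def by (simp add: LIMSEQ_const_iff)
qed

text \<open>The derivative of the product has integral zero. The product inherits bounded support
  from \<open>g\<close> alone, so \<open>f\<close> may be a function without zeros such as
  \<open>bracket_st a\<close>.\<close>

lemma half_integral_by_parts:
  fixes f g :: "'a::euclidean_space \<times> real \<Rightarrow> real"
  assumes f: "smooth f" and g: "smooth g" "bounded_support g" and b: "b \<in> Basis"
  shows "half_integral (\<lambda>z. f z * partial (b, 0) g z) = - half_integral (\<lambda>z. partial (b, 0) f z * g z)"
proof -
  have "(b, 0) \<in> (Basis :: ('a \<times> real) set)" using b by auto
  note p = smooth_partial[OF _ this]
  have "0 = half_integral (partial (b, 0) (\<lambda>z. f z * g z))"
    using assms by (intro half_integral_partial[symmetric]) auto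
  also have "\<dots> = half_integral (\<lambda>z. f z * partial (b, 0) g z + partial (b, 0) f z * g z)"
    using f g(1) by (simp add: partial_mult)
  also have "\<dots> = half_integral (\<lambda>z. f z * partial (b, 0) g z) + half_integral (\<lambda>z. partial (b, 0) f z * g z)"
    using p f g by (intro half_integral_add integrable_half_smooth) auto
  finally show ?thesis by simp
qed

lemma half_integral_laplacian:
  fixes f g :: "'a::euclidean_space \<times> real \<Rightarrow> real"
  assumes f: "smooth f" and g: "smooth g" "bounded_support g"
  shows "half_integral (\<lambda>z. f z * laplacian g z) = half_integral (\<lambda>z. laplacian f z * g z)"
proof -
  have p: "smooth (partial (b, 0) u)" if "smooth u" "b \<in> Basis" for u and b :: 'a
    using that by (intro smooth_partial) auto
  have "half_integral (\<lambda>z. f z * laplacian g z)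
      = (\<Sum>b\<in>Basis. half_integral (\<lambda>z. f z * partial (b, 0) (partial (b, 0) g) z))"
    unfolding laplacian_def sum_distrib_left
    using f g p by (intro half_integral_sum integrable_half_smooth) auto
  also have "\<dots> = (\<Sum>b\<in>Basis. half_integral (\<lambda>z. partial (b, 0) (partial (b, 0) f) z * g z))"
  proof (intro sum.cong refl)
    fix b :: 'a assume b: "b \<in> Basis"
    have "half_integral (\<lambda>z. f z * partial (b, 0) (partial (b, 0) g) z)
        = - half_integral (\<lambda>z. partial (b, 0) f z * partial (b, 0) g z)"
      using f g b p by (intro half_integral_by_parts) auto
    also have "\<dots> = half_integral (\<lambda>z. partial (b, 0) (partial (b, 0) f) z * g z)"
      using f g b p by (subst half_integral_by_parts) auto
    finally show "half_integral (\<lambda>z. f z * partial (b, 0) (partial (b, 0) g) z)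
        = half_integral (\<lambda>z. partial (b, 0) (partial (b, 0) f) z * g z)" .
  qed
  also have "\<dots> = half_integral (\<lambda>z. laplacian f z * g z)"
    unfolding laplacian_def sum_distrib_right
    using f g p by (intro half_integral_sum[symmetric] integrable_half_smooth) auto
  finally show ?thesis .
qed

lemma half_integral_polyharmonic:
  fixes f g :: "'a::euclidean_space \<times> real \<Rightarrow> real"
  assumes "smooth f" and "smooth g" "bounded_support g"
  shows "half_integral (\<lambda>z. f z * polyharmonic m g z) = half_integral (\<lambda>z. polyharmonic m f z * g z)"
  using assms
\<comment> \<open>\<open>f\<close> is generalised because each step moves the outermost Laplacian of
  \<open>g\<close> onto \<open>f\<close>, where it becomes the innermost one;
  \<open>polyharmonic_Suc'\<close> reassembles the iterate.\<close>
proof (induction m arbitrary: f)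
  case (Suc m)
  have "half_integral (\<lambda>z. f z * polyharmonic (Suc m) g z)
      = - half_integral (\<lambda>z. f z * laplacian (polyharmonic m g) z)"
    by (simp add: polyharmonic_Suc flip: half_integral_minus)
  also have "\<dots> = - half_integral (\<lambda>z. laplacian f z * polyharmonic m g z)"
    using Suc.prems by (subst half_integral_laplacian) auto
  also have "\<dots> = half_integral (\<lambda>z. (- laplacian f z) * polyharmonic m g z)"
    by (simp flip: half_integral_minus)
  also have "\<dots> = half_integral (\<lambda>z. polyharmonic m (\<lambda>z. - laplacian f z) z * g z)"
    using Suc.prems by (intro Suc.IH) auto
  finally show ?case by (simp only: polyharmonic_Suc')
qed simp

text \<open>As \<open>U\<close> does not depend on time, Fubini leaves the fundamental theorem of
  calculus on each vertical line. The boundary value at time 0 is the term through which initial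
  data enter the weak formulation.\<close>

lemma half_integral_time_deriv:
  fixes U :: "'a::euclidean_space \<Rightarrow> real" and g :: "'a \<times> real \<Rightarrow> real"
  assumes U: "smooth (\<lambda>z::'a \<times> real. U (fst z))" and g: "smooth g" "bounded_support g"
  shows "half_integral (\<lambda>z. U (fst z) * time_deriv g z) = - (LINT x|lborel. U x * g (x, 0))"
proof -
  obtain r where r: "\<And>z. r < norm z \<Longrightarrow> g z = 0"
    using g(2) by (auto simp: bounded_support_def)
  \<comment> \<open>Since the norm of \<open>(x, t)\<close> is at least
    \<open>\<bar>t\<bar>\<close>, \<open>g\<close> vanishes from time \<open>T\<close> on, uniformly
    in \<open>x\<close>.\<close>
  define T where "T = \<bar>r\<bar> + 1"
  have T: "T > 0" "g (x, t) = 0" if "t \<ge> T" for x t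
  proof -
    show "g (x, t) = 0"
      using norm_snd_le[of t x] that by (intro r) (auto simp: T_def)
  qed (simp add: T_def)
  have T0: "T > 0" by (simp add: T_def)
  have "smooth (time_deriv g)" "bounded_support (time_deriv g)"
    using g by (auto, simp add: time_deriv_def bounded_support_partial)
  then have "integrable lborel (\<lambda>z. indicator halfspace z * (U (fst z) * time_deriv g z))"
    using U by (intro integrable_half_smooth)
  then have "half_integral (\<lambda>z. U (fst z) * time_deriv g z)
    = (LINT x|lborel. LINT t|lborel. indicator halfspace (x, t) * (U x * time_deriv g (x, t)))"
    unfolding half_integral_def
    using lborel_pair.integral_fst'[of "\<lambda>z. indicator halfspace z * (U (fst z) * time_deriv g z)", symmetric]
    by (simp add: lborel_prod)
  also have "\<dots> = (LINT x|lborel. U x * (- g (x, 0)))"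
  proof (intro Bochner_Integration.integral_cong refl)
    fix x
    have D: "((\<lambda>t. g (x, t)) has_real_derivative time_deriv g (x, t)) (at t)" for t
      using DERIV_line[OF g(1), of "(x, 0)" "(0, 1)" t] by (simp add: time_deriv_def)
    have c: "isCont (\<lambda>t. time_deriv g (x, t)) t" for t
    proof -
      have "continuous_on UNIV (\<lambda>t. time_deriv g (x, t))"
        using g(1) by (intro continuous_on_compose2[OF smooth_continuous[of "time_deriv g"]])
          (auto intro!: continuous_intros)
      then show ?thesis by (simp add: continuous_on_eq_continuous_at)
    qed
    have "(LINT t|lborel. indicator halfspace (x, t) * (U x * time_deriv g (x, t)))
      = (LINT t|lborel. U x * (time_deriv g (x, t) * indicator {0..T} t))"
    \<comment> \<open>The half-space excludes time 0 while the interval \<open>{0..T}\<close>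
      contains it, so the integrands agree only off this one point.\<close>
    proof (intro integral_cong_AE)
      have "time_deriv g (x, t) = 0" if "t > T" for t
        unfolding time_deriv_def
      proof (rule partial_eq_0_open)
        show "open (UNIV \<times> {T<..} :: ('a \<times> real) set)" by (intro open_Times) auto
      qed (use that T in auto)
      then have "indicator halfspace (x, t) * (U x * time_deriv g (x, t))
          = U x * (time_deriv g (x, t) * indicator {0..T} t)" if "t \<noteq> 0" for t
        using that by (cases "t > T") (auto simp: indicator_def)
      then show "AE t in lborel. indicator halfspace (x, t) * (U x * time_deriv g (x, t))
          = U x * (time_deriv g (x, t) * indicator {0..T} t)"
        by (rule eventually_mono[OF AE_lborel_singleton[of "0::real"]])
      have [measurable]: "(\<lambda>t. time_deriv g (x, t)) \<in> borel_measurable borel"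
        using c by (intro borel_measurable_continuous_onI continuous_at_imp_continuous_on) auto
      have [measurable]: "(\<lambda>t. indicator halfspace (x, t) :: real) \<in> borel_measurable borel"
      proof -
        have "(\<lambda>t. indicator halfspace (x, t) :: real) = indicator {0<..}"
          by (auto simp: indicator_def)
        then show ?thesis by simp
      qed
      show "(\<lambda>t. indicator halfspace (x, t) * (U x * time_deriv g (x, t))) \<in> borel_measurable lborel"
        by simp
      show "(\<lambda>t. U x * (time_deriv g (x, t) * indicator {0..T} t)) \<in> borel_measurable lborel"
        by simp
    qed
    also have "\<dots> = U x * (g (x, T) - g (x, 0))"
      using T0 D c by (subst integral_mult_right_zero, subst integral_FTC_Icc_real[where F = "\<lambda>t. g (x, t)"]) auto
    finally show "(LINT t|lborel. indicator halfspace (x, t) * (U x * time_deriv g (x, t)))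
        = U x * (- g (x, 0))"
      using T by simp
  qed
  finally show ?thesis by simp
qed

subsection \<open>Iterated Laplacians of powers of 1 + |x|^2\<close>

text \<open>The index is half the decay rate: \<open>bracket a x\<close> is comparable to
  \<open>(1 + norm x) powr (- 2 * a)\<close>.\<close>

definition bracket :: "real \<Rightarrow> 'a::euclidean_space \<Rightarrow> real" where
  "bracket a x = (1 + (norm x)\<^sup>2) powr (- a)"

abbreviation bracket_st :: "real \<Rightarrow> 'a::euclidean_space \<times> real \<Rightarrow> real" where
  "bracket_st a \<equiv> \<lambda>z. bracket a (fst z)"

lemma one_plus_norm_pos [simp]: "0 < 1 + (norm x)\<^sup>2" "1 + (norm x)\<^sup>2 \<noteq> 0"
  by (smt (verit) zero_le_power2)+

lemma bracket_pos [simp]: "0 < bracket a x"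
  by (simp add: bracket_def)

lemma bracket_mono: "a \<le> b \<Longrightarrow> bracket b x \<le> bracket a x"
  by (auto simp: bracket_def intro: powr_mono)

lemma bracket_mult: "bracket a x * bracket b x = bracket (a + b) x"
  by (simp add: bracket_def powr_add [symmetric] algebra_simps)

lemma bracket_powr: "bracket a x powr b = bracket (a * b) x"
  by (simp add: bracket_def powr_powr)

lemma bracket_st_has_derivative:
  "(bracket_st a has_derivative (\<lambda>h. - 2 * a * inner (fst z) (fst h) * bracket_st (a + 1) z)) (at z)"
proof -
  have "((\<lambda>z. 1 + inner (fst z) (fst z)) has_derivative (\<lambda>h. 2 * inner (fst z) (fst h))) (at z)"
    by (auto intro!: derivative_eq_intros simp: inner_commute)
  moreover have "((\<lambda>y. y powr (- a)) has_derivative (*) (- a * (1 + inner (fst z) (fst z)) powr (- a - 1)))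
      (at (1 + inner (fst z) (fst z)))"
    using has_real_derivative_powr[of "1 + inner (fst z) (fst z)" "- a"] one_plus_norm_pos[of "fst z"]
    by (simp add: has_field_derivative_def power2_norm_eq_inner)
  ultimately have "((\<lambda>z. (1 + inner (fst z) (fst z)) powr (- a)) has_derivative
      (\<lambda>h. (- a * (1 + inner (fst z) (fst z)) powr (- a - 1)) * (2 * inner (fst z) (fst h)))) (at z)"
    by (rule has_derivative_compose)
  moreover have "- (a + 1) = - a - 1" by simp
  ultimately show ?thesis
    unfolding bracket_def power2_norm_eq_inner by (simp only: mult_ac mult_minus_left mult_minus_right)
qed

lemma smooth_bracket_st: "smooth (bracket_st a :: 'a::euclidean_space \<times> real \<Rightarrow> real)"
  unfolding smooth_def
proof
  fix k show "C_class k (bracket_st a :: 'a \<times> real \<Rightarrow> real)"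
  proof (induction k arbitrary: a)
    case 0
    then show ?case
      using bracket_st_has_derivative by (auto intro!: continuous_at_imp_continuous_on has_derivative_continuous)
  next
    case (Suc k)
    have "bounded_linear (\<lambda>z :: 'a \<times> real. inner (fst z) (fst h))" for h :: "'a \<times> real"
      by (intro bounded_linear_inner_left_comp bounded_linear_fst)
    then show ?case
      by (intro C_class_SucI[where f' = "\<lambda>z h. - 2 * a * inner (fst z) (fst h) * bracket_st (a + 1) z"]
          bracket_st_has_derivative C_class_mult Suc.IH C_class_const C_class_linear)
  qed
qed

lemma partial_bracket_st:
  "partial (b, 0) (bracket_st a) = (\<lambda>z. - 2 * a * (inner (fst z) b * bracket_st (a + 1) z))"
  by (rule ext) (simp add: partial_eq[OF bracket_st_has_derivative])

text \<open>\<open>\<beta>\<close> is the index at which \<open>|x| powr (- 2 * \<beta>)\<close> is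
  harmonic away from the origin; for \<open>0 < a \<le> \<beta>\<close> both coefficients are
  nonnegative.\<close>

lemma neg_laplacian_bracket_st:
  fixes a :: real
  defines "\<beta> \<equiv> real DIM('a) / 2 - 1"
  shows "- laplacian (bracket_st a :: 'a::euclidean_space \<times> real \<Rightarrow> real) z =
    4 * a * (\<beta> - a) * bracket_st (a + 1) z + 4 * a * (a + 1) * bracket_st (a + 2) z"
proof -
  have lin: "bounded_linear (\<lambda>z :: 'a \<times> real. inner (fst z) b)" for b
    by (intro bounded_linear_inner_left_comp bounded_linear_fst)
  have sm: "smooth (\<lambda>z :: 'a \<times> real. inner (fst z) b)" for b
    by (rule smooth_linear[OF lin])
  have D: "partial (b, 0) (\<lambda>z :: 'a \<times> real. inner (fst z) b) z = 1" if "b \<in> Basis" for b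
    using that by (simp add: partial_eq[OF bounded_linear_imp_has_derivative[OF lin]])
  have second: "partial (b, 0) (partial (b, 0) (bracket_st a :: 'a \<times> real \<Rightarrow> real)) z =
      - 2 * a * (bracket_st (a + 1) z - 2 * (a + 1) * (inner (fst z) b)\<^sup>2 * bracket_st (a + 2) z)"
    if "b \<in> Basis" for b
    unfolding partial_bracket_st
    by (subst partial_cmult, intro smooth_mult sm smooth_bracket_st)
      (simp add: partial_mult[OF sm smooth_bracket_st] D[OF that] partial_bracket_st power2_eq_square algebra_simps)
  have sq: "(\<Sum>b\<in>Basis. (inner (fst z) b)\<^sup>2) = (norm (fst z))\<^sup>2"
    unfolding power2_norm_eq_inner euclidean_inner[of "fst z" "fst z"] by (simp add: power2_eq_square)
  \<comment> \<open>Writing \<open>|x|^2\<close> as \<open>(1 + |x|^2) - 1\<close> trades the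
    quadratic factor of the second derivatives for a shift of the index, so the family is closed
    under the Laplacian.\<close>
  have rel: "(norm (fst z))\<^sup>2 * bracket_st (a + 2) z = bracket_st (a + 1) z - bracket_st (a + 2) z"
  proof -
    have "(1 + (norm (fst z))\<^sup>2) * bracket_st (a + 2) z = bracket_st (a + 1) z"
    proof -
      have "bracket (- 1) (fst z) = 1 + (norm (fst z))\<^sup>2" "- 1 + (a + 2) = a + 1"
        by (simp_all add: bracket_def)
      then show ?thesis
        using bracket_mult[of "- 1" "fst z" "a + 2"] by metis
    qed
    then show ?thesis by (simp add: algebra_simps)
  qed
  have "laplacian (bracket_st a :: 'a \<times> real \<Rightarrow> real) z =
      (\<Sum>b\<in>Basis. - 2 * a * bracket_st (a + 1) z + 4 * a * (a + 1) * bracket_st (a + 2) z * (inner (fst z) b)\<^sup>2)"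
    unfolding laplacian_def by (intro sum.cong refl) (simp add: second algebra_simps)
  also have "\<dots> = real DIM('a) * (- 2 * a * bracket_st (a + 1) z) + 4 * a * (a + 1) * ((norm (fst z))\<^sup>2 * bracket_st (a + 2) z)"
    by (simp add: sum.distrib sum_subtractf sum_distrib_left[symmetric] sq)
  finally show ?thesis
    unfolding rel \<beta>_def by (simp add: algebra_simps)
qed

text \<open>Closed form for iterating \<open>neg_laplacian_bracket_st\<close>: it solves the
  two-term recurrence \<open>poly_coeff_Suc\<close>, where \<open>k\<close> counts the iterations
  that took the term raising the index by 2. In product form the signs can be read off.\<close>

definition poly_coeff :: "real \<Rightarrow> real \<Rightarrow> nat \<Rightarrow> nat \<Rightarrow> real" where
  "poly_coeff \<beta> a j k =
    4 ^ j * (\<Prod>i<j + k. a + real i) * real (j choose k) * (\<Prod>i\<in>{k..<j}. \<beta> - a - real i)"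

lemma poly_coeff_Suc:
  "poly_coeff \<beta> a (Suc j) (Suc k) =
    4 * (a + real (j + Suc k)) * (\<beta> - (a + real (j + Suc k))) * poly_coeff \<beta> a j (Suc k)
    + 4 * (a + real (j + k)) * (a + real (j + k) + 1) * poly_coeff \<beta> a j k"
proof -
  consider "k < j" | "k = j" | "j < k" by linarith
  then show ?thesis
  proof cases
    case 1
    define P where "P = (\<Prod>i<j + k. a + real i)"
    define Q where "Q = (\<Prod>i\<in>{Suc k..<j}. \<beta> - a - real i)"
    have Q1: "(\<Prod>i\<in>{k..<j}. \<beta> - a - real i) = (\<beta> - a - real k) * Q"
      using 1 by (simp add: Q_def prod.atLeast_Suc_lessThan)
    have Q2: "(\<Prod>i\<in>{Suc k..<Suc j}. \<beta> - a - real i) = (\<beta> - a - real j) * Q"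
      using 1 by (simp add: Q_def)
    have "Suc k * (j choose Suc k) = (j - k) * (j choose k)"
      by (simp only: binomial_absorption binomial_absorb_comp)
    then have "real (Suc k * (j choose Suc k)) = real ((j - k) * (j choose k))" by simp
    then have binom: "(real k + 1) * real (j choose Suc k) = (real j - real k) * real (j choose k)"
      using 1 by (simp add: of_nat_diff algebra_simps)
    \<comment> \<open>All three coefficients share the factor \<open>X\<close>. Pascal's rule on the
      left and the absorption identity \<open>binom\<close> reduce the claim to an identity linear
      in \<open>\<beta>\<close>.\<close>
    define X where "X = 4 * 4 ^ j * P * (a + real (j + k)) * (a + real (j + k) + 1) * Q"
    have "poly_coeff \<beta> a (Suc j) (Suc k) =
        X * ((real (j choose k) + real (j choose Suc k)) * (\<beta> - a - real j))"
      unfolding poly_coeff_def Q2 X_def P_def by (simp add: algebra_simps)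
    also have "(real (j choose k) + real (j choose Suc k)) * (\<beta> - a - real j) =
        (\<beta> - (a + real (j + Suc k))) * real (j choose Suc k) + (\<beta> - a - real k) * real (j choose k)"
      using binom by (simp add: algebra_simps)
    also have "X * \<dots> = 4 * (a + real (j + Suc k)) * (\<beta> - (a + real (j + Suc k))) * poly_coeff \<beta> a j (Suc k)
      + 4 * (a + real (j + k)) * (a + real (j + k) + 1) * poly_coeff \<beta> a j k"
      unfolding poly_coeff_def Q1 Q_def[symmetric] X_def P_def by (simp add: algebra_simps)
    finally show ?thesis .
  next
    case 2
    have "(\<Prod>i<Suc j + Suc j. a + real i)
        = (\<Prod>i<j + j. a + real i) * (a + real (j + j)) * (a + real (j + j) + 1)"
      by (simp add: algebra_simps)
    then show ?thesis
      unfolding poly_coeff_def 2 by (simp add: binomial_eq_0 algebra_simps)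
  qed (simp add: poly_coeff_def binomial_eq_0)
qed

lemma poly_coeff_Suc_0:
  "poly_coeff \<beta> a (Suc j) 0 = 4 * (a + real j) * (\<beta> - (a + real j)) * poly_coeff \<beta> a j 0"
  by (simp add: poly_coeff_def algebra_simps)

lemma laplacian_sum:
  fixes f :: "'i \<Rightarrow> 'a::euclidean_space \<times> real \<Rightarrow> real"
  assumes "\<And>i. i \<in> I \<Longrightarrow> smooth (f i)"
  shows "laplacian (\<lambda>z. \<Sum>i\<in>I. c i * f i z) = (\<lambda>z. \<Sum>i\<in>I. c i * laplacian (f i) z)"
proof -
  have 1: "partial b (\<lambda>z. \<Sum>i\<in>I. c i * g i z) = (\<lambda>z. \<Sum>i\<in>I. c i * partial b (g i) z)"
    if "\<And>i. i \<in> I \<Longrightarrow> smooth (g i)" for b and g :: "'i \<Rightarrow> 'a \<times> real \<Rightarrow> real"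
    using that by (simp add: partial_sum partial_cmult smooth_mult)
  have 2: "smooth (partial (b, 0) (f i))" if "i \<in> I" "b \<in> Basis" for b i
    using assms that by (intro smooth_partial) auto
  show ?thesis
    unfolding laplacian_def using assms 2
    by (simp add: 1 sum_distrib_left) (subst sum.swap, rule refl)
qed

lemma polyharmonic_bracket_st:
  fixes a :: real
  defines "\<beta> \<equiv> real DIM('a) / 2 - 1"
  shows "polyharmonic j (bracket_st a :: 'a::euclidean_space \<times> real \<Rightarrow> real) =
    (\<lambda>z. \<Sum>k\<le>j. poly_coeff \<beta> a j k * bracket_st (a + real (j + k)) z)"
proof (induction j)
  case 0
  then show ?case by (simp add: poly_coeff_def)
next
  case (Suc j)
  let ?c = "poly_coeff \<beta> a"
  show ?case
  proof
    fix z :: "'a \<times> real"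
    define g where "g k = bracket_st (a + real (Suc j + k)) z" for k
    define A where "A k = 4 * (a + real (j + k)) * (\<beta> - (a + real (j + k))) * ?c j k" for k
    define B where "B k = 4 * (a + real (j + k)) * (a + real (j + k) + 1) * ?c j k" for k
    \<comment> \<open>The binomial coefficient in \<open>A (Suc j)\<close> is zero, so the first sum
      may be extended by one term and then shifted to line up with the second.\<close>
    have A0: "A (Suc j) = 0" by (simp add: A_def poly_coeff_def)
    have "polyharmonic (Suc j) (bracket_st a) z = (\<Sum>k\<le>j. ?c j k * (- laplacian (bracket_st (a + real (j + k))) z))"
      unfolding polyharmonic_Suc Suc.IH
      by (subst laplacian_sum[OF smooth_bracket_st]) (simp add: sum_negf)
    also have "\<dots> = (\<Sum>k\<le>j. A k * g k) + (\<Sum>k\<le>j. B k * g (Suc k))"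
      unfolding neg_laplacian_bracket_st sum.distrib[symmetric]
      by (intro sum.cong refl) (simp add: A_def B_def g_def \<beta>_def algebra_simps)
    also have "(\<Sum>k\<le>j. A k * g k) = (\<Sum>k\<le>Suc j. A k * g k)"
      using A0 by simp
    also have "(\<Sum>k\<le>Suc j. A k * g k) = A 0 * g 0 + (\<Sum>k\<le>j. A (Suc k) * g (Suc k))"
      by (rule sum.atMost_Suc_shift)
    also have "\<dots> + (\<Sum>k\<le>j. B k * g (Suc k)) = ?c (Suc j) 0 * g 0 + (\<Sum>k\<le>j. ?c (Suc j) (Suc k) * g (Suc k))"
      by (simp add: poly_coeff_Suc poly_coeff_Suc_0 A_def B_def sum.distrib[symmetric] algebra_simps)
    also have "\<dots> = (\<Sum>k\<le>Suc j. ?c (Suc j) k * g k)"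
      by (rule sum.atMost_Suc_shift[symmetric])
    finally show "polyharmonic (Suc j) (bracket_st a) z =
        (\<Sum>k\<le>Suc j. ?c (Suc j) k * bracket_st (a + real (Suc j + k)) z)"
      by (simp add: g_def)
  qed
qed

lemma polyharmonic_bracket_st_lower:
  fixes a :: real
  assumes "0 < a" "2 * a + 2 * real m < real DIM('a)"
  obtains c where "0 < c"
    "\<And>z :: 'a::euclidean_space \<times> real. c * bracket_st (a + real m) z \<le> polyharmonic m (bracket_st a) z"
proof -
  define \<beta> where "\<beta> = real DIM('a) / 2 - 1"
  \<comment> \<open>The smallest factor is the one with \<open>i = m - 1\<close>, equal to
    \<open>DIM('a) / 2 - a - m\<close>; this is where \<open>2 * a + 2 * m < DIM('a)\<close> comes
    from.\<close>
  have b: "0 < \<beta> - a - real i" if "i < m" for i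
    using that assms(2) by (auto simp: \<beta>_def field_simps)
  have nn: "0 \<le> poly_coeff \<beta> a m k" for k
    unfolding poly_coeff_def using assms(1) b
    by (intro mult_nonneg_nonneg prod_nonneg ballI) (auto intro: less_imp_le)
  have pos: "0 < poly_coeff \<beta> a m 0"
    unfolding poly_coeff_def using assms(1) b by (intro mult_pos_pos prod_pos) auto
  have "poly_coeff \<beta> a m 0 * bracket_st (a + real m) z \<le> polyharmonic m (bracket_st a) z" for z :: "'a \<times> real"
  proof -
    have "poly_coeff \<beta> a m 0 * bracket_st (a + real (m + 0)) z \<le>
        (\<Sum>k\<le>m. poly_coeff \<beta> a m k * bracket_st (a + real (m + k)) z)"
      by (rule member_le_sum[of 0 "{..m}" "\<lambda>k. poly_coeff \<beta> a m k * bracket_st (a + real (m + k)) z"])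
        (auto intro!: mult_nonneg_nonneg nn less_imp_le[OF bracket_pos])
    then show ?thesis by (simp add: polyharmonic_bracket_st \<beta>_def)
  qed
  with pos show ?thesis by (rule that)
qed

subsection \<open>Decay of Riesz potentials\<close>

lemma cball_borel [measurable]: "cball x r \<in> sets borel" for x :: "'a::euclidean_space"
  by (rule borel_closed) simp

text \<open>Sum over shells: \<open>f\<close> is dominated by \<open>\<Sum>n. a n * indicator (cball 0 (r n))\<close>.\<close>

lemma nn_integral_shells_finite:
  fixes f :: "'a::euclidean_space \<Rightarrow> real" and a r :: "nat \<Rightarrow> real"
  assumes shell: "\<And>z. z \<noteq> 0 \<Longrightarrow> 0 < f z \<Longrightarrow> \<exists>n. f z \<le> a n \<and> norm z \<le> r n"
    and nn: "\<And>n. 0 \<le> a n" "\<And>n. 0 \<le> r n" and sm: "summable (\<lambda>n. a n * r n ^ DIM('a))"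
  shows "(\<integral>\<^sup>+ z. ennreal (f z) \<partial>lborel) < \<infinity>"
proof -
  define c where "c = unit_ball_vol (real DIM('a))"
  have c: "0 \<le> c" by (simp add: c_def)
  have "(\<integral>\<^sup>+ z. ennreal (f z) \<partial>lborel)
      \<le> (\<integral>\<^sup>+ z. (\<Sum>n. ennreal (a n) * indicator (cball (0::'a) (r n)) z) \<partial>lborel)"
  proof (rule nn_integral_mono_AE, rule eventually_mono[OF AE_lborel_singleton[of 0]])
    fix z :: 'a assume z: "z \<noteq> 0"
    show "ennreal (f z) \<le> (\<Sum>n. ennreal (a n) * indicator (cball 0 (r n)) z)"
    proof (cases "0 < f z")
      case True
      then obtain n where n: "f z \<le> a n" "norm z \<le> r n" using shell z by blast
      have "ennreal (f z) \<le> (\<Sum>k\<in>{n}. ennreal (a k) * indicator (cball 0 (r k)) z)"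
        using n by (simp add: ennreal_leI)
      also have "\<dots> \<le> (\<Sum>n. ennreal (a n) * indicator (cball 0 (r n)) z)"
        by (rule sum_le_suminf) auto
      finally show ?thesis .
    next
      case False
      then show ?thesis by (simp add: ennreal_neg not_less)
    qed
  qed
  also have "\<dots> = (\<Sum>n. \<integral>\<^sup>+ z. ennreal (a n) * indicator (cball (0::'a) (r n)) z \<partial>lborel)"
    by (rule nn_integral_suminf) auto
  also have "\<dots> = (\<Sum>n. ennreal (c * (a n * r n ^ DIM('a))))"
  proof (rule arg_cong[where f = suminf], rule ext)
    fix n
    have "(\<integral>\<^sup>+ z. ennreal (a n) * indicator (cball (0::'a) (r n)) z \<partial>lborel)
        = ennreal (a n) * emeasure lborel (cball (0::'a) (r n))"
      by (simp add: nn_integral_cmult_indicator)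
    also have "\<dots> = ennreal (c * (a n * r n ^ DIM('a)))"
      using nn c by (simp add: emeasure_cball c_def ennreal_mult[symmetric] mult.left_commute)
    finally show "(\<integral>\<^sup>+ z. ennreal (a n) * indicator (cball (0::'a) (r n)) z \<partial>lborel)
        = ennreal (c * (a n * r n ^ DIM('a)))" .
  qed
  also have "\<dots> = ennreal (\<Sum>n. c * (a n * r n ^ DIM('a)))"
    using nn c sm by (intro suminf_ennreal2 summable_mult mult_nonneg_nonneg zero_le_power)
  finally show ?thesis by (rule le_less_trans) simp
qed

lemma nn_integral_riesz_kernel_finite:
  assumes "\<alpha> < real DIM('a)"
  shows "(\<integral>\<^sup>+ z. ennreal (indicator (cball 0 1) z * norm z powr (- \<alpha>)) \<partial>(lborel :: 'a::euclidean_space measure)) < \<infinity>"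
proof -
  \<comment> \<open>On the shell with \<open>norm z\<close> between
    \<open>2 powr (- (n + 1))\<close> and \<open>2 powr (- n)\<close> the kernel is at most
    \<open>2 powr (\<alpha> * (n + 1))\<close> or \<open>2 powr (\<alpha> * n)\<close>, according to
    the sign of \<open>\<alpha>\<close>; the maximum covers both cases.\<close>
  define a where "a n = max 1 (2 powr \<alpha>) * 2 powr (\<alpha> * real n)" for n :: nat
  define r where "r n = 2 powr (- real n)" for n :: nat
  define s where "s = (2::real) powr (\<alpha> - real DIM('a))"
  have "s < 1" using assms powr_less_mono[of "\<alpha> - real DIM('a)" 0 2] by (simp add: s_def)
  have rpow: "r n ^ DIM('a) = 2 powr (- real n * real DIM('a))" for n
    by (simp add: r_def powr_powr flip: powr_realpow)
  have "a n * r n ^ DIM('a) = max 1 (2 powr \<alpha>) * s ^ n" for n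
    unfolding a_def rpow s_def
    by (simp add: powr_realpow[symmetric] powr_powr mult.assoc powr_add[symmetric] algebra_simps)
  moreover have "summable (\<lambda>n. max 1 (2 powr \<alpha>) * s ^ n)"
    using \<open>s < 1\<close> by (intro summable_mult summable_geometric) (auto simp: s_def)
  ultimately have sm: "summable (\<lambda>n. a n * r n ^ DIM('a))" by simp
  show ?thesis
  proof (rule nn_integral_shells_finite[OF _ _ _ sm])
    fix z :: 'a assume z: "z \<noteq> 0" "0 < indicator (cball 0 1) z * norm z powr - \<alpha>"
    then have z1: "norm z \<le> 1" by (cases "norm z \<le> 1") auto
    define L where "L = - log 2 (norm z)"
    have L: "0 \<le> L" "norm z = 2 powr (- L)" using z z1 by (auto simp: L_def)
    define n where "n = nat \<lfloor>L\<rfloor>"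
    have n: "real n \<le> L" "L < real n + 1" using L(1) unfolding n_def by linarith+
    have "norm z powr - \<alpha> = 2 powr (\<alpha> * L)"
      by (simp add: L(2) powr_powr mult.commute)
    also have "\<dots> \<le> a n"
    proof (cases "0 \<le> \<alpha>")
      case True
      have "2 powr (\<alpha> * L) \<le> 2 powr (\<alpha> + \<alpha> * real n)"
      proof (rule powr_mono)
        show "\<alpha> * L \<le> \<alpha> + \<alpha> * real n"
          using mult_left_mono[of L "real n + 1" \<alpha>] n True by (simp add: algebra_simps)
      qed simp
      also have "\<dots> = 2 powr \<alpha> * 2 powr (\<alpha> * real n)" by (rule powr_add)
      also have "\<dots> \<le> a n" unfolding a_def by (intro mult_right_mono) auto
      finally show ?thesis .
    next
      case False
      have "2 powr (\<alpha> * L) \<le> 2 powr (\<alpha> * real n)"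
        using n False by (intro powr_mono mult_left_mono_neg) auto
      also have "\<dots> \<le> a n" unfolding a_def by (simp add: mult_le_cancel_right1)
      finally show ?thesis .
    qed
    finally have "norm z powr - \<alpha> \<le> a n" .
    moreover have "norm z \<le> r n" using n by (simp add: L(2) r_def)
    ultimately show "\<exists>n. indicator (cball 0 1) z * norm z powr - \<alpha> \<le> a n \<and> norm z \<le> r n"
      using z1 by (intro exI[of _ n]) simp
  qed (auto simp: a_def r_def)
qed

lemma nn_integral_decay_finite:
  assumes "real DIM('a) < \<beta>"
  shows "(\<integral>\<^sup>+ z. ennreal ((1 + norm z) powr (- \<beta>)) \<partial>(lborel :: 'a::euclidean_space measure)) < \<infinity>"
proof -
  define a where "a n = 2 powr (- \<beta> * real n)" for n :: nat
  \<comment> \<open>The shells are dyadic in \<open>1 + norm z\<close>; \<open>r n\<close> is the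
    upper end of the shell on which this quantity is at least \<open>2 powr n\<close>.\<close>
  define r where "r n = 2 powr (real n + 1)" for n :: nat
  define s where "s = (2::real) powr (real DIM('a) - \<beta>)"
  have "s < 1" using assms powr_less_mono[of "real DIM('a) - \<beta>" 0 2] by (simp add: s_def)
  have rpow: "r n ^ DIM('a) = 2 powr ((real n + 1) * real DIM('a))" for n
    by (simp add: r_def powr_powr flip: powr_realpow)
  have "a n * r n ^ DIM('a) = 2 powr real DIM('a) * s ^ n" for n
    unfolding a_def rpow s_def
    by (simp add: powr_realpow[symmetric] powr_powr powr_add[symmetric] algebra_simps)
  moreover have "summable (\<lambda>n. 2 powr real DIM('a) * s ^ n)"
    using \<open>s < 1\<close> by (intro summable_mult summable_geometric) (auto simp: s_def)
  ultimately have sm: "summable (\<lambda>n. a n * r n ^ DIM('a))" by simp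
  show ?thesis
  proof (rule nn_integral_shells_finite[OF _ _ _ sm])
    fix z :: 'a
    define L where "L = log 2 (1 + norm z)"
    have z0: "0 < 1 + norm z" using norm_ge_zero[of z] by linarith
    have L: "0 \<le> L" "1 + norm z = 2 powr L" using z0 by (auto simp: L_def)
    define n where "n = nat \<lfloor>L\<rfloor>"
    have n: "real n \<le> L" "L < real n + 1" using L(1) unfolding n_def by linarith+
    have "(1 + norm z) powr - \<beta> \<le> a n"
      unfolding L(2) a_def powr_powr
      using n assms by (intro powr_mono) (auto simp: mult.commute intro!: mult_left_mono)
    moreover have "1 + norm z \<le> r n"
      unfolding L(2) r_def using n by (intro powr_mono) auto
    ultimately show "\<exists>n. (1 + norm z) powr - \<beta> \<le> a n \<and> norm z \<le> r n"
      by (intro exI[of _ n]) simp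
  qed (auto simp: a_def r_def)
qed

text \<open>Evenness takes care of the reflection in \<open>x - y\<close>, leaving a plain
  translation.\<close>

lemma nn_integral_translate:
  fixes g :: "'a::euclidean_space \<Rightarrow> real"
  assumes [measurable]: "g \<in> borel_measurable borel" and even: "\<And>z. g (- z) = g z"
  shows "(\<integral>\<^sup>+ y. ennreal (g (x - y)) \<partial>lborel) = (\<integral>\<^sup>+ y. ennreal (g y) \<partial>lborel)"
proof -
  have "(\<integral>\<^sup>+ y. ennreal (g y) \<partial>lborel) = (\<integral>\<^sup>+ y. ennreal (g y) \<partial>distr lborel borel ((+) (- x)))"
    by (simp only: lborel_distr_plus)
  also have "\<dots> = (\<integral>\<^sup>+ y. ennreal (g (- x + y)) \<partial>lborel)"
    by (rule nn_integral_distr) auto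
  also have "\<dots> = (\<integral>\<^sup>+ y. ennreal (g (x - y)) \<partial>lborel)"
  proof -
    have "g (- x + y) = g (x - y)" for y
      using even[of "x - y"] by simp
    then show ?thesis by simp
  qed
  finally show ?thesis ..
qed

text \<open>Near the diagonal only the local singularity counts, integrable as
  \<open>a < DIM('a)\<close>. Away from it the integrand is controlled by the smaller of
  \<open>1 + norm (x - y)\<close> and \<open>1 + norm y\<close> raised to \<open>- (a + b)\<close>,
  and either of these has an integral independent of \<open>x\<close>.\<close>

lemma riesz_uniform_bound:
  fixes a b :: real
  assumes "0 \<le> a" "a < real DIM('a)" "0 < b" "real DIM('a) < a + b"
  obtains C where "0 \<le> C"
    "\<And>x :: 'a::euclidean_space.
      (\<integral>\<^sup>+ y. ennreal (norm (x - y) powr (- a) * (1 + norm y) powr (- b)) \<partial>lborel) \<le> ennreal C"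
proof -
  define g :: "'a \<Rightarrow> real" where "g z = indicator (cball 0 1) z * norm z powr (- a)" for z
  define h :: "'a \<Rightarrow> real" where "h z = (1 + norm z) powr (- (a + b))" for z
  have [measurable]: "g \<in> borel_measurable borel" unfolding g_def[abs_def] by measurable
  have [measurable]: "h \<in> borel_measurable borel" unfolding h_def[abs_def] by measurable
  have g0: "0 \<le> g z" and h0: "0 \<le> h z" for z by (auto simp: g_def h_def)
  define G where "G = (\<integral>\<^sup>+ z. ennreal (g z) \<partial>lborel)"
  define H where "H = (\<integral>\<^sup>+ z. ennreal (h z) \<partial>lborel)"
  have G: "G < \<infinity>" unfolding G_def g_def using assms by (intro nn_integral_riesz_kernel_finite)
  have H: "H < \<infinity>" unfolding H_def h_def using assms by (intro nn_integral_decay_finite)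
  have pt: "norm (x - y) powr (- a) * (1 + norm y) powr (- b) \<le> g (x - y) + 2 powr a * (h (x - y) + h y)"
    for x y :: 'a
  proof (cases "norm (x - y) \<le> 1")
    case True
    have "norm (x - y) powr (- a) * (1 + norm y) powr (- b) \<le> norm (x - y) powr (- a) * 1"
    proof (rule mult_left_mono)
      have "(1 + norm y) powr (- b) \<le> (1 + norm y) powr 0"
        using assms by (intro powr_mono) auto
      then show "(1 + norm y) powr (- b) \<le> 1"
        using norm_ge_zero[of y] by (simp split: if_splits)
    qed simp
    also have "\<dots> = g (x - y)" using True by (simp add: g_def)
    finally show ?thesis using h0[of y] h0[of "x - y"] by (smt (verit) mult_nonneg_nonneg powr_ge_zero)
  next
    case False
    define s where "s = 1 + norm (x - y)"
    define t where "t = 1 + norm y"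
    have st: "1 \<le> s" "1 \<le> t" by (auto simp: s_def t_def)
    \<comment> \<open>Here \<open>norm (x - y) > 1\<close>, hence
      \<open>norm (x - y) \<ge> s / 2\<close>; this is the source of the factor
      \<open>2 powr a\<close>.\<close>
    have "norm (x - y) powr (- a) \<le> (s / 2) powr (- a)"
      using False assms by (intro powr_mono2') (auto simp: s_def)
    also have "\<dots> = 2 powr a * s powr (- a)"
      using st by (simp add: powr_divide powr_minus divide_simps)
    finally have "norm (x - y) powr (- a) * t powr (- b) \<le> 2 powr a * s powr (- a) * t powr (- b)"
      by (intro mult_right_mono) auto
    also have "s powr (- a) * t powr (- b) \<le> h (x - y) + h y"
    proof (cases "s \<le> t")
      case True
      have "s powr (- a) * t powr (- b) \<le> s powr (- a) * s powr (- b)"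
        using True st assms by (intro mult_left_mono powr_mono2') auto
      also have "\<dots> = h (x - y)" by (simp add: h_def s_def powr_add[symmetric])
      finally show ?thesis using h0[of y] by simp
    next
      case False
      have "s powr (- a) * t powr (- b) \<le> t powr (- a) * t powr (- b)"
        using False st assms by (intro mult_right_mono powr_mono2') auto
      also have "\<dots> = h y" by (simp add: h_def t_def powr_add[symmetric])
      finally show ?thesis using h0[of "x - y"] by simp
    qed
    then have "2 powr a * s powr (- a) * t powr (- b) \<le> 2 powr a * (h (x - y) + h y)"
      by (simp add: mult.assoc)
    finally show ?thesis using g0[of "x - y"] by (simp add: t_def)
  qed
  have bound: "(\<integral>\<^sup>+ y. ennreal (norm (x - y) powr (- a) * (1 + norm y) powr (- b)) \<partial>lborel)
      \<le> G + ennreal (2 powr a) * (H + H)" for x :: 'a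
  proof -
    have "(\<integral>\<^sup>+ y. ennreal (norm (x - y) powr (- a) * (1 + norm y) powr (- b)) \<partial>lborel)
      \<le> (\<integral>\<^sup>+ y. ennreal (g (x - y)) + ennreal (2 powr a) * (ennreal (h (x - y)) + ennreal (h y)) \<partial>lborel)"
      using g0 h0 pt
      by (intro nn_integral_mono) (simp add: ennreal_plus[symmetric] ennreal_mult[symmetric] ennreal_leI del: ennreal_plus)
    also have "\<dots> = (\<integral>\<^sup>+ y. ennreal (g (x - y)) \<partial>lborel)
        + ennreal (2 powr a) * ((\<integral>\<^sup>+ y. ennreal (h (x - y)) \<partial>lborel) + (\<integral>\<^sup>+ y. ennreal (h y) \<partial>lborel))"
      by (subst nn_integral_add, simp, simp, subst nn_integral_cmult, simp, subst nn_integral_add) auto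
    also have "\<dots> = G + ennreal (2 powr a) * (H + H)"
      by (subst (1 2) nn_integral_translate) (auto simp: G_def H_def, auto simp: g_def h_def indicator_def)
    finally show ?thesis .
  qed
  have "G + ennreal (2 powr a) * (H + H) < \<infinity>"
    using G H by (auto simp: ennreal_mult_less_top)
  then obtain C where "0 \<le> C" "G + ennreal (2 powr a) * (H + H) = ennreal C"
    by (cases "G + ennreal (2 powr a) * (H + H)") auto
  with bound show ?thesis by (intro that[of C]) auto
qed

text \<open>Since \<open>1 + norm x \<le> (1 + norm y) + norm (x - y)\<close>, the weight \<open>(1 + norm x) powr \<delta>\<close> can be
  traded against either factor of the integrand.\<close>

lemma riesz_decay:
  fixes \<alpha> \<beta> \<delta> :: real
  assumes "0 < \<delta>" "\<delta> < \<alpha>" "\<alpha> < real DIM('a)" "\<delta> < \<beta> + \<alpha> - real DIM('a)"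
  obtains C where "0 \<le> C"
    "\<And>x :: 'a::euclidean_space.
      (\<integral>\<^sup>+ y. ennreal (norm (x - y) powr (- \<alpha>) * (1 + norm y) powr (- \<beta>)) \<partial>lborel)
        \<le> ennreal (C * (1 + norm x) powr (- \<delta>))"
proof -
  \<comment> \<open>\<open>A\<close> takes the weight out of the factor in \<open>y\<close>,
    \<open>B\<close> out of the kernel. The two upper bounds on \<open>\<delta>\<close> keep both
    exponent pairs within the range of \<open>riesz_uniform_bound\<close>.\<close>
  have A: "0 \<le> \<alpha>" "\<alpha> < real DIM('a)" "0 < \<beta> - \<delta>" "real DIM('a) < \<alpha> + (\<beta> - \<delta>)"
    and B: "0 \<le> \<alpha> - \<delta>" "\<alpha> - \<delta> < real DIM('a)" "0 < \<beta>" "real DIM('a) < \<alpha> - \<delta> + \<beta>"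
    using assms by linarith+
  obtain C1 where C1: "0 \<le> C1" "\<And>x :: 'a.
      (\<integral>\<^sup>+ y. ennreal (norm (x - y) powr (- \<alpha>) * (1 + norm y) powr (- (\<beta> - \<delta>))) \<partial>lborel) \<le> ennreal C1"
    using riesz_uniform_bound[OF A] by blast
  obtain C2 where C2: "0 \<le> C2" "\<And>x :: 'a.
      (\<integral>\<^sup>+ y. ennreal (norm (x - y) powr (- (\<alpha> - \<delta>)) * (1 + norm y) powr (- \<beta>)) \<partial>lborel) \<le> ennreal C2"
    using riesz_uniform_bound[OF B] by blast
  define C where "C = 2 powr \<delta> * (C1 + C2)"
  show ?thesis
  proof (rule that[of C])
    show "0 \<le> C" using C1(1) C2(1) by (simp add: C_def)
    fix x :: 'a
    define k where "k = 2 powr \<delta> * (1 + norm x) powr (- \<delta>)"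
    have k: "0 \<le> k" by (simp add: k_def)
    have pt: "norm (x - y) powr (- \<alpha>) * (1 + norm y) powr (- \<beta>) \<le>
        k * (norm (x - y) powr (- \<alpha>) * (1 + norm y) powr (- (\<beta> - \<delta>))
          + norm (x - y) powr (- (\<alpha> - \<delta>)) * (1 + norm y) powr (- \<beta>))" for y
    proof (cases "x = y")
      case False
      define s where "s = norm (x - y)"
      define t where "t = 1 + norm y"
      have st: "0 < s" "1 \<le> t" using False by (auto simp: s_def t_def)
      have x: "0 < 1 + norm x" using norm_ge_zero[of x] by linarith
      have "1 + norm x \<le> 2 * max s t"
        using norm_triangle_ineq[of "x - y" y] unfolding s_def t_def by (simp add: max_def)
      then have "(1 + norm x) powr \<delta> \<le> (2 * max s t) powr \<delta>"
        using assms x by (intro powr_mono2) auto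
      also have "\<dots> = 2 powr \<delta> * max s t powr \<delta>" using st by (simp add: powr_mult)
      also have "\<dots> \<le> 2 powr \<delta> * (t powr \<delta> + s powr \<delta>)"
        by (intro mult_left_mono) (auto simp: max_def)
      finally have "1 \<le> k * (t powr \<delta> + s powr \<delta>)"
        using x by (simp add: k_def powr_minus divide_simps)
      then have "s powr (- \<alpha>) * t powr (- \<beta>) * 1 \<le> s powr (- \<alpha>) * t powr (- \<beta>) * (k * (t powr \<delta> + s powr \<delta>))"
        by (intro mult_left_mono) auto
      also have "\<dots> = k * (s powr (- \<alpha>) * (t powr (- \<beta>) * t powr \<delta>) + (s powr (- \<alpha>) * s powr \<delta>) * t powr (- \<beta>))"
        by (simp add: algebra_simps)
      finally show ?thesis by (simp add: s_def t_def powr_add[symmetric])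
    qed (use k in auto)
    have "(\<integral>\<^sup>+ y. ennreal (norm (x - y) powr (- \<alpha>) * (1 + norm y) powr (- \<beta>)) \<partial>lborel)
      \<le> (\<integral>\<^sup>+ y. ennreal k * (ennreal (norm (x - y) powr (- \<alpha>) * (1 + norm y) powr (- (\<beta> - \<delta>)))
          + ennreal (norm (x - y) powr (- (\<alpha> - \<delta>)) * (1 + norm y) powr (- \<beta>))) \<partial>lborel)"
      using k pt
      by (intro nn_integral_mono) (simp add: ennreal_plus[symmetric] ennreal_mult[symmetric] ennreal_leI del: ennreal_plus)
    also have "\<dots> = ennreal k * ((\<integral>\<^sup>+ y. ennreal (norm (x - y) powr (- \<alpha>) * (1 + norm y) powr (- (\<beta> - \<delta>))) \<partial>lborel)
          + (\<integral>\<^sup>+ y. ennreal (norm (x - y) powr (- (\<alpha> - \<delta>)) * (1 + norm y) powr (- \<beta>)) \<partial>lborel))"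
      by (subst nn_integral_cmult, simp, subst nn_integral_add) auto
    also have "\<dots> \<le> ennreal k * (ennreal C1 + ennreal C2)"
      by (intro mult_left_mono add_mono C1 C2) auto
    also have "\<dots> = ennreal (C * (1 + norm x) powr (- \<delta>))"
      using k C1(1) C2(1)
      by (simp add: C_def k_def ennreal_plus[symmetric] ennreal_mult[symmetric] mult_ac del: ennreal_plus)
    finally show "(\<integral>\<^sup>+ y. ennreal (norm (x - y) powr (- \<alpha>) * (1 + norm y) powr (- \<beta>)) \<partial>lborel)
        \<le> ennreal (C * (1 + norm x) powr (- \<delta>))" .
  qed
qed

text \<open>With \<open>r = norm y\<close>, both sides of
  \<open>(1 + r)^2 / 2 \<le> 1 + r^2 \<le> (1 + r)^2\<close> are used: the left one for the
  integrand, costing \<open>2 powr b\<close>, the right one for the resulting bound.\<close>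

lemma riesz_bracket:
  fixes \<alpha> b \<delta> :: real
  assumes "0 < \<delta>" "\<delta> < \<alpha>" "\<alpha> < real DIM('a)" "\<delta> < 2 * b + \<alpha> - real DIM('a)"
  obtains C where "0 \<le> C"
    "\<And>x :: 'a::euclidean_space.
      (\<integral>\<^sup>+ y. ennreal (norm (x - y) powr (- \<alpha>) * bracket b y) \<partial>lborel) \<le> ennreal (C * bracket (\<delta> / 2) x)"
proof -
  have b: "0 < b" using assms by linarith
  obtain C where C: "0 \<le> C" "\<And>x :: 'a.
      (\<integral>\<^sup>+ y. ennreal (norm (x - y) powr (- \<alpha>) * (1 + norm y) powr (- (2 * b))) \<partial>lborel)
        \<le> ennreal (C * (1 + norm x) powr (- \<delta>))"
    using riesz_decay[OF assms] by blast
  have sq: "(1 + norm y) powr (- (2 * c)) = ((1 + norm y)\<^sup>2) powr (- c)" for c and y :: 'a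
  proof -
    have "0 < 1 + norm y" using norm_ge_zero[of y] by linarith
    then have "(1 + norm y)\<^sup>2 = (1 + norm y) powr 2" by (simp add: powr_numeral)
    then show ?thesis by (simp only: powr_powr) simp
  qed
  show ?thesis
  proof (rule that[of "2 powr b * C"])
    show "0 \<le> 2 powr b * C" using C by simp
    fix x :: 'a
    have up: "bracket b y \<le> 2 powr b * (1 + norm y) powr (- (2 * b))" for y :: 'a
    proof -
      have "(1 + norm y)\<^sup>2 / 2 \<le> 1 + (norm y)\<^sup>2"
        using sum_squares_bound[of 1 "norm y"] by (simp add: power2_eq_square algebra_simps)
      moreover have "0 < (1 + norm y)\<^sup>2" using norm_ge_zero[of y] by (intro zero_less_power) linarith
      ultimately have "(1 + (norm y)\<^sup>2) powr (- b) \<le> ((1 + norm y)\<^sup>2 / 2) powr (- b)"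
        using b by (intro powr_mono2') auto
      also have "\<dots> = 2 powr b * ((1 + norm y)\<^sup>2) powr (- b)"
        by (simp add: powr_divide powr_minus divide_simps)
      finally show ?thesis by (simp add: sq bracket_def)
    qed
    have low: "(1 + norm x) powr (- \<delta>) \<le> bracket (\<delta> / 2) x"
    proof -
      have "(1 + norm x) powr (- (2 * (\<delta> / 2))) \<le> bracket (\<delta> / 2) x"
        unfolding sq bracket_def using assms
        by (intro powr_mono2') (auto simp: power2_sum)
      then show ?thesis by simp
    qed
    have "(\<integral>\<^sup>+ y. ennreal (norm (x - y) powr (- \<alpha>) * bracket b y) \<partial>lborel)
      \<le> (\<integral>\<^sup>+ y. ennreal (2 powr b) * ennreal (norm (x - y) powr (- \<alpha>) * (1 + norm y) powr (- (2 * b))) \<partial>lborel)"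
    proof (intro nn_integral_mono)
      fix y :: 'a
      have "norm (x - y) powr (- \<alpha>) * bracket b y \<le> norm (x - y) powr (- \<alpha>) * (2 powr b * (1 + norm y) powr (- (2 * b)))"
        by (intro mult_left_mono up) auto
      then show "ennreal (norm (x - y) powr (- \<alpha>) * bracket b y)
        \<le> ennreal (2 powr b) * ennreal (norm (x - y) powr (- \<alpha>) * (1 + norm y) powr (- (2 * b)))"
        by (simp add: ennreal_mult[symmetric] ennreal_leI mult.left_commute)
    qed
    also have "\<dots> = ennreal (2 powr b) * (\<integral>\<^sup>+ y. ennreal (norm (x - y) powr (- \<alpha>) * (1 + norm y) powr (- (2 * b))) \<partial>lborel)"
      by (rule nn_integral_cmult) auto
    also have "\<dots> \<le> ennreal (2 powr b) * ennreal (C * bracket (\<delta> / 2) x)"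
      using C(1) low
      by (intro mult_left_mono order_trans[OF C(2)] ennreal_leI) auto
    also have "\<dots> = ennreal (2 powr b * C * bracket (\<delta> / 2) x)"
      using C(1) by (simp add: ennreal_mult[symmetric] less_imp_le mult.assoc)
    finally show "(\<integral>\<^sup>+ y. ennreal (norm (x - y) powr (- \<alpha>) * bracket b y) \<partial>lborel)
        \<le> ennreal (2 powr b * C * bracket (\<delta> / 2) x)" .
  qed
qed

subsection \<open>Existence\<close>

lemma bounded_support_time_deriv [intro]: "bounded_support f \<Longrightarrow> bounded_support (time_deriv f)"
  by (simp add: time_deriv_def bounded_support_partial)

section \<open>Passing between lebesgue and lborel integrals\<close>

lemma lebesgue_integrable_borel:
  "f \<in> borel_measurable borel \<Longrightarrow> integrable lebesgue f \<longleftrightarrow> integrable lborel f"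
  for f :: "'b::euclidean_space \<Rightarrow> real"
  by (rule integrable_completion) simp

lemma lebesgue_integral_borel:
  "f \<in> borel_measurable borel \<Longrightarrow> (LINT z|lebesgue. f z) = (LINT z|lborel. f z)"
  for f :: "'b::euclidean_space \<Rightarrow> real"
  by (rule integral_completion) simp

lemma locally_integrable_on_bounded:
  fixes f :: "'b::euclidean_space \<Rightarrow> real"
  assumes [measurable]: "f \<in> borel_measurable borel" and B: "\<And>z. \<bar>f z\<bar> \<le> B"
  shows "locally_integrable_on f S"
  unfolding locally_integrable_on_def set_integrable_def
proof (intro allI impI)
  fix K :: "'b set" assume "compact K \<and> K \<subseteq> S"
  then have K: "compact K" "K \<in> sets borel" by (auto intro: borel_compact)
  note [measurable] = K(2)
  have "integrable lborel (\<lambda>z. B * indicator K z :: real)"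
    using K emeasure_bounded_finite[OF compact_imp_bounded[OF K(1)]]
    by (intro integrable_mult_right integrable_real_indicator) auto
  then have "integrable lborel (\<lambda>z. indicator K z *\<^sub>R f z)"
    by (rule Bochner_Integration.integrable_bound)
      (auto simp: indicator_def intro!: AE_I2 order_trans[OF B abs_ge_self])
  then show "integrable lebesgue (\<lambda>z. indicator K z *\<^sub>R f z)"
    by (subst lebesgue_integrable_borel) auto
qed

lemma half_integral_mono:
  assumes "integrable lborel (\<lambda>z. indicator halfspace z * f z)"
    "integrable lborel (\<lambda>z. indicator halfspace z * g z)" "\<And>z. f z \<le> g z"
  shows "half_integral f \<le> half_integral g"
  unfolding half_integral_def using assms by (intro integral_mono) (auto intro: mult_left_mono)

lemma set_lebesgue_halfspace:
  fixes f :: "'a::euclidean_space \<times> real \<Rightarrow> real"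
  assumes [measurable]: "f \<in> borel_measurable borel"
  shows "set_integrable lebesgue halfspace f \<longleftrightarrow> integrable lborel (\<lambda>z. indicator halfspace z * f z)"
    and "(LINT z:halfspace|lebesgue. f z) = half_integral f"
  unfolding set_integrable_def set_lebesgue_integral_def half_integral_def
  by (subst lebesgue_integrable_borel, simp_all) (subst lebesgue_integral_borel, simp_all)

text \<open>A parameter choice near \<open>\<gamma> = N - 2 m\<close>, \<open>\<delta> = min \<alpha> (p * \<gamma> + \<alpha> - N)\<close>, where all conditions
  are strict.\<close>

lemma decay_exponents_exist:
  fixes N m p q \<alpha> :: real
  assumes "0 < p" "0 < q" "0 < \<alpha>" "\<alpha> < N" "2 * m < N" "0 \<le> m"
    and pq: "(N - \<alpha>) / (N - 2 * m) < p" "(N - \<alpha>) / (N - 2 * m) < q"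
    and sum: "(2 * N - \<alpha>) / (N - 2 * m) < p + q"
  obtains \<gamma> \<delta> where "0 < \<gamma>" "\<gamma> < N - 2 * m" "0 < \<delta>" "\<delta> < \<alpha>" "\<delta> < p * \<gamma> + \<alpha> - N"
    "\<gamma> + 2 * m \<le> q * \<gamma> + \<delta>"
proof -
  define D where "D = N - 2 * m"
  define M where "M = min \<alpha> (p * D + \<alpha> - N)"
  have D: "0 < D" using assms by (simp add: D_def)
  have "N - \<alpha> < p * D" "N - \<alpha> < q * D" "2 * N - \<alpha> < (p + q) * D"
    using pq sum D by (simp_all add: D_def[symmetric] pos_divide_less_eq)
  then have M: "0 < M" "N < q * D + M"
    using assms by (auto simp: M_def min_def algebra_simps)
  \<comment> \<open>With \<open>\<gamma> = D - e\<close> and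
    \<open>\<delta> = M - (p + 1) * e\<close> the three caps keep \<open>\<gamma>\<close> positive,
    keep \<open>\<delta>\<close> at least \<open>M / 2\<close>, and pay for the loss
    \<open>(p + q) * e\<close> in the last inequality. The extra 1 in \<open>p + 1\<close> makes the
    bound on \<open>\<delta>\<close> through \<open>p * \<gamma>\<close> strict.\<close>
  define e where "e = min (D / 2) (min (M / (2 * (p + 1))) ((q * D + M - N) / (p + q)))"
  have e: "0 < e" "e \<le> D / 2" "e \<le> M / (2 * (p + 1))" "e \<le> (q * D + M - N) / (p + q)"
    using D M assms(1,2) unfolding e_def
    by (simp, meson min.cobounded1 min.cobounded2 order_trans,
      meson min.cobounded1 min.cobounded2 order_trans, meson min.cobounded1 min.cobounded2 order_trans)
  have e': "2 * ((p + 1) * e) \<le> M" "(p + q) * e \<le> q * D + M - N"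
    using e(3,4) assms by (auto simp: pos_le_divide_eq algebra_simps)
  have pe: "0 < (p + 1) * e" using e assms by simp
  show ?thesis
  proof (rule that[of "D - e" "M - (p + 1) * e"])
    show "M - (p + 1) * e < p * (D - e) + \<alpha> - N"
    proof -
      have "M \<le> p * D + \<alpha> - N" by (simp add: M_def)
      then show ?thesis using e(1) by (simp add: algebra_simps)
    qed
    show "M - (p + 1) * e < \<alpha>"
      using pe by (simp add: M_def min_def)
    show "D - e + 2 * m \<le> q * (D - e) + (M - (p + 1) * e)"
      using e'(2) by (simp add: D_def algebra_simps)
  qed (use e e' pe D M in \<open>auto simp: D_def[symmetric]\<close>)
qed

theorem weak_solution_exists:
  fixes m :: nat and p q \<alpha> :: real
  assumes m: "2 * m < DIM('a::euclidean_space)" and p: "0 < p" and q: "0 < q"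
    and \<alpha>: "0 < \<alpha>" "\<alpha> < real DIM('a)"
    and mn: "min p q > (real DIM('a) - \<alpha>) / (real DIM('a) - 2 * real m)"
    and sum: "p + q > (2 * real DIM('a) - \<alpha>) / (real DIM('a) - 2 * real m)"
  shows "\<exists>(u\<^sub>0 :: 'a \<Rightarrow> real) u. weak_solution m \<alpha> p q u\<^sub>0 u \<and> (\<forall>z\<in>halfspace. 0 < u z)"
proof -
  obtain \<gamma> \<delta> where gd: "0 < \<gamma>" "\<gamma> < real DIM('a) - 2 * real m" "0 < \<delta>" "\<delta> < \<alpha>"
    "\<delta> < p * \<gamma> + \<alpha> - real DIM('a)" "\<gamma> + 2 * real m \<le> q * \<gamma> + \<delta>"
    by (rule decay_exponents_exist[of p q \<alpha> "real DIM('a)" "real m"]) (use assms in auto)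
  define a where "a = \<gamma> / 2"
  have a: "0 < a" "2 * a + 2 * real m < real DIM('a)" using gd by (auto simp: a_def)
  obtain c where c: "0 < c" "\<And>z :: 'a \<times> real. c * bracket_st (a + real m) z \<le> polyharmonic m (bracket_st a) z"
    using polyharmonic_bracket_st_lower[OF a] by blast
  have "\<delta> < 2 * (a * p) + \<alpha> - real DIM('a)" using gd by (simp add: a_def mult.commute)
  then obtain C where C: "0 \<le> C" "\<And>x :: 'a.
      (\<integral>\<^sup>+ y. ennreal (norm (x - y) powr (- \<alpha>) * bracket (a * p) y) \<partial>lborel) \<le> ennreal (C * bracket (\<delta> / 2) x)"
    using riesz_bracket[OF gd(3,4) \<alpha>(2)] by blast
  \<comment> \<open>The numerator is \<open>N + (N - \<alpha>)\<close>, larger than the denominator.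
    A total degree above 1 lets a small amplitude \<open>\<epsilon>\<close> favour the linear
    side.\<close>
  have pq: "1 < p + q"
  proof -
    have "1 < (2 * real DIM('a) - \<alpha>) / (real DIM('a) - 2 * real m)"
      using m \<alpha> by (simp add: less_divide_eq)
    then show ?thesis using sum by simp
  qed
  \<comment> \<open>Chosen so that \<open>\<epsilon> powr (p + q - 1)\<close> equals
    \<open>c / (C + 1)\<close>; the 1 allows \<open>C = 0\<close>.\<close>
  define \<epsilon> where "\<epsilon> = (c / (C + 1)) powr (1 / (p + q - 1))"
  have \<epsilon>: "0 < \<epsilon>" using c C by (simp add: \<epsilon>_def)
  have \<epsilon>pow: "\<epsilon> powr (p + q) * C \<le> \<epsilon> * c"
  proof -
    have "\<epsilon> powr (p + q - 1) = c / (C + 1)"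
      using pq c C by (simp add: \<epsilon>_def powr_powr)
    then have "\<epsilon> powr (p + q - 1) * C = c * (C / (C + 1))" by simp
    also have "\<dots> \<le> c * 1" using c C by (intro mult_left_mono) auto
    finally have "\<epsilon> * (\<epsilon> powr (p + q - 1) * C) \<le> \<epsilon> * c" using \<epsilon> by simp
    moreover have "\<epsilon> * \<epsilon> powr (p + q - 1) = \<epsilon> powr (p + q)"
      using \<epsilon> powr_add[of \<epsilon> 1 "p + q - 1"] by simp
    ultimately show ?thesis by (simp flip: mult.assoc)
  qed
  define v where "v x = \<epsilon> * bracket a x" for x :: 'a
  define u where "u z = v (fst z)" for z :: "'a \<times> real"
  have v: "0 < v x" for x using \<epsilon> by (simp add: v_def)
  have vpow: "v x powr r = \<epsilon> powr r * bracket (a * r) x" for x r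
    using \<epsilon> by (simp add: v_def powr_mult less_imp_le bracket_powr)
  have [measurable]: "bracket b \<in> borel_measurable borel" for b
    unfolding bracket_def[abs_def] by measurable
  have [measurable]: "v \<in> borel_measurable borel" unfolding v_def[abs_def] by measurable
  have fst_borel [measurable]: "(fst :: 'a \<times> real \<Rightarrow> 'a) \<in> borel_measurable borel"
    by (intro borel_measurable_continuous_onI continuous_intros)
  have [measurable]: "u \<in> borel_measurable borel" unfolding u_def[abs_def] by measurable
  have jle: "bracket b x \<le> 1" if "0 \<le> b" for b and x :: 'a
    using bracket_mono[OF that, of x] by (simp add: bracket_def)
  define k where "k x y = norm (x - y) powr (- \<alpha>) * v y powr p" for x y :: 'a
  have ri: "riesz_integrand \<alpha> p u z = k (fst z)" for z
    using v by (auto simp: riesz_integrand_def k_def u_def fun_eq_iff abs_of_pos split: prod.split)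
  have [measurable]: "k x \<in> borel_measurable borel" for x
    unfolding k_def[abs_def] by measurable
  have kj: "k x y = \<epsilon> powr p * (norm (x - y) powr (- \<alpha>) * bracket (a * p) y)" for x y
    by (simp add: k_def vpow)
  have k0: "0 \<le> k x y" for x y by (simp add: k_def)
  have kint: "(\<integral>\<^sup>+ y. ennreal (k x y) \<partial>lborel) \<le> ennreal (\<epsilon> powr p * (C * bracket (\<delta> / 2) x))" for x
  proof -
    have "(\<integral>\<^sup>+ y. ennreal (k x y) \<partial>lborel)
      = ennreal (\<epsilon> powr p) * (\<integral>\<^sup>+ y. ennreal (norm (x - y) powr (- \<alpha>) * bracket (a * p) y) \<partial>lborel)"
      unfolding kj by (subst nn_integral_cmult[symmetric]) (auto simp: ennreal_mult[symmetric] less_imp_le)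
    also have "\<dots> \<le> ennreal (\<epsilon> powr p) * ennreal (C * bracket (\<delta> / 2) x)"
      by (intro mult_left_mono C(2)) auto
    finally show ?thesis using C(1) by (simp add: ennreal_mult[symmetric] less_imp_le)
  qed
  have kI: "integrable lborel (k x)" for x
    using le_less_trans[OF kint[of x] ennreal_less_top]
    by (intro integrableI_nonneg) (auto simp: k0)
  define R where "R x = (LINT y|lborel. k x y)" for x
  have R: "riesz_conv \<alpha> p u z = R (fst z)" for z
    unfolding riesz_conv_def ri R_def by (rule lebesgue_integral_borel) simp
  have R0: "0 \<le> R x" for x unfolding R_def by (rule integral_nonneg_AE) (simp add: k0)
  have Rle: "R x \<le> \<epsilon> powr p * (C * bracket (\<delta> / 2) x)" for x
  proof -
    have "ennreal (R x) = (\<integral>\<^sup>+ y. ennreal (k x y) \<partial>lborel)"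
      unfolding R_def by (rule nn_integral_eq_integral[symmetric]) (auto simp: kI k0)
    then have "ennreal (R x) \<le> ennreal (\<epsilon> powr p * (C * bracket (\<delta> / 2) x))"
      using kint[of x] by simp
    then show ?thesis using C(1) by (subst (asm) ennreal_le_iff) (auto simp: less_imp_le)
  qed
  have [measurable]: "R \<in> borel_measurable borel"
    unfolding R_def[abs_def] k_def by measurable
  \<comment> \<open>The stationary inequality holds pointwise. The required
    \<open>a + m \<le> \<delta> / 2 + a * q\<close> is half of the last inequality between
    \<open>\<gamma>\<close> and \<open>\<delta>\<close>.\<close>
  have key: "R x * v x powr q \<le> \<epsilon> * polyharmonic m (bracket_st a) (x, t)" for x t
  proof -
    have "R x * v x powr q \<le> (\<epsilon> powr p * (C * bracket (\<delta> / 2) x)) * (\<epsilon> powr q * bracket (a * q) x)"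
      unfolding vpow by (intro mult_right_mono Rle) (auto simp: less_imp_le)
    also have "\<dots> = \<epsilon> powr (p + q) * C * bracket (\<delta> / 2 + a * q) x"
      by (simp add: powr_add bracket_mult[symmetric] mult_ac)
    also have "\<dots> \<le> \<epsilon> powr (p + q) * C * bracket (a + real m) x"
      using gd C(1) by (intro mult_left_mono bracket_mono) (auto simp: a_def algebra_simps)
    also have "\<dots> \<le> \<epsilon> * c * bracket (a + real m) x"
      using \<epsilon>pow by (intro mult_right_mono) (auto simp: less_imp_le)
    also have "\<dots> \<le> \<epsilon> * polyharmonic m (bracket_st a) (x, t)"
      using c(2)[of "(x, t)"] \<epsilon> by (simp add: mult.assoc)
    finally show ?thesis .
  qed
  have Rvb: "\<bar>R x * v x powr q\<bar> \<le> \<epsilon> powr p * C * \<epsilon> powr q" for x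
  proof -
    have "R x * v x powr q \<le> (\<epsilon> powr p * (C * bracket (\<delta> / 2) x)) * (\<epsilon> powr q * bracket (a * q) x)"
      unfolding vpow by (intro mult_right_mono Rle) (auto simp: less_imp_le)
    also have "\<dots> \<le> (\<epsilon> powr p * (C * 1)) * (\<epsilon> powr q * 1)"
      using C(1) gd a q by (intro mult_mono mult_left_mono jle mult_nonneg_nonneg) (auto simp: less_imp_le)
    finally show ?thesis using R0[of x] by simp
  qed
  have uabs: "\<bar>u z\<bar> = v (fst z)" for z using v[of "fst z"] by (simp add: u_def)
  have jle_a: "bracket a x \<le> 1" for x :: 'a using a by (intro jle) auto
  have "weak_solution m \<alpha> p q v u"
    unfolding weak_solution_def
  proof (intro conjI allI impI)
    show "locally_integrable_on v UNIV"
      using \<epsilon> jle_a by (intro locally_integrable_on_bounded[of _ \<epsilon>]) (auto simp: v_def abs_mult less_imp_le)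
    have "u \<in> borel_measurable lebesgue" by (rule measurable_completion) simp
    then show "u \<in> borel_measurable (lebesgue_on halfspace)"
      by (rule measurable_restrict_space1)
    show "locally_integrable_on (\<lambda>z. \<bar>u z\<bar> powr p) (UNIV \<times> {0..})"
    proof (rule locally_integrable_on_bounded[of _ "\<epsilon> powr p"])
      fix z
      show "\<bar>\<bar>u z\<bar> powr p\<bar> \<le> \<epsilon> powr p"
        using \<epsilon> a p jle[of "a * p" "fst z"] by (simp add: uabs vpow abs_mult abs_of_pos mult_left_le)
    qed simp
    show "AE z in lebesgue. z \<in> halfspace \<longrightarrow> integrable lebesgue (riesz_integrand \<alpha> p u z)"
      unfolding ri by (intro AE_I2 impI) (simp add: lebesgue_integrable_borel kI)
    show "locally_integrable_on (\<lambda>z. riesz_conv \<alpha> p u z * \<bar>u z\<bar> powr q) (UNIV \<times> {0..})"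
      unfolding R uabs by (rule locally_integrable_on_bounded[OF _ Rvb]) measurable
  next
    fix \<phi> :: "'a \<times> real \<Rightarrow> real"
    assume "test_function \<phi> \<and> (\<forall>z. 0 \<le> \<phi> z)"
    then have phi: "smooth \<phi>" "bounded_support \<phi>" "\<And>z. 0 \<le> \<phi> z" by (auto simp: test_function_iff)
    note sj = smooth_bracket_st[of a, where 'a = 'a]
    have usm: "smooth u"
      unfolding u_def[abs_def] v_def by (intro smooth_mult smooth_const sj)
    have st: "smooth (time_deriv \<phi>)" "bounded_support (time_deriv \<phi>)"
      "smooth (polyharmonic m \<phi>)" "bounded_support (polyharmonic m \<phi>)"
      using phi by auto
    note [measurable] = smooth_borel[OF phi(1)] smooth_borel[OF st(1)] smooth_borel[OF st(3)]
      smooth_borel[OF sj] smooth_borel[OF polyharmonic_smooth[OF sj]]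
    have slice: "continuous_on UNIV (\<lambda>x. \<phi> (x, 0))"
      by (intro continuous_on_compose2[OF smooth_continuous[OF phi(1)]]) (auto intro!: continuous_intros)
    have vphi: "integrable lborel (\<lambda>x. v x * \<phi> (x, 0))"
    proof (rule integrable_bounded_support)
      have "continuous_on UNIV (\<lambda>x. u (x, 0))"
        by (intro continuous_on_compose2[OF smooth_continuous[OF usm]]) (auto intro!: continuous_intros)
      then show "continuous_on UNIV (\<lambda>x. v x * \<phi> (x, 0))"
        using slice by (auto simp: u_def intro: continuous_intros)
      obtain r where r: "\<And>z. r < norm z \<Longrightarrow> \<phi> z = 0"
        using phi(2) by (auto simp: bounded_support_def)
      then show "bounded_support (\<lambda>x. v x * \<phi> (x, 0))"
        unfolding bounded_support_def by (intro exI[of _ r]) (auto simp: norm_Pair)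
    qed
    have vphi_borel: "(\<lambda>x. v x * \<phi> (x, 0)) \<in> borel_measurable borel"
      using borel_measurable_integrable[OF vphi] by simp
    show "integrable lebesgue (\<lambda>x. v x * \<phi> (x, 0))"
      using vphi vphi_borel by (simp add: lebesgue_integrable_borel)
    have i1: "integrable lborel (\<lambda>z. indicator halfspace z * (u z * time_deriv \<phi> z))"
      and i2: "integrable lborel (\<lambda>z. indicator halfspace z * (u z * polyharmonic m \<phi> z))"
      using usm st by (auto intro!: integrable_half_smooth)
    have i3: "integrable lborel (\<lambda>z. indicator halfspace z * (polyharmonic m (bracket_st a) z * \<phi> z))"
      using sj phi by (intro integrable_half_smooth) auto
    have i12: "integrable lborel (\<lambda>z. indicator halfspace z * (u z * (- time_deriv \<phi> z + polyharmonic m \<phi> z)))"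
      using Bochner_Integration.integrable_add[OF integrable_minus[OF i1] i2] by (simp add: algebra_simps)
    show "set_integrable lebesgue halfspace (\<lambda>z. u z * (- time_deriv \<phi> z + polyharmonic m \<phi> z))"
      by (subst set_lebesgue_halfspace) (use i12 in auto)
    have i4: "integrable lborel (\<lambda>z. indicator halfspace z * (R (fst z) * v (fst z) powr q * \<phi> z))"
    proof (rule integrable_half, rule Bochner_Integration.integrable_bound)
      show "integrable lborel (\<lambda>z. (\<epsilon> powr p * C * \<epsilon> powr q) * \<phi> z)"
        by (intro integrable_mult_right integrable_bounded_support smooth_continuous phi)
      show "AE z in lborel. norm (R (fst z) * v (fst z) powr q * \<phi> z) \<le> norm ((\<epsilon> powr p * C * \<epsilon> powr q) * \<phi> z)"
      proof (rule AE_I2)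
        fix z
        have "\<bar>R (fst z) * v (fst z) powr q\<bar> * \<bar>\<phi> z\<bar> \<le> (\<epsilon> powr p * C * \<epsilon> powr q) * \<bar>\<phi> z\<bar>"
          by (intro mult_right_mono Rvb) auto
        then show "norm (R (fst z) * v (fst z) powr q * \<phi> z) \<le> norm ((\<epsilon> powr p * C * \<epsilon> powr q) * \<phi> z)"
          using C(1) by (simp add: abs_mult)
      qed
    qed simp
    show "set_integrable lebesgue halfspace (\<lambda>z. riesz_conv \<alpha> p u z * \<bar>u z\<bar> powr q * \<phi> z)"
      unfolding R uabs by (subst set_lebesgue_halfspace) (use i4 in auto)
    have "half_integral (\<lambda>z. R (fst z) * v (fst z) powr q * \<phi> z)
        \<le> half_integral (\<lambda>z. \<epsilon> * (polyharmonic m (bracket_st a) z * \<phi> z))"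
    proof (rule half_integral_mono[OF i4])
      show "integrable lborel (\<lambda>z. indicator halfspace z * (\<epsilon> * (polyharmonic m (bracket_st a) z * \<phi> z)))"
        using integrable_mult_right[OF i3, of \<epsilon>] by (simp add: mult.left_commute)
      fix z :: "'a \<times> real"
      show "R (fst z) * v (fst z) powr q * \<phi> z \<le> \<epsilon> * (polyharmonic m (bracket_st a) z * \<phi> z)"
        using mult_right_mono[OF key[of "fst z" "snd z"] phi(3)[of z]] by (simp add: mult.assoc)
    qed
    also have "\<dots> = \<epsilon> * half_integral (\<lambda>z. bracket_st a z * polyharmonic m \<phi> z)"
      by (simp only: half_integral_cmult half_integral_polyharmonic[OF sj phi(1,2)])
    also have "\<dots> = half_integral (\<lambda>z. u z * polyharmonic m \<phi> z)"
      by (simp only: half_integral_cmult[symmetric] u_def v_def mult.assoc)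
    \<comment> \<open>\<open>u\<close> is stationary, so the slice term and the time-derivative term
      cancel and may be inserted here.\<close>
    also have "\<dots> = - (LINT x|lborel. v x * \<phi> (x, 0))
        + (half_integral (\<lambda>z. - (u z * time_deriv \<phi> z)) + half_integral (\<lambda>z. u z * polyharmonic m \<phi> z))"
      using half_integral_time_deriv[of v \<phi>] usm phi by (simp add: half_integral_minus u_def[abs_def])
    also have "half_integral (\<lambda>z. - (u z * time_deriv \<phi> z)) + half_integral (\<lambda>z. u z * polyharmonic m \<phi> z)
        = half_integral (\<lambda>z. u z * (- time_deriv \<phi> z + polyharmonic m \<phi> z))"
      using i1 i2 by (subst half_integral_add[symmetric]) (auto simp: algebra_simps)
    finally show "(LINT z:halfspace|lebesgue. riesz_conv \<alpha> p u z * \<bar>u z\<bar> powr q * \<phi> z)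
      \<le> - (LINT x|lebesgue. v x * \<phi> (x, 0))
        + (LINT z:halfspace|lebesgue. u z * (- time_deriv \<phi> z + polyharmonic m \<phi> z))"
      unfolding R uabs lebesgue_integral_borel[OF vphi_borel]
      by (subst (1 2) set_lebesgue_halfspace) auto
  qed
  moreover have "\<forall>z\<in>halfspace. 0 < u z" using v by (simp add: u_def)
  ultimately show ?thesis by blast
qed

subsection \<open>Rescaled test functions\<close>

lemma partial_power:
  "smooth f \<Longrightarrow> partial b (\<lambda>z. f z ^ Suc n) = (\<lambda>z. real (Suc n) * partial b f z * f z ^ n)"
  by (rule ext, rule partial_eq)
    (use has_derivative_power[OF smooth_has_derivative, of f "Suc n"] in simp)

text \<open>Derivatives of order \<open>j\<close> of a power \<open>f ^ k\<close> retain the factor \<open>f ^ (k - j)\<close>.\<close>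

definition vanishing_order :: "('b::euclidean_space \<Rightarrow> real) \<Rightarrow> nat \<Rightarrow> ('b \<Rightarrow> real) \<Rightarrow> bool" where
  "vanishing_order f n g \<longleftrightarrow> (\<exists>v. smooth v \<and> g = (\<lambda>z. f z ^ n * v z))"

lemma vanishing_order_power: "vanishing_order f n (\<lambda>z. f z ^ n)"
  unfolding vanishing_order_def by (intro exI[of _ "\<lambda>z. 1"]) auto

lemma vanishing_order_partial:
  assumes f: "smooth f" and g: "vanishing_order f (Suc n) g" and b: "b \<in> Basis"
  shows "vanishing_order f n (partial b g)"
proof -
  obtain v where v: "smooth v" "g = (\<lambda>z. f z ^ Suc n * v z)"
    using g by (auto simp: vanishing_order_def)
  have "partial b g = (\<lambda>z. f z ^ n * (f z * partial b v z + real (Suc n) * partial b f z * v z))"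
    unfolding v(2) partial_mult[OF smooth_power[OF f] v(1)] partial_power[OF f]
    by (simp add: algebra_simps)
  moreover have "smooth (\<lambda>z. f z * partial b v z + real (Suc n) * partial b f z * v z)"
    by (intro smooth_add smooth_mult smooth_const f v smooth_partial b)
  ultimately show ?thesis
    unfolding vanishing_order_def
    by (intro exI[of _ "\<lambda>z. f z * partial b v z + real (Suc n) * partial b f z * v z"] conjI)
qed

lemma vanishing_order_minus: "vanishing_order f n g \<Longrightarrow> vanishing_order f n (\<lambda>z. - g z)"
  using smooth_minus mult_minus_right unfolding vanishing_order_def by (auto simp: fun_eq_iff)

lemma vanishing_order_sum:
  assumes "\<And>i. i \<in> I \<Longrightarrow> vanishing_order f n (g i)"
  shows "vanishing_order f n (\<lambda>z. \<Sum>i\<in>I. g i z)"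
proof -
  obtain v where v: "\<And>i. i \<in> I \<Longrightarrow> smooth (v i) \<and> g i = (\<lambda>z. f z ^ n * v i z)"
    using assms unfolding vanishing_order_def by metis
  then show ?thesis
    unfolding vanishing_order_def
    by (intro exI[of _ "\<lambda>z. \<Sum>i\<in>I. v i z"]) (auto simp: sum_distrib_left intro!: smooth_sum)
qed

lemma vanishing_order_polyharmonic:
  fixes f g :: "'a::euclidean_space \<times> real \<Rightarrow> real"
  assumes "smooth f" "vanishing_order f (n + 2 * m) g"
  shows "vanishing_order f n (polyharmonic m g)"
  using assms(2)
proof (induction m arbitrary: n)
  case (Suc m)
  have "vanishing_order f (Suc (Suc n)) (polyharmonic m g)"
    using Suc.prems by (intro Suc.IH) simp
  then show ?case
    unfolding polyharmonic_Suc laplacian_def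
    by (intro vanishing_order_minus vanishing_order_sum vanishing_order_partial assms(1)) auto
qed simp

lemma vanishing_order_le:
  assumes "smooth f" "vanishing_order f n g" "k \<le> n"
  shows "vanishing_order f k g"
proof -
  obtain v where v: "smooth v" "g = (\<lambda>z. f z ^ n * v z)"
    using assms(2) by (auto simp: vanishing_order_def)
  then have "g = (\<lambda>z. f z ^ k * (f z ^ (n - k) * v z))"
    using assms(3) by (simp add: power_add[symmetric] flip: mult.assoc)
  moreover have "smooth (\<lambda>z. f z ^ (n - k) * v z)"
    by (intro smooth_mult smooth_power assms(1) v(1))
  ultimately show ?thesis
    unfolding vanishing_order_def by (intro exI[of _ "\<lambda>z. f z ^ (n - k) * v z"] conjI)
qed

text \<open>The smooth cofactor is bounded only on a ball containing the support of
  \<open>f\<close>; elsewhere \<open>n > 0\<close> makes \<open>g\<close> vanish. Since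
  \<open>f\<close> is at most 1, the exponent may be lowered from \<open>n\<close> to the real
  number \<open>a\<close>.\<close>

lemma vanishing_order_bound:
  fixes f g :: "'b::euclidean_space \<Rightarrow> real"
  assumes f: "bounded_support f" "\<And>z. 0 \<le> f z" "\<And>z. f z \<le> 1"
    and g: "vanishing_order f n g" and n: "0 < n" and a: "a \<le> real n"
  obtains C where "0 \<le> C" "\<And>z. \<bar>g z\<bar> \<le> C * f z powr a"
proof -
  obtain v where v: "smooth v" "g = (\<lambda>z. f z ^ n * v z)"
    using g by (auto simp: vanishing_order_def)
  obtain r where r: "\<And>z. r < norm z \<Longrightarrow> f z = 0"
    using f(1) by (auto simp: bounded_support_def)
  have "compact (v ` cball 0 r)"
    by (intro compact_continuous_image)
      (auto intro: continuous_on_subset[OF smooth_continuous[OF v(1)]])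
  then obtain B where B: "\<And>z. norm z \<le> r \<Longrightarrow> \<bar>v z\<bar> \<le> B"
    using compact_imp_bounded[of "v ` cball 0 r"] by (fastforce simp: bounded_iff)
  have "\<bar>g z\<bar> \<le> max B 0 * f z powr a" for z
  proof (cases "f z = 0")
    case True
    then show ?thesis using n by (simp add: v(2))
  next
    case False
    then have z: "0 < f z" "norm z \<le> r" using f(2)[of z] r[of z] by (auto simp: not_less[symmetric])
    have "\<bar>g z\<bar> = f z powr real n * \<bar>v z\<bar>"
      using z by (simp add: v(2) abs_mult powr_realpow)
    also have "\<dots> \<le> f z powr a * max B 0"
      using z f(3)[of z] a B[of z] by (intro mult_mono powr_mono') auto
    finally show ?thesis by (simp add: mult.commute)
  qed
  then show ?thesis by (intro that[of "max B 0"]) auto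
qed

lemma polyharmonic_eq_0_open:
  fixes f :: "'a::euclidean_space \<times> real \<Rightarrow> real"
  assumes U: "open U" and f: "\<And>w. w \<in> U \<Longrightarrow> f w = c" and z: "z \<in> U" and m: "1 \<le> m"
  shows "polyharmonic m f z = 0"
proof -
  \<comment> \<open>The induction speaks of constancy, not of vanishing, because the iterate with
    \<open>k = 0\<close> is the constant itself.\<close>
  have "\<exists>c. \<forall>w\<in>U. polyharmonic k f w = c" for k
  proof (induction k)
    case (Suc k)
    then obtain c where c: "\<And>w. w \<in> U \<Longrightarrow> polyharmonic k f w = c" by blast
    have "partial (b, 0) (polyharmonic k f) w = 0" if "w \<in> U" for b w
      by (rule partial_eq_0_open[OF U that c])
    then have "partial (b, 0) (partial (b, 0) (polyharmonic k f)) w = 0" if "w \<in> U" for b w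
      by (intro partial_eq_0_open[OF U that])
    then have "\<forall>w\<in>U. polyharmonic (Suc k) f w = 0"
      by (simp add: polyharmonic_Suc laplacian_def)
    then show ?case ..
  qed (use f in auto)
  moreover obtain k where k: "m = Suc k" using m by (cases m) auto
  ultimately obtain c where c: "\<And>w. w \<in> U \<Longrightarrow> polyharmonic k f w = c" by blast
  have "partial (b, 0) (polyharmonic k f) w = 0" if "w \<in> U" for b w
    by (rule partial_eq_0_open[OF U that c])
  then have "partial (b, 0) (partial (b, 0) (polyharmonic k f)) z = 0" for b
    by (intro partial_eq_0_open[OF U z])
  then show ?thesis by (simp add: k polyharmonic_Suc laplacian_def)
qed

text \<open>With \<open>T = R ^ (2 * m)\<close> this is the parabolic scaling: the time derivative
  and the polyharmonic operator then gain the same factor \<open>inverse T\<close>.\<close>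

definition dilation :: "real \<Rightarrow> real \<Rightarrow> 'a::euclidean_space \<times> real \<Rightarrow> 'a \<times> real" where
  "dilation R T z = (fst z /\<^sub>R R, snd z /\<^sub>R T)"

lemma bounded_linear_dilation: "bounded_linear (dilation R T)"
  unfolding dilation_def[abs_def]
  by (intro bounded_linear_Pair bounded_linear_scaleR_right[THEN bounded_linear_compose]
      bounded_linear_fst bounded_linear_snd)

lemma has_derivative_dilation:
  assumes "(f has_derivative f') (at (dilation R T z))"
  shows "((\<lambda>z. f (dilation R T z)) has_derivative (\<lambda>h. f' (dilation R T h))) (at z)"
  using has_derivative_compose[OF bounded_linear_imp_has_derivative[OF bounded_linear_dilation] assms] .

lemma C_class_scaleR_partial:
  "C_class (Suc k) f \<Longrightarrow> partial (c *\<^sub>R b) f z = c * partial b f z"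
  using linear_scale[OF has_derivative_linear[OF C_class_Suc_has_derivative], of k f c b z] by simp

lemma C_class_dilation:
  fixes f :: "'a::euclidean_space \<times> real \<Rightarrow> real"
  shows "C_class k f \<Longrightarrow> C_class k (\<lambda>z. f (dilation R T z))"
proof (induction k arbitrary: f)
  case 0
  have "continuous_on UNIV (dilation R T :: 'a \<times> real \<Rightarrow> _)"
    by (rule linear_continuous_on[OF bounded_linear_dilation])
  with 0 show ?case
    using continuous_on_compose2[of UNIV f UNIV "dilation R T"] by simp
next
  case (Suc k)
  show ?case
  proof (rule C_class_SucI[OF has_derivative_dilation[OF C_class_Suc_has_derivative[OF Suc.prems]]])
    fix b :: "'a \<times> real" assume b: "b \<in> Basis"
    \<comment> \<open>A basis vector is purely spatial or purely temporal, hence an eigenvector of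
      the dilation.\<close>
    obtain c where c: "dilation R T b = c *\<^sub>R b"
    proof (cases "snd b = 0")
      case True
      then show ?thesis by (intro that[of "inverse R"]) (auto simp: dilation_def prod_eq_iff)
    next
      case False
      then have "fst b = 0" using b by (auto simp: Basis_prod_def)
      then show ?thesis by (intro that[of "inverse T"]) (auto simp: dilation_def prod_eq_iff)
    qed
    show "C_class k (\<lambda>z. partial (dilation R T b) f (dilation R T z))"
      unfolding c C_class_scaleR_partial[OF Suc.prems]
      by (intro C_class_mult C_class_const Suc.IH C_class_Suc_partial[OF Suc.prems b])
  qed
qed

lemma smooth_dilation: "smooth f \<Longrightarrow> smooth (\<lambda>z. f (dilation R T z))"
  by (simp add: smooth_def C_class_dilation)

text \<open>\<open>\<eta>\<close> stays in unscaled time: spatial derivatives treat it as a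
  constant, and only the time derivative produces a term with \<open>deriv \<eta>\<close>.\<close>

lemma has_derivative_dilated_product:
  fixes f :: "'a::euclidean_space \<times> real \<Rightarrow> real"
  assumes "smooth f" "smooth \<eta>"
  shows "((\<lambda>z. f (dilation R T z) * \<eta> (snd z)) has_derivative
    (\<lambda>h. f (dilation R T z) * (deriv \<eta> (snd z) * snd h)
      + partial (dilation R T h) f (dilation R T z) * \<eta> (snd z))) (at z)"
proof -
  have "((\<lambda>z. \<eta> (snd z)) has_derivative (\<lambda>h. deriv \<eta> (snd z) * snd h)) (at z)"
    by (rule has_derivative_compose[OF has_derivative_snd[OF has_derivative_ident]
          smooth_deriv(2)[OF assms(2), unfolded has_field_derivative_def]])
  then show ?thesis
    by (intro has_derivative_mult has_derivative_dilation smooth_has_derivative assms(1))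
qed

lemma partial_space_dilated_product:
  fixes f :: "'a::euclidean_space \<times> real \<Rightarrow> real"
  assumes "smooth f" "smooth \<eta>"
  shows "partial (b, 0) (\<lambda>z. f (dilation R T z) * \<eta> (snd z)) =
    (\<lambda>z. inverse R * partial (b, 0) f (dilation R T z) * \<eta> (snd z))"
proof
  fix z
  have "dilation R T (b, 0) = inverse R *\<^sub>R (b, 0)" by (simp add: dilation_def)
  then have "partial (dilation R T (b, 0)) f w = inverse R * partial (b, 0) f w" for w
    using assms(1) C_class_scaleR_partial[of 0 f] by (simp only: smooth_def)
  then show "partial (b, 0) (\<lambda>z. f (dilation R T z) * \<eta> (snd z)) z =
      inverse R * partial (b, 0) f (dilation R T z) * \<eta> (snd z)"
    by (simp add: partial_eq[OF has_derivative_dilated_product[OF assms]])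
qed

lemma partial_time_dilated_product:
  fixes f :: "'a::euclidean_space \<times> real \<Rightarrow> real"
  assumes "smooth f" "smooth \<eta>"
  shows "time_deriv (\<lambda>z. f (dilation R T z) * \<eta> (snd z)) z =
    inverse T * time_deriv f (dilation R T z) * \<eta> (snd z) + f (dilation R T z) * deriv \<eta> (snd z)"
proof -
  have "dilation R T (0, 1) = inverse T *\<^sub>R (0 :: 'a, 1)" by (simp add: dilation_def)
  then have "partial (dilation R T (0, 1)) f w = inverse T * partial (0, 1) f w" for w
    using assms(1) C_class_scaleR_partial[of 0 f] by (simp only: smooth_def)
  then show ?thesis
    by (simp add: time_deriv_def partial_eq[OF has_derivative_dilated_product[OF assms]])
qed

lemma polyharmonic_dilated_product:
  fixes f :: "'a::euclidean_space \<times> real \<Rightarrow> real"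
  assumes f: "smooth f" and \<eta>: "smooth \<eta>"
  shows "polyharmonic m (\<lambda>z. f (dilation R T z) * \<eta> (snd z)) =
    (\<lambda>z. inverse R ^ (2 * m) * polyharmonic m f (dilation R T z) * \<eta> (snd z))"
proof (induction m)
  case (Suc m)
  let ?g = "polyharmonic m f"
  have g: "smooth ?g" using f by auto
  have p: "smooth (partial (b, 0) ?g)" if "b \<in> Basis" for b :: 'a
    using that g by (intro smooth_partial) auto
  have sm: "smooth (\<lambda>z. h (dilation R T z) * \<eta> (snd z))" if "smooth h" for h :: "'a \<times> real \<Rightarrow> real"
    by (rule smooth_mult[OF smooth_dilation[OF that]
          smooth_compose[OF \<eta> smooth_linear[OF bounded_linear_snd]]])
  define c where "c = inverse R ^ (2 * m)"
  have "laplacian (\<lambda>z. c * (?g (dilation R T z) * \<eta> (snd z))) z =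
      c * (inverse R)\<^sup>2 * laplacian ?g (dilation R T z) * \<eta> (snd z)" for z
    unfolding laplacian_def partial_cmult[OF sm[OF g]] partial_space_dilated_product[OF g \<eta>]
  proof (simp only: sum_distrib_left sum_distrib_right, intro sum.cong refl)
    fix b :: 'a assume b: "b \<in> Basis"
    have "partial (b, 0) (\<lambda>z. (c * inverse R) * (partial (b, 0) ?g (dilation R T z) * \<eta> (snd z))) z
        = (c * inverse R) * (inverse R * partial (b, 0) (partial (b, 0) ?g) (dilation R T z) * \<eta> (snd z))"
      by (simp only: partial_cmult[OF sm[OF p[OF b]]] partial_space_dilated_product[OF p[OF b] \<eta>])
    then show "partial (b, 0) (\<lambda>z. c * (inverse R * partial (b, 0) ?g (dilation R T z) * \<eta> (snd z))) z
        = c * (inverse R)\<^sup>2 * partial (b, 0) (partial (b, 0) ?g) (dilation R T z) * \<eta> (snd z)"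
      by (simp add: power2_eq_square mult.assoc)
  qed
  then have "polyharmonic (Suc m) (\<lambda>z. f (dilation R T z) * \<eta> (snd z)) z =
      c * (inverse R)\<^sup>2 * polyharmonic (Suc m) f (dilation R T z) * \<eta> (snd z)" for z
    unfolding polyharmonic_Suc Suc.IH c_def[symmetric] by (simp add: mult.assoc)
  then show ?case by (simp add: c_def fun_eq_iff power_add[symmetric] power2_eq_square mult_ac)
qed simp

text \<open>The squared norm keeps the function smooth at the origin, and on pairs one function cuts
  off space and time together.\<close>

definition radial_cutoff :: "'b::euclidean_space \<Rightarrow> real" where
  "radial_cutoff z = cutoff (inner z z)"

lemma smooth_radial_cutoff: "smooth radial_cutoff"
  unfolding radial_cutoff_def[abs_def]
  using smooth_compose[OF smooth_cutoff smooth_inner[OF bounded_linear_ident]] .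

lemma radial_cutoff_eq_1: "norm z < 1 \<Longrightarrow> radial_cutoff z = 1"
  unfolding radial_cutoff_def using norm_ge_zero[of z]
  by (intro cutoff_eq_1) (auto simp: power2_norm_eq_inner[symmetric] power_le_one)

lemma radial_cutoff_eq_0: "2 < norm z \<Longrightarrow> radial_cutoff z = 0"
  unfolding radial_cutoff_def
  using power_mono[of 2 "norm z" 2] by (intro cutoff_eq_0) (simp add: power2_norm_eq_inner[symmetric])

text \<open>The factor \<open>flat 0 t\<close> makes the test functions vanish for \<open>t \<le> 0\<close>, so that the initial datum
  drops out; being nondecreasing, it contributes to the time derivative with the good sign.\<close>

definition scaled_test :: "nat \<Rightarrow> nat \<Rightarrow> real \<Rightarrow> 'a::euclidean_space \<times> real \<Rightarrow> real" where
  "scaled_test m k R z = radial_cutoff (dilation R (R ^ (2 * m)) z) ^ k * flat 0 (snd z)"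

lemma
  fixes z :: "'a::euclidean_space \<times> real"
  shows scaled_test_nonneg: "0 \<le> scaled_test m k R z"
    and scaled_test_le_flat: "scaled_test m k R z \<le> flat 0 (snd z)"
    and scaled_test_le_1: "scaled_test m k R z \<le> 1"
proof -
  have rc: "0 \<le> radial_cutoff w" "radial_cutoff w \<le> 1" for w :: "'a \<times> real"
    by (auto simp: radial_cutoff_def cutoff_nonneg cutoff_le_1)
  show "0 \<le> scaled_test m k R z"
    by (simp add: scaled_test_def rc flat_0_nonneg)
  show *: "scaled_test m k R z \<le> flat 0 (snd z)"
    by (simp add: scaled_test_def rc flat_0_nonneg power_le_one mult_le_cancel_right1 mult_left_le_one_le)
  show "scaled_test m k R z \<le> 1"
    using * flat_0_le_1[of "snd z"] by linarith
qed

lemma scaled_test_eq_flat: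
  "norm (dilation R (R ^ (2 * m)) z) < 1 \<Longrightarrow> scaled_test m k R z = flat 0 (snd z)"
  by (simp add: scaled_test_def radial_cutoff_eq_1)

lemma scaled_test_eq_0:
  fixes z :: "'a::euclidean_space \<times> real"
  assumes "0 < R" "0 < k" "2 * R < norm (fst z) \<or> snd z \<le> 0 \<or> 2 * R ^ (2 * m) < snd z"
  shows "scaled_test m k R z = 0"
proof -
  let ?T = "R ^ (2 * m)"
  have T: "0 < ?T" using assms by simp
  have "2 < norm (dilation R ?T z)" if "2 * R < norm (fst z)"
  proof -
    have "2 < norm (fst z /\<^sub>R R)" using that assms(1) by (simp add: field_simps)
    then show ?thesis
      unfolding dilation_def using norm_fst_le[of "fst z /\<^sub>R R" "snd z /\<^sub>R ?T"] by linarith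
  qed
  moreover have "2 < norm (dilation R ?T z)" if "2 * ?T < snd z"
  proof -
    have "2 < norm (snd z /\<^sub>R ?T)" using that T by (simp add: field_simps)
    then show ?thesis
      unfolding dilation_def using norm_snd_le[of "snd z /\<^sub>R ?T" "fst z /\<^sub>R R"] by linarith
  qed
  ultimately show ?thesis
    using assms by (auto simp: scaled_test_def radial_cutoff_eq_0 flat_0)
qed

lemma test_function_scaled_test:
  assumes "0 < R" "0 < k"
  shows "test_function (scaled_test m k R :: 'a::euclidean_space \<times> real \<Rightarrow> real)"
  unfolding test_function_iff
proof
  show "smooth (scaled_test m k R :: 'a \<times> real \<Rightarrow> real)"
    unfolding scaled_test_def[abs_def]
    by (intro smooth_mult smooth_power smooth_dilation smooth_radial_cutoff
        smooth_compose[OF smooth_flat] smooth_linear bounded_linear_snd)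
  have "scaled_test m k R z = 0" if "2 * R + 2 * R ^ (2 * m) < norm z" for z :: "'a \<times> real"
  proof -
    have "norm z \<le> norm (fst z) + \<bar>snd z\<bar>"
      using norm_Pair_le[of "fst z" "snd z"] by simp
    then show ?thesis
      using that by (intro scaled_test_eq_0 assms) linarith
  qed
  then show "bounded_support (scaled_test m k R :: 'a \<times> real \<Rightarrow> real)"
    unfolding bounded_support_def by blast
qed

text \<open>Young's inequality with exponent \<open>s\<close> needs derivatives bounded by the test
  function to the power \<open>1 / s\<close>, which a high power of the cutoff provides. The term
  from differentiating \<open>flat 0\<close> has the good sign, so only an upper bound is claimed.
  On the plateau all other derivatives vanish.\<close>

lemma scaled_test_operator_bound:
  fixes s :: real
  assumes m: "1 \<le> m" and s: "1 < s"
  obtains k C where "0 < k" "0 \<le> C"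
    "\<And>R (z :: 'a::euclidean_space \<times> real). 0 < R \<Longrightarrow>
      - time_deriv (scaled_test m k R) z + polyharmonic m (scaled_test m k R) z \<le>
      (if norm (dilation R (R ^ (2 * m)) z) < 1 then 0
       else C * inverse R ^ (2 * m) * scaled_test m k R z powr (1 / s))"
proof -
  let ?f = "radial_cutoff :: 'a \<times> real \<Rightarrow> real"
  have f1: "bounded_support ?f"
    unfolding bounded_support_def by (intro exI[of _ 2]) (simp add: radial_cutoff_eq_0)
  have f2: "0 \<le> ?f z" and f3: "?f z \<le> 1" for z
    by (simp_all add: radial_cutoff_def cutoff_nonneg cutoff_le_1)
  note f = f1 f2 f3
  have sf: "smooth ?f" by (rule smooth_radial_cutoff)
  \<comment> \<open>Up to \<open>2 * m\<close> of the \<open>k\<close> factors are lost to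
    derivatives, and the remaining \<open>n\<close> have to dominate the power \<open>k / s\<close>;
    this amounts to \<open>2 * m \<le> n * (s - 1)\<close>.\<close>
  define n where "n = nat \<lceil>2 * real m / (s - 1)\<rceil> + 1"
  define k where "k = n + 2 * m"
  have n: "2 * real m / (s - 1) \<le> real n" "0 < n"
    unfolding n_def by linarith+
  have kn: "real k * (1 / s) \<le> real n"
  proof -
    have "2 * real m \<le> real n * (s - 1)" using n(1) s by (simp add: pos_divide_le_eq)
    then show ?thesis using s by (simp add: k_def field_simps)
  qed
  let ?F = "\<lambda>z. ?f z ^ k"
  have Fpow: "?f z powr (real k * (1 / s)) = ?F z powr (1 / s)" for z
  proof (cases "?f z = 0")
    case False
    then have "?F z = ?f z powr real k" using f2[of z] by (simp add: powr_realpow)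
    then show ?thesis by (simp only: powr_powr)
  qed (use n(2) in \<open>simp add: k_def\<close>)
  have vF: "vanishing_order ?f (n + 2 * m) ?F"
    unfolding k_def by (rule vanishing_order_power)
  obtain C1 where C1: "0 \<le> C1" "\<And>z. \<bar>polyharmonic m ?F z\<bar> \<le> C1 * ?f z powr (real k * (1 / s))"
    using vanishing_order_bound[OF f vanishing_order_polyharmonic[OF sf vF] n(2) kn] by blast
  have "vanishing_order ?f n (time_deriv ?F)"
    unfolding time_deriv_def using m
    by (intro vanishing_order_partial sf vanishing_order_le[OF sf vF]) auto
  then obtain C2 where C2: "0 \<le> C2" "\<And>z. \<bar>time_deriv ?F z\<bar> \<le> C2 * ?f z powr (real k * (1 / s))"
    using vanishing_order_bound[OF f _ n(2) kn] by blast
  have sF: "smooth ?F" using sf by auto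
  show ?thesis
  proof (rule that[of k "C1 + C2"])
    show "0 < k" using n by (simp add: k_def)
    show "0 \<le> C1 + C2" using C1 C2 by simp
    fix R :: real and z :: "'a \<times> real"
    assume R: "0 < R"
    define T where "T = R ^ (2 * m)"
    have T: "0 < T" using R by (simp add: T_def)
    define w where "w = dilation R T z"
    define \<eta> where "\<eta> = flat 0 (snd z)"
    have \<eta>: "0 \<le> \<eta>" "\<eta> \<le> 1" by (simp_all add: \<eta>_def flat_0_nonneg flat_0_le_1)
    have d: "0 \<le> deriv (flat 0) t" for t
      using DERIV_imp_deriv[OF flat_DERIV[of 0 t]] by (simp add: flat_def)
    have st: "scaled_test m k R = (\<lambda>z. ?F (dilation R T z) * flat 0 (snd z))"
      by (simp add: scaled_test_def[abs_def] T_def)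
    have "- time_deriv (scaled_test m k R) z \<le> inverse T * (- time_deriv ?F w) * \<eta>"
      unfolding st partial_time_dilated_product[OF sF smooth_flat] w_def \<eta>_def
      using d[of "snd z"] f2[of "dilation R T z"] by simp
    moreover have "polyharmonic m (scaled_test m k R) z = inverse T * polyharmonic m ?F w * \<eta>"
      unfolding st polyharmonic_dilated_product[OF sF smooth_flat] w_def \<eta>_def
      by (simp add: T_def power_inverse)
    ultimately have le: "- time_deriv (scaled_test m k R) z + polyharmonic m (scaled_test m k R) z
        \<le> inverse T * (- time_deriv ?F w + polyharmonic m ?F w) * \<eta>"
      by (simp add: algebra_simps)
    show "- time_deriv (scaled_test m k R) z + polyharmonic m (scaled_test m k R) z \<le>
      (if norm (dilation R (R ^ (2 * m)) z) < 1 then 0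
       else (C1 + C2) * inverse R ^ (2 * m) * scaled_test m k R z powr (1 / s))"
    proof (cases "norm w < 1")
      case True
      have o: "open {w :: 'a \<times> real. norm w < 1}" by (intro open_Collect_less continuous_intros)
      have c: "?F v = 1" if "v \<in> {w. norm w < 1}" for v using that by (simp add: radial_cutoff_eq_1)
      have "polyharmonic m ?F w = 0"
        by (rule polyharmonic_eq_0_open[OF o c _ m]) (use True in auto)
      moreover have "time_deriv ?F w = 0"
        unfolding time_deriv_def by (rule partial_eq_0_open[OF o _ c]) (use True in auto)
      ultimately show ?thesis using le True by (simp add: w_def T_def)
    next
      case False
      have "- time_deriv ?F w + polyharmonic m ?F w \<le> (C1 + C2) * ?F w powr (1 / s)"
        using C1(2)[of w] C2(2)[of w] unfolding Fpow by (simp add: algebra_simps)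
      then have "inverse T * (- time_deriv ?F w + polyharmonic m ?F w) * \<eta>
          \<le> inverse T * ((C1 + C2) * ?F w powr (1 / s)) * \<eta>"
        using T \<eta> by (intro mult_right_mono mult_left_mono) auto
      \<comment> \<open>A number in the unit interval grows under the power \<open>1 / s\<close>, so
        the undifferentiated time factor can be absorbed into the power of the test
        function.\<close>
      also have "\<dots> \<le> inverse T * ((C1 + C2) * ?F w powr (1 / s)) * \<eta> powr (1 / s)"
      proof (rule mult_left_mono)
        show "\<eta> \<le> \<eta> powr (1 / s)"
          using powr_mono'[of "1 / s" 1 \<eta>] \<eta> s by simp
      qed (use T C1 C2 in auto)
      also have "\<dots> = (C1 + C2) * inverse T * (?F w * \<eta>) powr (1 / s)"
        using f2[of w] \<eta> by (simp add: powr_mult mult_ac)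
      also have "\<dots> = (C1 + C2) * inverse R ^ (2 * m) * scaled_test m k R z powr (1 / s)"
        unfolding st by (simp add: T_def w_def \<eta>_def power_inverse)
      finally show ?thesis using le False by (simp add: w_def T_def)
    qed
  qed
qed

subsection \<open>The weak inequality in nonnegative integrals\<close>

text \<open>Without sharp constants: the second term is the threshold where
  \<open>l * a powr (s - 1)\<close> equals 1. Below it that term suffices, above it the first one
  does.\<close>

lemma young_powr:
  fixes a l s :: real
  assumes "0 \<le> a" "0 < l" "1 < s"
  shows "a \<le> l * a powr s + l powr (- 1 / (s - 1))"
proof (cases "a \<le> l powr (- 1 / (s - 1))")
  case True
  then show ?thesis using assms by (smt (verit) mult_nonneg_nonneg powr_ge_zero)
next
  case False
  have a: "0 < a" using False powr_ge_zero[of l "- 1 / (s - 1)"] by linarith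
  have "inverse l = (l powr (- 1 / (s - 1))) powr (s - 1)"
  proof -
    have e: "- 1 / (s - 1) * (s - 1) = - 1" using assms by simp
    show ?thesis unfolding powr_powr e using assms by (simp add: powr_minus)
  qed
  also have "\<dots> \<le> a powr (s - 1)" using False assms by (intro powr_mono2) auto
  finally have "1 \<le> l * a powr (s - 1)" using assms by (simp add: field_simps)
  then have "a * 1 \<le> a * (l * a powr (s - 1))" using a by (intro mult_left_mono) auto
  also have "\<dots> = l * a powr s" using a powr_add[of a 1 "s - 1"] by simp
  finally show ?thesis using powr_ge_zero[of l "- 1 / (s - 1)"] by linarith
qed

text \<open>Proved by integrating the pointwise bound \<open>2 * A * B \<le> A^2 + B^2\<close> over
  pairs \<open>(x, y)\<close>; in \<open>ennreal\<close> this covers infinite integrals as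
  well.\<close>

lemma nn_integral_cauchy_schwarz_powr:
  fixes w \<phi> :: "'a::euclidean_space \<Rightarrow> real" and p q :: real
  assumes [measurable]: "w \<in> borel_measurable borel" "\<phi> \<in> borel_measurable borel"
    and w: "\<And>x. 0 \<le> w x" and \<phi>: "\<And>x. 0 \<le> \<phi> x"
  shows "(\<integral>\<^sup>+x. ennreal (w x powr ((p + q) / 2) * \<phi> x) \<partial>lborel)\<^sup>2 \<le>
    (\<integral>\<^sup>+x. ennreal (w x powr p * \<phi> x) \<partial>lborel) * (\<integral>\<^sup>+x. ennreal (w x powr q * \<phi> x) \<partial>lborel)"
proof -
  define f where "f x = ennreal (w x powr p * \<phi> x)" for x
  define g where "g x = ennreal (w x powr q * \<phi> x)" for x
  define h where "h x = ennreal (w x powr ((p + q) / 2) * \<phi> x)" for x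
  have [measurable]: "f \<in> borel_measurable borel" unfolding f_def[abs_def] by measurable
  have [measurable]: "g \<in> borel_measurable borel" unfolding g_def[abs_def] by measurable
  have [measurable]: "h \<in> borel_measurable borel" unfolding h_def[abs_def] by measurable
  have pt: "2 * (h x * h y) \<le> f x * g y + g x * f y" for x y
  proof -
    define A where "A = w x powr (p / 2) * w y powr (q / 2)"
    define B where "B = w y powr (p / 2) * w x powr (q / 2)"
    have AB: "A * B = w x powr ((p + q) / 2) * w y powr ((p + q) / 2)"
      by (simp add: A_def B_def add_divide_distrib powr_add mult_ac)
    have sq: "A\<^sup>2 = w x powr p * w y powr q" "B\<^sup>2 = w y powr p * w x powr q"
    proof -
      have half: "(c powr (r / 2))\<^sup>2 = c powr r" for c r :: real
        by (simp add: power2_eq_square powr_add[symmetric])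
      show "A\<^sup>2 = w x powr p * w y powr q" "B\<^sup>2 = w y powr p * w x powr q"
        by (simp_all only: A_def B_def power_mult_distrib half)
    qed
    have "2 * (A * B) * (\<phi> x * \<phi> y) \<le> (A\<^sup>2 + B\<^sup>2) * (\<phi> x * \<phi> y)"
      using sum_squares_bound[of A B] \<phi> by (intro mult_right_mono) auto
    then have "2 * ((w x powr ((p + q) / 2) * \<phi> x) * (w y powr ((p + q) / 2) * \<phi> y)) \<le>
        (w x powr p * \<phi> x) * (w y powr q * \<phi> y) + (w x powr q * \<phi> x) * (w y powr p * \<phi> y)"
      unfolding AB sq by (simp add: algebra_simps)
    then have "ennreal (2 * ((w x powr ((p + q) / 2) * \<phi> x) * (w y powr ((p + q) / 2) * \<phi> y))) \<le>
        ennreal ((w x powr p * \<phi> x) * (w y powr q * \<phi> y) + (w x powr q * \<phi> x) * (w y powr p * \<phi> y))"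
      by (rule ennreal_leI)
    then show ?thesis
      using \<phi> by (simp add: f_def g_def h_def ennreal_mult ennreal_plus)
  qed
  have "2 * (\<integral>\<^sup>+x. h x \<partial>lborel)\<^sup>2 = (\<integral>\<^sup>+x. (\<integral>\<^sup>+y. 2 * (h x * h y) \<partial>lborel) \<partial>lborel)"
    by (simp add: nn_integral_cmult nn_integral_multc power2_eq_square)
  also have "\<dots> \<le> (\<integral>\<^sup>+x. (\<integral>\<^sup>+y. f x * g y + g x * f y \<partial>lborel) \<partial>lborel)"
    by (intro nn_integral_mono pt)
  also have "\<dots> = (\<integral>\<^sup>+x. f x \<partial>lborel) * (\<integral>\<^sup>+x. g x \<partial>lborel) + (\<integral>\<^sup>+x. g x \<partial>lborel) * (\<integral>\<^sup>+x. f x \<partial>lborel)"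
    by (simp add: nn_integral_add nn_integral_cmult nn_integral_multc)
  also have "\<dots> = 2 * ((\<integral>\<^sup>+x. f x \<partial>lborel) * (\<integral>\<^sup>+x. g x \<partial>lborel))"
    by (simp add: mult.commute mult_2)
  finally show ?thesis
    unfolding f_def g_def h_def by (subst (asm) ennreal_mult_le_mult_iff) auto
qed

text \<open>The negative part only lowers the Bochner integral. It is applied to the linear term,
  whose integrand changes sign.\<close>

lemma ennreal_integral_le_nn_integral:
  "integrable M f \<Longrightarrow> ennreal (integral\<^sup>L M f) \<le> (\<integral>\<^sup>+x. ennreal (f x) \<partial>M)"
proof -
  assume f: "integrable M f"
  have "integral\<^sup>L M f \<le> enn2real (\<integral>\<^sup>+x. ennreal (f x) \<partial>M)"
    unfolding real_lebesgue_integral_def[OF f] by simp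
  then have "ennreal (integral\<^sup>L M f) \<le> ennreal (enn2real (\<integral>\<^sup>+x. ennreal (f x) \<partial>M))"
    by (rule ennreal_leI)
  also have "\<dots> \<le> (\<integral>\<^sup>+x. ennreal (f x) \<partial>M)" by (simp add: ennreal_enn2real_if)
  finally show ?thesis .
qed

text \<open>The solution agrees with a Borel function only almost everywhere in space-time, whereas
  the convolution at \<open>z\<close> integrates over the slice through \<open>z\<close>. Fubini
  makes the agreement valid on almost every slice.\<close>

lemma AE_lborel_slices:
  fixes P :: "'a::euclidean_space \<times> real \<Rightarrow> bool"
  assumes "AE z in lborel. P z"
  shows "AE z :: 'a \<times> real in lborel. AE y in lborel. P (y, snd z)"
proof -
  obtain N where N: "{z. \<not> P z} \<subseteq> N" "emeasure lborel N = 0" "N \<in> sets borel"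
    using AE_E[OF assms] by auto
  have [measurable]: "N \<in> sets (borel \<Otimes>\<^sub>M borel)" by (subst borel_prod) (rule N(3))
  have "0 = (\<integral>\<^sup>+z. indicator N z \<partial>(lborel :: ('a \<times> real) measure))" using N by simp
  also have "\<dots> = (\<integral>\<^sup>+t. (\<integral>\<^sup>+x. indicator N (x, t) \<partial>lborel) \<partial>lborel)"
    by (subst lborel_pair.nn_integral_snd) (simp_all add: lborel_prod borel_measurable_indicator N(3))
  finally have "AE t in lborel. (\<integral>\<^sup>+x. indicator N (x :: 'a, t :: real) \<partial>lborel) = 0"
    by (subst (asm) eq_commute, subst (asm) nn_integral_0_iff_AE) auto
  then have "AE t in lborel. AE y in lborel. (y, t) \<notin> N"
  proof (rule eventually_mono)
    fix t assume "(\<integral>\<^sup>+x. indicator N (x :: 'a, t :: real) \<partial>lborel) = 0"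
    then have "AE x in lborel. indicator N (x :: 'a, t) = (0 :: ennreal)"
      by (subst (asm) nn_integral_0_iff_AE) auto
    then show "AE y in lborel. (y, t) \<notin> N"
      by (rule eventually_mono) (auto simp: indicator_def split: if_splits)
  qed
  then have AEt: "AE t in lborel. AE y in lborel. P (y, t)"
    by (rule eventually_mono) (use N(1) in \<open>auto elim!: eventually_mono\<close>)
  obtain T where T: "{t. \<not> (AE y in lborel. P (y, t))} \<subseteq> T" "emeasure lborel T = 0" "T \<in> sets borel"
    using AE_E[OF AEt] by auto
  have "emeasure (lborel :: ('a \<times> real) measure) (UNIV \<times> T) = emeasure lborel (UNIV :: 'a set) * emeasure lborel T"
    unfolding lborel_prod[symmetric] using T(3) by (intro lborel.emeasure_pair_measure_Times) auto
  then have "UNIV \<times> T \<in> null_sets (lborel :: ('a \<times> real) measure)"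
    using T by (auto simp: null_sets_def intro!: borel_Times)
  then show ?thesis
    by (rule AE_I') (use T(1) in auto)
qed

text \<open>Unlike \<open>riesz_conv\<close>, whose value is 0 for a divergent convolution, this
  version is infinite there.\<close>

definition riesz_nn :: "real \<Rightarrow> real \<Rightarrow> ('a::euclidean_space \<times> real \<Rightarrow> real) \<Rightarrow> 'a \<times> real \<Rightarrow> ennreal" where
  "riesz_nn \<alpha> p w z = (\<integral>\<^sup>+y. ennreal (norm (fst z - y) powr (- \<alpha>) * w (y, snd z) powr p) \<partial>lborel)"

text \<open>Passing to a Borel representative and to \<open>ennreal\<close> frees the later uses of
  Fubini and Cauchy--Schwarz from integrability conditions. Finiteness of the nonlinear side is kept
  since the absorption argument depends on it.\<close>

lemma weak_solution_nn_inequality: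
  fixes u :: "'a::euclidean_space \<times> real \<Rightarrow> real"
  assumes ws: "weak_solution m \<alpha> p q u\<^sub>0 u"
    and nonneg: "AE z in lebesgue. z \<in> halfspace \<longrightarrow> 0 \<le> u z"
  obtains w where "w \<in> borel_measurable borel" "\<And>z. 0 \<le> w z"
    "AE z in lborel. z \<in> halfspace \<longrightarrow> u z = w z"
    "\<And>\<phi>. test_function \<phi> \<Longrightarrow> (\<And>z. 0 \<le> \<phi> z) \<Longrightarrow> (\<And>x. \<phi> (x, 0) = 0) \<Longrightarrow>
      (\<integral>\<^sup>+z. indicator halfspace z * (riesz_nn \<alpha> p w z * ennreal (w z powr q * \<phi> z)) \<partial>lborel) < \<infinity> \<and>
      (\<integral>\<^sup>+z. indicator halfspace z * (riesz_nn \<alpha> p w z * ennreal (w z powr q * \<phi> z)) \<partial>lborel) \<le>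
      (\<integral>\<^sup>+z. indicator halfspace z * ennreal (w z * (- time_deriv \<phi> z + polyharmonic m \<phi> z)) \<partial>lborel)"
proof -
  have um: "u \<in> borel_measurable (lebesgue_on halfspace)"
    and ri: "AE z in lebesgue. z \<in> halfspace \<longrightarrow> integrable lebesgue (riesz_integrand \<alpha> p u z)"
    using ws by (auto simp: weak_solution_def)
  have "halfspace \<inter> space lebesgue \<in> sets (lebesgue :: ('a \<times> real) measure)" by simp
  then have "(\<lambda>z. indicator halfspace z *\<^sub>R u z) \<in> borel_measurable lebesgue"
    using um by (simp add: borel_measurable_restrict_space_iff)
  then obtain g where g: "g \<in> borel_measurable lborel" "AE z in lborel. indicator halfspace z *\<^sub>R u z = g z"
    using completion_ex_borel_measurable_real by blast
  \<comment> \<open>Truncation makes \<open>w\<close> nonnegative everywhere; almost everywhere on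
    the half-space it changes nothing, because \<open>u\<close> is nonnegative there.\<close>
  define w where "w z = max 0 (g z)" for z
  have [measurable]: "w \<in> borel_measurable borel" using g(1) unfolding w_def[abs_def] by simp
  have w0: "0 \<le> w z" for z by (simp add: w_def)
  have uw: "AE z in lborel. z \<in> halfspace \<longrightarrow> u z = w z"
    using g(2) nonneg unfolding AE_completion_iff by eventually_elim (auto simp: w_def)
  have slices: "AE z :: 'a \<times> real in lborel. AE y in lborel.
      (y, snd z) \<in> halfspace \<longrightarrow> u (y, snd z) = w (y, snd z)"
    by (rule AE_lborel_slices[OF uw])
  have Req: "AE z in lborel. z \<in> halfspace \<longrightarrow> ennreal (riesz_conv \<alpha> p u z) = riesz_nn \<alpha> p w z"
    using slices ri unfolding AE_completion_iff
  proof eventually_elim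
    fix z :: "'a \<times> real"
    assume s: "AE y in lborel. (y, snd z) \<in> halfspace \<longrightarrow> u (y, snd z) = w (y, snd z)"
      and i: "z \<in> halfspace \<longrightarrow> integrable lebesgue (riesz_integrand \<alpha> p u z)"
    show "z \<in> halfspace \<longrightarrow> ennreal (riesz_conv \<alpha> p u z) = riesz_nn \<alpha> p w z"
    proof
      assume z: "z \<in> halfspace"
      have "ennreal (riesz_conv \<alpha> p u z) = (\<integral>\<^sup>+y. ennreal (riesz_integrand \<alpha> p u z y) \<partial>lebesgue)"
        unfolding riesz_conv_def using i z
        by (intro nn_integral_eq_integral[symmetric]) (auto simp: riesz_integrand_def split: prod.split)
      also have "\<dots> = (\<integral>\<^sup>+y. ennreal (riesz_integrand \<alpha> p u z y) \<partial>lborel)"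
        by (rule nn_integral_completion)
      also have "\<dots> = riesz_nn \<alpha> p w z"
        unfolding riesz_nn_def
        by (rule nn_integral_cong_AE, use s in eventually_elim)
          (use z w0 in \<open>auto simp: riesz_integrand_def mem_halfspace_iff split: prod.split\<close>)
      finally show "ennreal (riesz_conv \<alpha> p u z) = riesz_nn \<alpha> p w z" .
    qed
  qed
  have R0: "0 \<le> riesz_conv \<alpha> p u z" for z
    unfolding riesz_conv_def riesz_integrand_def by (intro integral_nonneg_AE) (auto split: prod.split)
  show ?thesis
  proof (rule that[of w])
    fix \<phi> :: "'a \<times> real \<Rightarrow> real"
    assume t: "test_function \<phi>" and n: "\<And>z. 0 \<le> \<phi> z" and z: "\<And>x. \<phi> (x, 0) = 0"
    define L where "L z = - time_deriv \<phi> z + polyharmonic m \<phi> z" for z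
    define V where "V z = riesz_conv \<alpha> p u z * \<bar>u z\<bar> powr q * \<phi> z" for z
    have i1: "integrable lebesgue (\<lambda>z. indicator halfspace z *\<^sub>R (u z * L z))"
      and i2: "integrable lebesgue (\<lambda>z. indicator halfspace z *\<^sub>R V z)"
      and le: "(LINT z|lebesgue. indicator halfspace z *\<^sub>R V z) \<le> (LINT z|lebesgue. indicator halfspace z *\<^sub>R (u z * L z))"
      using ws t n z unfolding weak_solution_def set_integrable_def set_lebesgue_integral_def V_def L_def
      by auto
    have "ennreal (LINT z|lebesgue. indicator halfspace z *\<^sub>R V z)
        = (\<integral>\<^sup>+z. ennreal (indicator halfspace z *\<^sub>R V z) \<partial>lebesgue)"
      using i2 R0 n by (intro nn_integral_eq_integral[symmetric]) (auto simp: V_def)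
    also have "\<dots> = (\<integral>\<^sup>+z. ennreal (indicator halfspace z *\<^sub>R V z) \<partial>lborel)"
      by (rule nn_integral_completion)
    also have "\<dots> = (\<integral>\<^sup>+z. indicator halfspace z * (riesz_nn \<alpha> p w z * ennreal (w z powr q * \<phi> z)) \<partial>lborel)"
      by (rule nn_integral_cong_AE, use uw Req in eventually_elim)
        (use w0 R0 n in \<open>auto simp: V_def indicator_def ennreal_mult' mult.assoc\<close>)
    finally have A: "ennreal (LINT z|lebesgue. indicator halfspace z *\<^sub>R V z)
        = (\<integral>\<^sup>+z. indicator halfspace z * (riesz_nn \<alpha> p w z * ennreal (w z powr q * \<phi> z)) \<partial>lborel)" .
    have "ennreal (LINT z|lebesgue. indicator halfspace z *\<^sub>R (u z * L z))
        \<le> (\<integral>\<^sup>+z. ennreal (indicator halfspace z *\<^sub>R (u z * L z)) \<partial>lebesgue)"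
      by (rule ennreal_integral_le_nn_integral[OF i1])
    also have "\<dots> = (\<integral>\<^sup>+z. ennreal (indicator halfspace z *\<^sub>R (u z * L z)) \<partial>lborel)"
      by (rule nn_integral_completion)
    also have "\<dots> = (\<integral>\<^sup>+z. indicator halfspace z * ennreal (w z * L z) \<partial>lborel)"
      by (rule nn_integral_cong_AE, use uw in eventually_elim) (auto simp: indicator_def)
    finally have B: "ennreal (LINT z|lebesgue. indicator halfspace z *\<^sub>R (u z * L z))
        \<le> (\<integral>\<^sup>+z. indicator halfspace z * ennreal (w z * L z) \<partial>lborel)" .
    show "(\<integral>\<^sup>+z. indicator halfspace z * (riesz_nn \<alpha> p w z * ennreal (w z powr q * \<phi> z)) \<partial>lborel) < \<infinity> \<and>
      (\<integral>\<^sup>+z. indicator halfspace z * (riesz_nn \<alpha> p w z * ennreal (w z powr q * \<phi> z)) \<partial>lborel) \<le>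
      (\<integral>\<^sup>+z. indicator halfspace z * ennreal (w z * (- time_deriv \<phi> z + polyharmonic m \<phi> z)) \<partial>lborel)"
      using order_trans[OF ennreal_leI[OF le] B] unfolding A[symmetric] L_def by simp
  qed (use w0 uw in auto)
qed

subsection \<open>Energy bounds\<close>

text \<open>For nonnegative \<open>f\<close>, the square of the mixed norm L2 in time of L1 in
  space.\<close>

definition slice_energy :: "('a::euclidean_space \<times> real \<Rightarrow> real) \<Rightarrow> ennreal" where
  "slice_energy f = (\<integral>\<^sup>+t. (\<integral>\<^sup>+x. ennreal (f (x, t)) \<partial>lborel)\<^sup>2 \<partial>lborel)"

section \<open>Measurability and integration along time slices\<close>

lemma Pair_right_borel [measurable]: "(\<lambda>x. (x, t)) \<in> borel_measurable borel"
  by (intro borel_measurable_continuous_onI continuous_intros)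

lemma measurable_slice:
  fixes f :: "'a::euclidean_space \<times> real \<Rightarrow> 'b::topological_space"
  assumes "f \<in> borel_measurable borel"
  shows "(\<lambda>x. f (x, t)) \<in> borel_measurable borel"
  using measurable_compose[OF Pair_right_borel assms] .

lemma measurable_slice_integral:
  fixes f :: "'a::euclidean_space \<times> real \<Rightarrow> ennreal"
  assumes "f \<in> borel_measurable borel"
  shows "(\<lambda>t. \<integral>\<^sup>+x. f (x, t) \<partial>lborel) \<in> borel_measurable borel"
proof -
  have "(\<lambda>z. f (snd z, fst z)) \<in> borel_measurable (borel :: (real \<times> 'a) measure)"
    by (rule measurable_compose[OF _ assms])
      (intro borel_measurable_continuous_onI continuous_intros)
  then have "(\<lambda>(t, x). f (x, t)) \<in> borel_measurable ((borel :: real measure) \<Otimes>\<^sub>M (borel :: 'a measure))"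
    by (subst borel_prod) (simp add: case_prod_beta)
  then have "(\<lambda>(t, x). f (x, t)) \<in> borel_measurable ((borel :: real measure) \<Otimes>\<^sub>M (lborel :: 'a measure))"
    by (simp cong: measurable_cong_sets)
  then show ?thesis
    by (rule lborel.borel_measurable_nn_integral)
qed

lemma nn_integral_slices:
  fixes f :: "'a::euclidean_space \<times> real \<Rightarrow> ennreal"
  assumes "f \<in> borel_measurable borel"
  shows "(\<integral>\<^sup>+z. f z \<partial>lborel) = (\<integral>\<^sup>+t. (\<integral>\<^sup>+x. f (x, t) \<partial>lborel) \<partial>lborel)"
  using lborel_pair.nn_integral_snd[of f] assms by (simp add: lborel_prod)

lemma slice_energy_mono: "(\<And>z. f z \<le> g z) \<Longrightarrow> slice_energy f \<le> slice_energy g"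
  unfolding slice_energy_def by (intro nn_integral_mono power_mono ennreal_leI) auto

lemma riesz_nn_measurable:
  fixes w :: "'a::euclidean_space \<times> real \<Rightarrow> real"
  assumes [measurable]: "w \<in> borel_measurable borel"
  shows "riesz_nn \<alpha> p w \<in> borel_measurable borel"
proof -
  have "continuous_on UNIV (\<lambda>v. (snd v, snd (fst v)) :: 'a \<times> real)"
    by (intro continuous_intros)
  then have [measurable]: "(\<lambda>v. (snd v, snd (fst v)) :: 'a \<times> real) \<in> borel_measurable borel"
    by (rule borel_measurable_continuous_onI)
  have [measurable]: "(\<lambda>v :: ('a \<times> real) \<times> 'a. fst (fst v) - snd v) \<in> borel_measurable borel"
    by (intro borel_measurable_continuous_onI continuous_intros)
  have "(\<lambda>v :: ('a \<times> real) \<times> 'a. ennreal (norm (fst (fst v) - snd v) powr (- \<alpha>) * w (snd v, snd (fst v)) powr p))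
      \<in> borel_measurable borel"
    by measurable
  then have "(\<lambda>(z, y). ennreal (norm (fst z - y) powr (- \<alpha>) * w (y, snd z) powr p))
      \<in> borel_measurable ((borel :: ('a \<times> real) measure) \<Otimes>\<^sub>M (borel :: 'a measure))"
    by (subst borel_prod) (simp add: case_prod_beta)
  then have "(\<lambda>(z, y). ennreal (norm (fst z - y) powr (- \<alpha>) * w (y, snd z) powr p))
      \<in> borel_measurable ((borel :: ('a \<times> real) measure) \<Otimes>\<^sub>M (lborel :: 'a measure))"
    by (simp cong: measurable_cong_sets)
  then show ?thesis
    unfolding riesz_nn_def[abs_def] by (rule lborel.borel_measurable_nn_integral)
qed

text \<open>On the support of \<open>\<phi>\<close> the kernel is at least \<open>(4 R) powr (- \<alpha>)\<close>.\<close>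

lemma riesz_energy_lower_bound:
  fixes w \<phi> :: "'a::euclidean_space \<times> real \<Rightarrow> real"
  assumes [measurable]: "w \<in> borel_measurable borel" "\<phi> \<in> borel_measurable borel"
    and w: "\<And>z. 0 \<le> w z" and \<phi>: "\<And>z. 0 \<le> \<phi> z" "\<And>z. \<phi> z \<le> 1"
    and supp: "\<And>x t. 2 * R < norm x \<or> t \<le> 0 \<Longrightarrow> \<phi> (x, t) = 0"
    and R: "0 < R" and \<alpha>: "0 \<le> \<alpha>"
  shows "ennreal ((4 * R) powr (- \<alpha>)) * slice_energy (\<lambda>z. w z powr ((p + q) / 2) * \<phi> z) \<le>
    (\<integral>\<^sup>+z. indicator halfspace z * (riesz_nn \<alpha> p w z * ennreal (w z powr q * \<phi> z)) \<partial>lborel)"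
proof -
  let ?c = "(4 * R) powr (- \<alpha>)"
  note [measurable] = riesz_nn_measurable[OF assms(1)] measurable_slice[OF assms(1)] measurable_slice[OF assms(2)]
  have low: "ennreal ?c * (\<integral>\<^sup>+y. ennreal (w (y, t) powr p * \<phi> (y, t)) \<partial>lborel) \<le> riesz_nn \<alpha> p w (x, t)"
    if x: "norm x \<le> 2 * R" for x t
  proof -
    have "ennreal ?c * (\<integral>\<^sup>+y. ennreal (w (y, t) powr p * \<phi> (y, t)) \<partial>lborel)
        = (\<integral>\<^sup>+y. ennreal ?c * ennreal (w (y, t) powr p * \<phi> (y, t)) \<partial>lborel)"
      by (rule nn_integral_cmult[symmetric]) simp
    also have "\<dots> \<le> riesz_nn \<alpha> p w (x, t)"
      unfolding riesz_nn_def fst_conv snd_conv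
    \<comment> \<open>The kernel has the value 0 on the diagonal, so the pointwise bound may fail at
      \<open>y = x\<close>.\<close>
    proof (rule nn_integral_mono_AE, rule eventually_mono[OF AE_lborel_singleton[of x]])
      fix y assume y: "y \<noteq> x"
      have "?c * (w (y, t) powr p * \<phi> (y, t)) \<le> norm (x - y) powr (- \<alpha>) * w (y, t) powr p"
      proof (cases "\<phi> (y, t) = 0")
        case False
        then have "norm y \<le> 2 * R" using supp[of y t] by force
        \<comment> \<open>Both points lie in the ball of radius \<open>2 * R\<close>; hence the
          constant \<open>4 * R\<close>.\<close>
        then have "norm (x - y) \<le> 4 * R" using x norm_triangle_ineq4[of x y] by linarith
        then have "?c \<le> norm (x - y) powr (- \<alpha>)"
          using y \<alpha> R by (intro powr_mono2') auto
        moreover have "w (y, t) powr p * \<phi> (y, t) \<le> w (y, t) powr p"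
          using \<phi>(2)[of "(y, t)"] \<phi>(1)[of "(y, t)"] by (intro mult_left_le) auto
        ultimately show ?thesis
          using \<phi>(1)[of "(y, t)"] by (intro mult_mono) auto
      qed simp
      then show "ennreal ?c * ennreal (w (y, t) powr p * \<phi> (y, t)) \<le> ennreal (norm (x - y) powr (- \<alpha>) * w (y, t) powr p)"
        using \<phi>(1)[of "(y, t)"] by (simp add: ennreal_mult[symmetric] ennreal_leI)
    qed
    finally show ?thesis .
  qed
  have "ennreal ?c * slice_energy (\<lambda>z. w z powr ((p + q) / 2) * \<phi> z)
      = (\<integral>\<^sup>+t. ennreal ?c * (\<integral>\<^sup>+x. ennreal (w (x, t) powr ((p + q) / 2) * \<phi> (x, t)) \<partial>lborel)\<^sup>2 \<partial>lborel)"
    unfolding slice_energy_def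
    by (intro nn_integral_cmult[symmetric]) (simp add: measurable_slice_integral)
  also have "\<dots> \<le> (\<integral>\<^sup>+t. (\<integral>\<^sup>+x. indicator halfspace (x, t) * (riesz_nn \<alpha> p w (x, t) * ennreal (w (x, t) powr q * \<phi> (x, t))) \<partial>lborel) \<partial>lborel)"
  proof (rule nn_integral_mono)
    fix t
    define P where "P = (\<integral>\<^sup>+y. ennreal (w (y, t) powr p * \<phi> (y, t)) \<partial>lborel)"
    define Q where "Q = (\<integral>\<^sup>+y. ennreal (w (y, t) powr q * \<phi> (y, t)) \<partial>lborel)"
    have "(\<integral>\<^sup>+x. ennreal (w (x, t) powr ((p + q) / 2) * \<phi> (x, t)) \<partial>lborel)\<^sup>2 \<le> P * Q"
      unfolding P_def Q_def using w \<phi> by (intro nn_integral_cauchy_schwarz_powr) auto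
    then have "ennreal ?c * (\<integral>\<^sup>+x. ennreal (w (x, t) powr ((p + q) / 2) * \<phi> (x, t)) \<partial>lborel)\<^sup>2 \<le> ennreal ?c * P * Q"
      by (simp add: mult.assoc mult_left_mono)
    also have "\<dots> = (\<integral>\<^sup>+x. ennreal ?c * P * ennreal (w (x, t) powr q * \<phi> (x, t)) \<partial>lborel)"
      unfolding Q_def by (rule nn_integral_cmult[symmetric]) simp
    also have "\<dots> \<le> (\<integral>\<^sup>+x. indicator halfspace (x, t) * (riesz_nn \<alpha> p w (x, t) * ennreal (w (x, t) powr q * \<phi> (x, t))) \<partial>lborel)"
    proof (rule nn_integral_mono)
      fix x
      show "ennreal ?c * P * ennreal (w (x, t) powr q * \<phi> (x, t)) \<le>
        indicator halfspace (x, t) * (riesz_nn \<alpha> p w (x, t) * ennreal (w (x, t) powr q * \<phi> (x, t)))"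
      proof (cases "\<phi> (x, t) = 0")
        case False
        then have "norm x \<le> 2 * R" "0 < t" using supp[of x t] by force+
        then show ?thesis using low[of x t] by (simp add: P_def mult_right_mono)
      qed simp
    qed
    finally show "ennreal ?c * (\<integral>\<^sup>+x. ennreal (w (x, t) powr ((p + q) / 2) * \<phi> (x, t)) \<partial>lborel)\<^sup>2 \<le>
      (\<integral>\<^sup>+x. indicator halfspace (x, t) * (riesz_nn \<alpha> p w (x, t) * ennreal (w (x, t) powr q * \<phi> (x, t))) \<partial>lborel)" .
  qed
  also have "\<dots> = (\<integral>\<^sup>+z. indicator halfspace z * (riesz_nn \<alpha> p w z * ennreal (w z powr q * \<phi> z)) \<partial>lborel)"
    by (subst nn_integral_slices) simp_all
  finally show ?thesis .
qed

text \<open>Young's inequality is applied twice, with free parameters \<open>l\<close> in space and \<open>k\<close> in time.\<close>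

lemma linear_term_upper_bound:
  fixes w \<phi> :: "'a::euclidean_space \<times> real \<Rightarrow> real"
  assumes [measurable]: "w \<in> borel_measurable borel" "\<phi> \<in> borel_measurable borel" "E \<in> sets borel"
    and w: "\<And>z. 0 \<le> w z" and \<phi>: "\<And>z. 0 \<le> \<phi> z"
    and supp: "\<And>x t. 2 * R < norm x \<or> t \<le> 0 \<or> 2 * T < t \<Longrightarrow> \<phi> (x, t) = 0"
    and R: "0 < R" and T: "0 < T" and s: "1 < s" and l: "0 < l" and k: "0 < k"
  shows "(\<integral>\<^sup>+z. ennreal (indicator E z * (w z * \<phi> z powr (1 / s))) \<partial>lborel) \<le>
    ennreal (l * k) * slice_energy (\<lambda>z. indicator E z * (w z powr s * \<phi> z)) +
    ennreal (2 * T * (l / k + l powr (- 1 / (s - 1)) * (unit_ball_vol (real DIM('a)) * (2 * R) ^ DIM('a))))"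
proof -
  let ?l' = "l powr (- 1 / (s - 1))" and ?V = "unit_ball_vol (real DIM('a)) * (2 * R) ^ DIM('a)"
  note [measurable] = measurable_slice[OF assms(1)] measurable_slice[OF assms(2)]
  have Eb [measurable]: "(\<lambda>x. indicator E (x, t) :: real) \<in> borel_measurable borel" for t
    by (rule measurable_slice) simp
  define F where "F t = (\<integral>\<^sup>+x. ennreal (indicator E (x, t) * (w (x, t) powr s * \<phi> (x, t))) \<partial>lborel)" for t
  have F_meas [measurable]: "F \<in> borel_measurable borel"
    unfolding F_def[abs_def]
    by (rule measurable_slice_integral[of "\<lambda>z. ennreal (indicator E z * (w z powr s * \<phi> z))"]) simp
  have V: "0 \<le> ?V" using R by simp
  \<comment> \<open>Young's inequality with exponent 2; an infinite slice integral is covered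
    because its square is infinite too.\<close>
  have young_F: "F t \<le> ennreal k * (F t)\<^sup>2 + ennreal (1 / k)" for t
  proof (cases "F t")
    case (real r)
    have "r \<le> k * r powr 2 + k powr (- 1 / (2 - 1))" using young_powr[of r k 2] real k by auto
    then have "r \<le> k * r\<^sup>2 + 1 / k"
      using real k by (cases "r = 0") (auto simp: powr_minus divide_inverse powr_numeral)
    then show ?thesis
      using real k by (simp add: ennreal_power ennreal_mult[symmetric] ennreal_plus[symmetric] ennreal_leI del: ennreal_plus)
  next
    case top
    then show ?thesis using k by (simp add: ennreal_mult_top power2_eq_square)
  qed
  \<comment> \<open>The indicator records the support in time; without it the constant terms would
    have infinite integral over \<open>t\<close>.\<close>
  have inner: "(\<integral>\<^sup>+x. ennreal (indicator E (x, t) * (w (x, t) * \<phi> (x, t) powr (1 / s))) \<partial>lborel) \<le>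
      ennreal (l * k) * (F t)\<^sup>2 + ennreal (l / k + ?l' * ?V) * indicator {0..2 * T} t" for t
  proof (cases "t \<in> {0..2 * T}")
    case False
    then have "\<phi> (x, t) = 0" for x using supp[of x t] by auto
    then show ?thesis by simp
  next
    case True
    have pt: "indicator E (x, t) * (w (x, t) * \<phi> (x, t) powr (1 / s)) \<le>
        l * (indicator E (x, t) * (w (x, t) powr s * \<phi> (x, t))) + ?l' * indicator (cball 0 (2 * R)) x" for x
    proof (cases "\<phi> (x, t) = 0")
      case False
      then have x: "norm x \<le> 2 * R" using supp[of x t] by force
      have "w (x, t) * \<phi> (x, t) powr (1 / s) \<le> l * (w (x, t) * \<phi> (x, t) powr (1 / s)) powr s + ?l'"
        using w l s by (intro young_powr) auto
      also have "(w (x, t) * \<phi> (x, t) powr (1 / s)) powr s = w (x, t) powr s * \<phi> (x, t)"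
        using w[of "(x, t)"] \<phi>[of "(x, t)"] s by (simp add: powr_mult powr_powr)
      finally show ?thesis using x by (auto simp: indicator_def)
    qed simp
    have "(\<integral>\<^sup>+x. ennreal (indicator E (x, t) * (w (x, t) * \<phi> (x, t) powr (1 / s))) \<partial>lborel) \<le>
        (\<integral>\<^sup>+x. ennreal l * ennreal (indicator E (x, t) * (w (x, t) powr s * \<phi> (x, t)))
          + ennreal ?l' * indicator (cball 0 (2 * R)) x \<partial>lborel)"
    proof (rule nn_integral_mono)
      fix x
      have "ennreal (indicator E (x, t) * (w (x, t) * \<phi> (x, t) powr (1 / s))) \<le>
          ennreal (l * (indicator E (x, t) * (w (x, t) powr s * \<phi> (x, t))) + ?l' * indicator (cball 0 (2 * R)) x)"
        using pt by (rule ennreal_leI)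
      also have "\<dots> = ennreal l * ennreal (indicator E (x, t) * (w (x, t) powr s * \<phi> (x, t)))
          + ennreal ?l' * indicator (cball 0 (2 * R)) x"
        using l w \<phi> by (simp add: ennreal_plus ennreal_mult ennreal_indicator)
      finally show "ennreal (indicator E (x, t) * (w (x, t) * \<phi> (x, t) powr (1 / s))) \<le> \<dots>" .
    qed
    also have "\<dots> = ennreal l * F t + ennreal ?l' * emeasure lborel (cball (0::'a) (2 * R))"
      unfolding F_def by (simp add: nn_integral_add nn_integral_cmult nn_integral_cmult_indicator)
    also have "\<dots> \<le> ennreal l * (ennreal k * (F t)\<^sup>2 + ennreal (1 / k)) + ennreal ?l' * ennreal ?V"
      using R young_F[of t] by (intro add_mono mult_left_mono) (auto simp: emeasure_cball)
    also have "\<dots> = ennreal (l * k) * (F t)\<^sup>2 + ennreal (l / k + ?l' * ?V)"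
      using l k V by (simp add: distrib_left ennreal_mult ennreal_plus mult.assoc add.assoc ennreal_mult[symmetric, of l "1 / k"])
    finally show ?thesis using True by simp
  qed
  have "(\<integral>\<^sup>+z. ennreal (indicator E z * (w z * \<phi> z powr (1 / s))) \<partial>lborel)
      = (\<integral>\<^sup>+t. (\<integral>\<^sup>+x. ennreal (indicator E (x, t) * (w (x, t) * \<phi> (x, t) powr (1 / s))) \<partial>lborel) \<partial>lborel)"
    by (rule nn_integral_slices) simp
  also have "\<dots> \<le> (\<integral>\<^sup>+t. ennreal (l * k) * (F t)\<^sup>2 + ennreal (l / k + ?l' * ?V) * indicator {0..2 * T} t \<partial>lborel)"
    by (intro nn_integral_mono inner)
  also have "\<dots> = ennreal (l * k) * slice_energy (\<lambda>z. indicator E z * (w z powr s * \<phi> z))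
      + ennreal (l / k + ?l' * ?V) * ennreal (2 * T)"
    unfolding slice_energy_def F_def[symmetric]
    using T by (simp add: nn_integral_add nn_integral_cmult nn_integral_cmult_indicator)
  also have "ennreal (l / k + ?l' * ?V) * ennreal (2 * T) = ennreal ((l / k + ?l' * ?V) * (2 * T))"
    by (rule ennreal_mult[symmetric])
      (use l k V T R in \<open>intro add_nonneg_nonneg mult_nonneg_nonneg divide_nonneg_nonneg, simp_all\<close>)
  also have "(l / k + ?l' * ?V) * (2 * T) = 2 * T * (l / k + ?l' * ?V)"
    by (rule mult.commute)
  finally show ?thesis .
qed

text \<open>The complement of the plateau, and so the only place where
  \<open>scaled_test_operator_bound\<close> leaves a contribution.\<close>

definition outer_region :: "nat \<Rightarrow> real \<Rightarrow> ('a::euclidean_space \<times> real) set" where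
  "outer_region m R = {z. 1 \<le> norm (dilation R (R ^ (2 * m)) z)}"

lemma outer_region_borel [measurable]: "outer_region m R \<in> sets borel"
proof -
  have "continuous_on UNIV (\<lambda>z. norm (dilation R (R ^ (2 * m)) z))"
    by (intro continuous_intros linear_continuous_on bounded_linear_dilation)
  then have "closed {z :: 'a \<times> real. 1 \<le> norm (dilation R (R ^ (2 * m)) z)}"
    by (intro closed_Collect_le continuous_on_const)
  then show ?thesis unfolding outer_region_def by (rule borel_closed)
qed

lemma scaled_test_borel [measurable]:
  assumes "0 < R" "0 < k" shows "scaled_test m k R \<in> borel_measurable borel"
  using test_function_scaled_test[OF assms] test_function_iff smooth_borel by blast

lemma energy_estimate:
  fixes w :: "'a::euclidean_space \<times> real \<Rightarrow> real"
  assumes m: "1 \<le> m" and s: "1 < (p + q) / 2" and \<alpha>: "0 \<le> \<alpha>"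
    and crit: "(real DIM('a) + \<alpha>) * ((p + q) / 2 - 1) \<le> real m - \<alpha>"
    and wm [measurable]: "w \<in> borel_measurable borel" and w: "\<And>z. 0 \<le> w z"
    and ineq: "\<And>\<phi>. test_function \<phi> \<Longrightarrow> (\<And>z. 0 \<le> \<phi> z) \<Longrightarrow> (\<And>x. \<phi> (x, 0) = 0) \<Longrightarrow>
      (\<integral>\<^sup>+z. indicator halfspace z * (riesz_nn \<alpha> p w z * ennreal (w z powr q * \<phi> z)) \<partial>lborel) < \<infinity> \<and>
      (\<integral>\<^sup>+z. indicator halfspace z * (riesz_nn \<alpha> p w z * ennreal (w z powr q * \<phi> z)) \<partial>lborel) \<le>
      (\<integral>\<^sup>+z. indicator halfspace z * ennreal (w z * (- time_deriv \<phi> z + polyharmonic m \<phi> z)) \<partial>lborel)"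
  obtains k C where "0 < k" "0 \<le> C"
    "\<And>R K M. 1 \<le> R \<Longrightarrow> 0 < K \<Longrightarrow> 0 < M \<Longrightarrow>
      slice_energy (\<lambda>z. w z powr ((p + q) / 2) * scaled_test m k R z) < \<infinity> \<and>
      slice_energy (\<lambda>z. w z powr ((p + q) / 2) * scaled_test m k R z) \<le>
      ennreal (C * (K * M)) *
        slice_energy (\<lambda>z. indicator (outer_region m R) z * (w z powr ((p + q) / 2) * scaled_test m k R z)) +
      ennreal (C * (K / M + K powr (- 1 / ((p + q) / 2 - 1))))"
proof -
  define s where "s = (p + q) / 2"
  have s1: "1 < s" using s by (simp add: s_def)
  obtain k C where k: "0 < k" and C: "0 \<le> C" and op:
    "\<And>R (z :: 'a \<times> real). 0 < R \<Longrightarrow>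
      - time_deriv (scaled_test m k R) z + polyharmonic m (scaled_test m k R) z \<le>
      (if norm (dilation R (R ^ (2 * m)) z) < 1 then 0
       else C * inverse R ^ (2 * m) * scaled_test m k R z powr (1 / s))"
    using scaled_test_operator_bound[OF m s1] by blast
  define v where "v = unit_ball_vol (real DIM('a)) * 2 ^ DIM('a)"
  have v: "0 \<le> v" by (simp add: v_def)
  \<comment> \<open>The 2 is the length \<open>2 * T\<close> of the time support relative to
    \<open>T\<close>, \<open>4 powr \<alpha>\<close> comes from the kernel bound, \<open>C\<close>
    from the operator, and \<open>v\<close> is the volume of a ball of radius 2.\<close>
  define D where "D = 2 * 4 powr \<alpha> * C * (1 + v)"
  have D0: "0 \<le> D" using C v by (simp add: D_def)
  have D1: "4 powr \<alpha> * C \<le> D" "2 * 4 powr \<alpha> * C \<le> D" "2 * 4 powr \<alpha> * C * v \<le> D"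
  proof -
    have e: "0 \<le> 4 powr \<alpha> * C" using C by simp
    have "0 \<le> (4 powr \<alpha> * C) * v" using e v by (rule mult_nonneg_nonneg)
    then show "4 powr \<alpha> * C \<le> D" "2 * 4 powr \<alpha> * C \<le> D" "2 * 4 powr \<alpha> * C * v \<le> D"
      using e by (auto simp: D_def algebra_simps)
  qed
  show ?thesis
  proof (rule that[OF k D0], unfold s_def[symmetric])
    fix R K M :: real assume R1: "1 \<le> R" and K: "0 < K" and M: "0 < M"
    have R: "0 < R" using R1 by simp
    define T where "T = R ^ (2 * m)"
    have T: "0 < T" "T = R powr (2 * real m)" using R by (simp_all add: T_def powr_realpow[symmetric])
    define \<phi> where "\<phi> = (scaled_test m k R :: 'a \<times> real \<Rightarrow> real)"
    define E where "E = (outer_region m R :: ('a \<times> real) set)"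
    have [measurable]: "E \<in> sets borel" "\<phi> \<in> borel_measurable borel"
      using R k by (simp_all add: E_def \<phi>_def scaled_test_borel outer_region_borel)
    have ph: "0 \<le> \<phi> z" "\<phi> z \<le> 1" for z
      by (simp_all add: \<phi>_def scaled_test_nonneg scaled_test_le_1)
    have supp: "\<phi> (x, t) = 0" if "2 * R < norm x \<or> t \<le> 0 \<or> 2 * T < t" for x t
      unfolding \<phi>_def using that by (intro scaled_test_eq_0[OF R k]) (auto simp: T_def)
    have tf: "test_function \<phi>" unfolding \<phi>_def by (rule test_function_scaled_test[OF R k])
    define X where "X = slice_energy (\<lambda>z. w z powr s * \<phi> z)"
    define XE where "XE = slice_energy (\<lambda>z. indicator E z * (w z powr s * \<phi> z))"
    \<comment> \<open>With \<open>T = R ^ (2 * m)\<close> these powers of \<open>R\<close> cancel in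
      \<open>R powr \<alpha> * inverse T * (l * \<mu>)\<close> and in
      \<open>R powr \<alpha> * (l / \<mu>)\<close>, leaving \<open>K * M\<close> and
      \<open>K / M\<close>.\<close>
    define l where "l = K * R powr (real m - \<alpha>)"
    define \<mu> where "\<mu> = M * R powr real m"
    have l: "0 < l" and \<mu>: "0 < \<mu>" using K M R by (simp_all add: l_def \<mu>_def)
    define l' where "l' = l powr (- 1 / (s - 1))"
    define c where "c = (4 * R) powr \<alpha>"
    have c: "0 < c" "(4 * R) powr (- \<alpha>) = 1 / c" using R by (simp_all add: c_def powr_minus divide_inverse)
    define C' where "C' = C * inverse T"
    have C': "0 \<le> C'" using C T by (simp add: C'_def)
    let ?I = "\<integral>\<^sup>+z. indicator halfspace z * (riesz_nn \<alpha> p w z * ennreal (w z powr q * \<phi> z)) \<partial>lborel"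
    have I: "?I < \<infinity>" "?I \<le> (\<integral>\<^sup>+z. indicator halfspace z * ennreal (w z * (- time_deriv \<phi> z + polyharmonic m \<phi> z)) \<partial>lborel)"
      using ineq[OF tf ph(1)] supp by auto
    have low: "ennreal (1 / c) * X \<le> ?I"
      unfolding X_def s_def c(2)[symmetric]
      by (rule riesz_energy_lower_bound) (use w ph supp R \<alpha> in auto)
    have "?I \<le> (\<integral>\<^sup>+z. ennreal C' * ennreal (indicator E z * (w z * \<phi> z powr (1 / s))) \<partial>lborel)"
    proof (rule order_trans[OF I(2)], rule nn_integral_mono)
      fix z
      have "w z * (- time_deriv \<phi> z + polyharmonic m \<phi> z) \<le>
          w z * (if norm (dilation R T z) < 1 then 0 else C * inverse R ^ (2 * m) * \<phi> z powr (1 / s))"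
        unfolding \<phi>_def T_def by (intro mult_left_mono op R w)
      also have "\<dots> = C' * (indicator E z * (w z * \<phi> z powr (1 / s)))"
        by (auto simp: E_def outer_region_def indicator_def C'_def T_def power_inverse)
      finally have "ennreal (w z * (- time_deriv \<phi> z + polyharmonic m \<phi> z))
          \<le> ennreal (C' * (indicator E z * (w z * \<phi> z powr (1 / s))))"
        by (rule ennreal_leI)
      also have "\<dots> = ennreal C' * ennreal (indicator E z * (w z * \<phi> z powr (1 / s)))"
        using C' by (rule ennreal_mult') 
      finally show "indicator halfspace z * ennreal (w z * (- time_deriv \<phi> z + polyharmonic m \<phi> z))
          \<le> ennreal C' * ennreal (indicator E z * (w z * \<phi> z powr (1 / s)))"
        by (auto simp: indicator_def)
    qed
    also have "\<dots> = ennreal C' * (\<integral>\<^sup>+z. ennreal (indicator E z * (w z * \<phi> z powr (1 / s))) \<partial>lborel)"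
      by (rule nn_integral_cmult) simp
    also have "\<dots> \<le> ennreal C' * (ennreal (l * \<mu>) * XE
        + ennreal (2 * T * (l / \<mu> + l' * (unit_ball_vol (real DIM('a)) * (2 * R) ^ DIM('a)))))"
      unfolding XE_def l'_def
      by (intro mult_left_mono linear_term_upper_bound) (use w ph supp R T s1 l \<mu> in auto)
    finally have up: "?I \<le> ennreal C' * (ennreal (l * \<mu>) * XE
        + ennreal (2 * T * (l / \<mu> + l' * (unit_ball_vol (real DIM('a)) * (2 * R) ^ DIM('a)))))" .
    have Xc: "X = ennreal c * (ennreal (1 / c) * X)"
      using c(1) by (simp add: mult.assoc[symmetric] ennreal_mult[symmetric])
    \<comment> \<open>The nonlinear term is finite and dominates a positive multiple of
      \<open>X\<close>.\<close>
    have "X < \<infinity>"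
      using le_less_trans[OF low I(1)] by (subst Xc) (simp add: ennreal_mult_less_top)
    moreover have "X \<le> ennreal (D * (K * M)) * XE + ennreal (D * (K / M + K powr (- 1 / (s - 1))))"
    proof -
      define Y where "Y = 2 * T * (l / \<mu> + l' * (unit_ball_vol (real DIM('a)) * (2 * R) ^ DIM('a)))"
      have Y0: "0 \<le> Y"
        unfolding Y_def using T(1) l \<mu> R by (intro mult_nonneg_nonneg add_nonneg_nonneg) (auto simp: l'_def)
      have "X \<le> ennreal c * (ennreal C' * (ennreal (l * \<mu>) * XE + ennreal Y))"
        by (subst Xc) (intro mult_left_mono order_trans[OF low up[folded Y_def]], simp)
      also have "\<dots> = ennreal (c * C' * (l * \<mu>)) * XE + ennreal (c * C' * Y)"
        using c(1) C' l \<mu> Y0 by (simp add: distrib_left ennreal_mult mult.assoc)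
      also have "c * C' * (l * \<mu>) = 4 powr \<alpha> * C * (K * M)"
      proof -
        have "R powr \<alpha> * inverse T * (R powr (real m - \<alpha>) * R powr real m) = 1"
          using R unfolding T(2) by (simp add: powr_minus[symmetric] powr_add[symmetric])
        then have "(4 powr \<alpha> * C * (K * M)) * (R powr \<alpha> * inverse T * (R powr (real m - \<alpha>) * R powr real m))
            = 4 powr \<alpha> * C * (K * M)" by simp
        then show ?thesis
          using R by (simp add: c_def C'_def l_def \<mu>_def powr_mult mult_ac)
      qed
      also have "c * C' * Y = 2 * 4 powr \<alpha> * C * (R powr \<alpha> * (l / \<mu>) + v * (R powr (\<alpha> + real DIM('a)) * l'))"
        using R T by (simp add: Y_def c_def C'_def v_def powr_mult power_mult_distrib powr_add powr_realpow field_simps)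
      also have "R powr \<alpha> * (l / \<mu>) = K / M"
      proof -
        have "R powr \<alpha> * R powr (real m - \<alpha>) = R powr real m" by (simp add: powr_add[symmetric])
        then show ?thesis using R M by (simp add: l_def \<mu>_def field_simps)
      qed
      also have "ennreal (4 powr \<alpha> * C * (K * M)) * XE
          + ennreal (2 * 4 powr \<alpha> * C * (K / M + v * (R powr (\<alpha> + real DIM('a)) * l')))
          \<le> ennreal (D * (K * M)) * XE + ennreal (D * (K / M + K powr (- 1 / (s - 1))))"
      proof -
        have A: "4 powr \<alpha> * C * (K * M) \<le> D * (K * M)"
          using D1(1) K M by (intro mult_right_mono) auto
        \<comment> \<open>Here \<open>crit\<close> enters: it makes the total exponent of
          \<open>R\<close> nonpositive, and \<open>R \<ge> 1\<close> removes the power.\<close>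
        have "R powr (\<alpha> + real DIM('a)) * l' = K powr (- 1 / (s - 1)) *
            R powr (\<alpha> + real DIM('a) - (real m - \<alpha>) / (s - 1))"
          using R K by (simp add: l'_def l_def powr_mult powr_powr powr_add[symmetric] field_simps)
        also have "\<dots> \<le> K powr (- 1 / (s - 1)) * R powr 0"
        proof (intro mult_left_mono powr_mono R1)
          have "real DIM('a) + \<alpha> \<le> (real m - \<alpha>) / (s - 1)"
            using crit s1 by (simp add: s_def[symmetric] pos_le_divide_eq)
          then show "\<alpha> + real DIM('a) - (real m - \<alpha>) / (s - 1) \<le> 0" by simp
        qed simp
        finally have *: "R powr (\<alpha> + real DIM('a)) * l' \<le> K powr (- 1 / (s - 1))" using R by simp
        have "2 * 4 powr \<alpha> * C * (K / M) \<le> D * (K / M)"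
          using D1(2) K M by (intro mult_right_mono) auto
        moreover have "(2 * 4 powr \<alpha> * C * v) * (R powr (\<alpha> + real DIM('a)) * l') \<le> D * K powr (- 1 / (s - 1))"
          using D1(3) * D0 by (intro mult_mono) (auto simp: l'_def)
        ultimately have B: "2 * 4 powr \<alpha> * C * (K / M + v * (R powr (\<alpha> + real DIM('a)) * l'))
            \<le> D * (K / M + K powr (- 1 / (s - 1)))"
          by (simp add: algebra_simps)
        show ?thesis
          by (intro add_mono mult_right_mono[OF ennreal_leI[OF A]] ennreal_leI[OF B]) simp
      qed
      finally show ?thesis .
    qed
    ultimately show "slice_energy (\<lambda>z. w z powr s * scaled_test m k R z) < \<infinity> \<and>
      slice_energy (\<lambda>z. w z powr s * scaled_test m k R z) \<le>
      ennreal (D * (K * M)) * slice_energy (\<lambda>z. indicator (outer_region m R) z * (w z powr s * scaled_test m k R z))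
      + ennreal (D * (K / M + K powr (- 1 / (s - 1))))"
      by (simp add: X_def XE_def E_def \<phi>_def)
  qed
qed

text \<open>With \<open>v = v * indicator (- E) + v * indicator E\<close> and \<open>E n\<close> decreasing to the empty set, the
  energy carried by \<open>E n\<close> tends to zero once the total energy is finite.\<close>

lemma slice_energy_limit:
  fixes v :: "'a::euclidean_space \<times> real \<Rightarrow> real"
  assumes [measurable]: "v \<in> borel_measurable borel" "\<And>n. E n \<in> sets borel"
    and v: "\<And>z. 0 \<le> v z" and dec: "\<And>n. E (Suc n) \<subseteq> E n" and empty: "(\<Inter>n. E n) = {}"
  shows "(\<lambda>n. slice_energy (\<lambda>z. indicator (- E n) z * v z)) \<longlonglongrightarrow> slice_energy v"
    and "slice_energy (\<lambda>z. indicator (- E n) z * v z) + slice_energy (\<lambda>z. indicator (E n) z * v z)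
      \<le> slice_energy v"
proof -
  define F where "F n t = (\<integral>\<^sup>+x. ennreal (indicator (- E n) (x, t) * v (x, t)) \<partial>lborel)" for n t
  define G where "G n t = (\<integral>\<^sup>+x. ennreal (indicator (E n) (x, t) * v (x, t)) \<partial>lborel)" for n t
  define H where "H t = (\<integral>\<^sup>+x. ennreal (v (x, t)) \<partial>lborel)" for t
  have Qb [measurable]: "- E n \<in> sets borel" for n using assms(2) by (rule borel_comp)
  note [measurable] = measurable_slice[OF assms(1)]
  have [measurable]: "(\<lambda>x. indicator (- E n) (x, t) :: real) \<in> borel_measurable borel"
    "(\<lambda>x. indicator (E n) (x, t) :: real) \<in> borel_measurable borel" for n t
    by (rule measurable_slice, simp)+
  have Fm [measurable]: "F n \<in> borel_measurable borel" for n
    unfolding F_def[abs_def]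
    by (rule measurable_slice_integral[of "\<lambda>z. ennreal (indicator (- E n) z * v z)"]) simp
  have Gm [measurable]: "G n \<in> borel_measurable borel" for n
    unfolding G_def[abs_def]
    by (rule measurable_slice_integral[of "\<lambda>z. ennreal (indicator (E n) z * v z)"]) simp
  have ind: "indicator (- E n) z * v z \<le> indicator (- E (Suc n)) z * v z" for n z
    using v[of z] dec[of n] by (auto simp: indicator_def)
  have inc: "incseq (\<lambda>n x. ennreal (indicator (- E n) (x, t) * v (x, t)))" for t
    by (intro incseq_SucI le_funI ennreal_leI ind)
  have lim_pt: "(\<lambda>n. ennreal (indicator (- E n) z * v z)) \<longlonglongrightarrow> ennreal (v z)" for z
  proof -
    obtain n where n: "z \<notin> E n" using empty by auto
    have "z \<notin> E k" if "n \<le> k" for k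
      using n lift_Suc_antimono_le[of E, OF dec that] by auto
    then have "eventually (\<lambda>k. ennreal (indicator (- E k) z * v z) = ennreal (v z)) sequentially"
      unfolding eventually_sequentially by (intro exI[of _ n]) (auto simp: indicator_def)
    then show ?thesis by (rule tendsto_eventually)
  qed
  \<comment> \<open>Monotone convergence on each slice; a second application in time follows for the
    squares.\<close>
  have limF: "(\<lambda>n. F n t) \<longlonglongrightarrow> H t" for t
    unfolding F_def H_def by (rule nn_integral_LIMSEQ[OF inc _ lim_pt]) simp
  have limF2: "(\<lambda>n. (F n t)\<^sup>2) \<longlonglongrightarrow> (H t)\<^sup>2" for t
    unfolding power2_eq_square by (rule tendsto_mult_ennreal[OF limF limF]) auto
  have incF: "incseq (\<lambda>n t. (F n t)\<^sup>2)"
    by (intro incseq_SucI le_funI power_mono) (auto simp: F_def intro!: nn_integral_mono ennreal_leI ind)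
  show "(\<lambda>n. slice_energy (\<lambda>z. indicator (- E n) z * v z)) \<longlonglongrightarrow> slice_energy v"
    unfolding slice_energy_def F_def[symmetric] H_def[symmetric]
    by (rule nn_integral_LIMSEQ[OF incF _ limF2]) simp
  have FG: "F n t + G n t = H t" for t
    unfolding F_def G_def H_def
    by (subst nn_integral_add[symmetric]) (auto intro!: nn_integral_cong simp: indicator_def)
  \<comment> \<open>The square is superadditive on nonnegative numbers: dropping the mixed products
    costs equality but suffices for the tail estimate.\<close>
  have "(F n t)\<^sup>2 + (G n t)\<^sup>2 \<le> (H t)\<^sup>2" for t
    unfolding FG[symmetric] power2_eq_square by (simp add: distrib_left distrib_right add_increasing add_mono)
  then have "(\<integral>\<^sup>+t. (F n t)\<^sup>2 + (G n t)\<^sup>2 \<partial>lborel) \<le> (\<integral>\<^sup>+t. (H t)\<^sup>2 \<partial>lborel)"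
    by (rule nn_integral_mono)
  then show "slice_energy (\<lambda>z. indicator (- E n) z * v z) + slice_energy (\<lambda>z. indicator (E n) z * v z)
      \<le> slice_energy v"
    unfolding slice_energy_def F_def[symmetric] G_def[symmetric] H_def[symmetric]
    by (simp add: nn_integral_add)
qed

lemma slice_energy_eq_0:
  fixes v :: "'a::euclidean_space \<times> real \<Rightarrow> real"
  assumes [measurable]: "v \<in> borel_measurable borel" and v: "\<And>z. 0 \<le> v z" and "slice_energy v = 0"
  shows "AE z in lborel. v z = 0"
proof -
  define H where "H t = (\<integral>\<^sup>+x. ennreal (v (x, t)) \<partial>lborel)" for t
  have [measurable]: "H \<in> borel_measurable borel"
    unfolding H_def[abs_def] by (rule measurable_slice_integral[of "\<lambda>z. ennreal (v z)"]) simp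
  have "AE t in lborel. (H t)\<^sup>2 = 0"
    using assms(3) unfolding slice_energy_def H_def[symmetric] by (subst (asm) nn_integral_0_iff_AE) auto
  then have "(\<integral>\<^sup>+t. H t \<partial>lborel) = 0"
    by (subst nn_integral_0_iff_AE) auto
  then have "(\<integral>\<^sup>+z. ennreal (v z) \<partial>lborel) = 0"
    by (subst nn_integral_slices) (simp_all add: H_def)
  then have "AE z in lborel. ennreal (v z) = 0"
    by (subst (asm) nn_integral_0_iff_AE) auto
  then show ?thesis
    by eventually_elim (use v in \<open>simp add: ennreal_eq_0_iff order_antisym\<close>)
qed

subsection \<open>Nonexistence\<close>

lemma norm_dilation_antimono:
  assumes "0 < R" "R \<le> S"
  shows "norm (dilation S (S ^ n) z) \<le> norm (dilation R (R ^ n) z)"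
proof -
  have "norm (fst z) / S \<le> norm (fst z) / R" "\<bar>snd z\<bar> / S ^ n \<le> \<bar>snd z\<bar> / R ^ n"
    using assms by (auto intro!: divide_left_mono power_mono mult_pos_pos zero_less_power)
  then show ?thesis
    using assms unfolding dilation_def norm_Pair
    by (intro real_sqrt_le_mono add_mono power_mono) (auto simp: divide_inverse_commute abs_mult)
qed

lemma outer_region_antimono:
  "0 < R \<Longrightarrow> R \<le> S \<Longrightarrow> outer_region m S \<subseteq> outer_region m R"
  unfolding outer_region_def using norm_dilation_antimono order_trans by blast

lemma outer_region_Inter:
  assumes "1 \<le> m"
  shows "(\<Inter>n. outer_region m (real (Suc n)) :: ('a::euclidean_space \<times> real) set) = {}"
proof -
  have "\<exists>n. z \<notin> outer_region m (real (Suc n))" for z :: "'a \<times> real"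
  proof -
    obtain n where n: "norm (fst z) + \<bar>snd z\<bar> < real n" using reals_Archimedean2 by blast
    define R where "R = real (Suc n)"
    have R: "1 \<le> R" "norm (fst z) + \<bar>snd z\<bar> < R" using n by (auto simp: R_def)
    have "R ^ 1 \<le> R ^ (2 * m)" using R assms by (intro power_increasing) auto
    then have T: "\<bar>snd z\<bar> / R ^ (2 * m) \<le> \<bar>snd z\<bar> / R"
      using R by (intro divide_left_mono) auto
    have "norm (dilation R (R ^ (2 * m)) z) \<le> norm (fst z) / R + \<bar>snd z\<bar> / R ^ (2 * m)"
      unfolding dilation_def
      using norm_Pair_le[of "fst z /\<^sub>R R" "snd z /\<^sub>R R ^ (2 * m)"] R
      by (simp add: divide_inverse_commute abs_mult)
    also have "\<dots> \<le> (norm (fst z) + \<bar>snd z\<bar>) / R"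
      using T by (simp add: add_divide_distrib)
    also have "\<dots> < 1" using R by simp
    finally show ?thesis
      unfolding outer_region_def R_def by (intro exI[of _ n]) auto
  qed
  then show ?thesis by blast
qed

theorem no_nontrivial_weak_solution:
  fixes u :: "'a::euclidean_space \<times> real \<Rightarrow> real"
  assumes m: "1 \<le> m" and \<alpha>: "0 < \<alpha>" and pq: "2 < p + q"
    and le: "p + q \<le> (2 * real DIM('a) + 2 * real m) / (real DIM('a) + \<alpha>)"
    and ws: "weak_solution m \<alpha> p q u\<^sub>0 u"
    and nonneg: "AE z in lebesgue. z \<in> halfspace \<longrightarrow> 0 \<le> u z"
  shows "AE z in lebesgue. z \<in> halfspace \<longrightarrow> u z = 0"
proof -
  define s where "s = (p + q) / 2"
  have s: "1 < s" using pq by (simp add: s_def)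
  \<comment> \<open>Clearing the denominator gives \<open>(N + \<alpha>) * s \<le> N + m\<close>;
    subtract \<open>N + \<alpha>\<close>.\<close>
  have crit: "(real DIM('a) + \<alpha>) * (s - 1) \<le> real m - \<alpha>"
    using le \<alpha> by (simp add: s_def pos_le_divide_eq algebra_simps add_pos_pos)
  obtain w where wm [measurable]: "w \<in> borel_measurable borel" and w: "\<And>z. 0 \<le> w z"
    and uw: "AE z in lborel. z \<in> halfspace \<longrightarrow> u z = w z"
    and ineq: "\<And>\<phi>. test_function \<phi> \<Longrightarrow> (\<And>z. 0 \<le> \<phi> z) \<Longrightarrow> (\<And>x. \<phi> (x, 0) = 0) \<Longrightarrow>
      (\<integral>\<^sup>+z. indicator halfspace z * (riesz_nn \<alpha> p w z * ennreal (w z powr q * \<phi> z)) \<partial>lborel) < \<infinity> \<and>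
      (\<integral>\<^sup>+z. indicator halfspace z * (riesz_nn \<alpha> p w z * ennreal (w z powr q * \<phi> z)) \<partial>lborel) \<le>
      (\<integral>\<^sup>+z. indicator halfspace z * ennreal (w z * (- time_deriv \<phi> z + polyharmonic m \<phi> z)) \<partial>lborel)"
    using weak_solution_nn_inequality[OF ws nonneg] by blast
  obtain k C where k: "0 < k" and C: "0 \<le> C" and est:
    "\<And>R K M. 1 \<le> R \<Longrightarrow> 0 < K \<Longrightarrow> 0 < M \<Longrightarrow>
      slice_energy (\<lambda>z. w z powr s * scaled_test m k R z) < \<infinity> \<and>
      slice_energy (\<lambda>z. w z powr s * scaled_test m k R z) \<le>
      ennreal (C * (K * M)) *
        slice_energy (\<lambda>z. indicator (outer_region m R) z * (w z powr s * scaled_test m k R z)) +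
      ennreal (C * (K / M + K powr (- 1 / (s - 1))))"
    using energy_estimate[OF m s[unfolded s_def] less_imp_le[OF \<alpha>] crit[unfolded s_def] wm w ineq]
    unfolding s_def[symmetric] by blast
  \<comment> \<open>The integrand that remains when the cutoff is replaced by 1. It coincides with
    the truncated one off \<open>E n\<close> and dominates it everywhere, so the truncated energies
    can be compared with \<open>a n\<close> and \<open>b n\<close>.\<close>
  define v where "v z = w z powr s * flat 0 (snd z)" for z
  have v: "0 \<le> v z" for z by (simp add: v_def flat_0_nonneg)
  have [measurable]: "flat 0 \<in> borel_measurable borel" by (rule smooth_borel[OF smooth_flat])
  have [measurable]: "(snd :: 'a \<times> real \<Rightarrow> real) \<in> borel_measurable borel"
    by (intro borel_measurable_continuous_onI continuous_intros)
  have vm [measurable]: "v \<in> borel_measurable borel" unfolding v_def[abs_def] by measurable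
  define R where "R n = real (Suc n)" for n
  have R: "1 \<le> R n" "0 < R n" for n by (auto simp: R_def)
  define E where "E n = (outer_region m (R n) :: ('a \<times> real) set)" for n
  have Em: "E n \<in> sets borel" for n by (simp add: E_def outer_region_borel)
  have Edec: "E (Suc n) \<subseteq> E n" for n
    unfolding E_def by (rule outer_region_antimono) (auto simp: R_def)
  have Eempty: "(\<Inter>n. E n) = {}" unfolding E_def R_def by (rule outer_region_Inter[OF m])
  define \<phi> where "\<phi> n = (scaled_test m k (R n) :: 'a \<times> real \<Rightarrow> real)" for n
  define J where "J n = slice_energy (\<lambda>z. w z powr s * \<phi> n z)" for n
  define JE where "JE n = slice_energy (\<lambda>z. indicator (E n) z * (w z powr s * \<phi> n z))" for n
  define a where "a n = slice_energy (\<lambda>z. indicator (- E n) z * v z)" for n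
  define b where "b n = slice_energy (\<lambda>z. indicator (E n) z * v z)" for n
  define A where "A = slice_energy v"
  have lim: "a \<longlonglongrightarrow> A" and ab: "a n + b n \<le> A" for n
    using slice_energy_limit[of v E, OF vm Em v Edec Eempty] by (auto simp: a_def[abs_def] b_def A_def)
  have aJ: "a n \<le> J n" for n
    unfolding a_def J_def
  proof (rule slice_energy_mono)
    fix z
    show "indicator (- E n) z * v z \<le> w z powr s * \<phi> n z"
      using scaled_test_eq_flat[of "R n" m z k]
      by (auto simp: indicator_def E_def outer_region_def v_def \<phi>_def scaled_test_nonneg)
  qed
  have JEJ: "JE n \<le> J n" for n
    unfolding JE_def J_def
    by (rule slice_energy_mono) (auto simp: indicator_def \<phi>_def scaled_test_nonneg)
  have JEb: "JE n \<le> b n" for n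
    unfolding JE_def b_def
    by (rule slice_energy_mono)
      (auto simp: indicator_def \<phi>_def v_def intro!: mult_left_mono scaled_test_le_flat)
  have Jfin: "J n < \<infinity>" for n
    unfolding J_def \<phi>_def using est[OF R(1), of 1 1] by simp
  have est': "J n \<le> ennreal (C * (K * M)) * JE n + ennreal (C * (K / M + K powr (- 1 / (s - 1))))"
    if "0 < K" "0 < M" for n K M
    unfolding J_def JE_def \<phi>_def E_def using est[OF R(1) that] by simp
  \<comment> \<open>With \<open>K = 1\<close> this makes the coefficient of \<open>JE n\<close> at
    most 1/2. As \<open>JE n \<le> J n\<close> and \<open>J n\<close> is finite, half of
    \<open>J n\<close> can be absorbed.\<close>
  define M0 where "M0 = 1 / (2 * C + 1)"
  have M0: "0 < M0" "C * M0 \<le> 1 / 2" using C by (auto simp: M0_def field_simps)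
  define B where "B = C * (1 / M0 + 1)"
  have B: "0 \<le> B" using C M0 by (simp add: B_def)
  have J_bound: "J n \<le> ennreal (2 * B)" for n
  proof -
    obtain j where j: "0 \<le> j" "J n = ennreal j" using Jfin[of n] by (cases "J n") auto
    have "J n \<le> ennreal (C * M0) * JE n + ennreal B"
      using est'[of 1 M0 n] M0(1) by (simp add: B_def)
    also have "\<dots> \<le> ennreal (1 / 2) * ennreal j + ennreal B"
      using JEJ[of n] M0(2) by (intro add_mono mult_mono ennreal_leI) (auto simp: j)
    also have "ennreal (1 / 2) * ennreal j = ennreal (1 / 2 * j)"
      using j(1) by (intro ennreal_mult[symmetric]) auto
    also have "\<dots> + ennreal B = ennreal (1 / 2 * j + B)"
      using j(1) B by (intro ennreal_plus[symmetric]) auto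
    finally have "j \<le> 1 / 2 * j + B" using j B by (subst (asm) j(2), subst (asm) ennreal_le_iff) auto
    then show ?thesis unfolding j(2) by (intro ennreal_leI) simp
  qed
  have "A \<le> ennreal (2 * B)"
    by (rule LIMSEQ_le_const2[OF lim]) (use aJ J_bound order_trans in blast)
  then obtain A' where A': "0 \<le> A'" "A = ennreal A'" by (cases A) (auto simp: top_unique)
  \<comment> \<open>For fixed \<open>K\<close> and \<open>M\<close> the term with
    \<open>K * M\<close> multiplies a tail tending to 0, so only the explicit constant survives in
    the limit.\<close>
  have small: "A' \<le> C * (K / M + K powr (- 1 / (s - 1)))" if KM: "0 < K" "0 < M" for K M
  proof -
    define a' where "a' n = enn2real (a n)" for n
    have a': "a n = ennreal (a' n)" "0 \<le> a' n" for n
    proof -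
      have "a n \<le> A" using ab[of n] add_increasing2[of "b n" "a n" "a n"] by (meson order_trans zero_le order_refl)
      then have "a n < top" using A' by (simp add: le_less_trans)
      then show "a n = ennreal (a' n)" by (simp add: a'_def)
    qed (simp add: a'_def)
    have lim': "a' \<longlonglongrightarrow> A'"
      using lim A' a' by (simp add: tendsto_ennreal_iff[symmetric] flip: a'(1))
    let ?D = "C * (K / M + K powr (- 1 / (s - 1)))"
    have D: "0 \<le> ?D" using C KM by simp
    have "a' n \<le> C * (K * M) * (A' - a' n) + ?D" for n
    proof -
      \<comment> \<open>The tail \<open>b n\<close> is bounded by the gap between the total energy
        and its inner part, which closes as \<open>n\<close> grows.\<close>
      have le: "a' n \<le> A'" and bn: "b n \<le> ennreal (A' - a' n)"
      proof -
        have 1: "ennreal (a' n) + b n \<le> ennreal A'" using ab[of n] a'(1)[of n] A'(2) by simp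
        then have "ennreal (a' n) \<le> ennreal A'"
          using add_increasing2[of "b n" "ennreal (a' n)" "ennreal (a' n)"] by (meson order_trans zero_le order_refl)
        then show le: "a' n \<le> A'" using A' by simp
        obtain b' where b': "0 \<le> b'" "b n = ennreal b'" using 1 by (cases "b n") (auto simp: top_unique)
        then have "ennreal (a' n + b') \<le> ennreal A'" using 1 a'(2)[of n] by simp
        then have "a' n + b' \<le> A'" using A' by simp
        then show "b n \<le> ennreal (A' - a' n)" unfolding b'(2) by (intro ennreal_leI) simp
      qed
      have "ennreal (a' n) \<le> ennreal (C * (K * M)) * JE n + ennreal ?D"
        using order_trans[OF aJ est'[OF KM]] by (simp add: a'(1)[symmetric])
      also have "\<dots> \<le> ennreal (C * (K * M)) * ennreal (A' - a' n) + ennreal ?D"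
        using order_trans[OF JEb[of n] bn] by (intro add_mono mult_left_mono) auto
      also have "\<dots> = ennreal (C * (K * M) * (A' - a' n) + ?D)"
        using C KM le D by (simp add: ennreal_mult[symmetric] ennreal_plus[symmetric] del: ennreal_plus)
      finally show ?thesis
        using C KM le D by (subst (asm) ennreal_le_iff) auto
    qed
    moreover have "(\<lambda>n. C * (K * M) * (A' - a' n) + ?D) \<longlonglongrightarrow> C * (K * M) * (A' - A') + ?D"
      by (intro tendsto_intros lim')
    ultimately have "A' \<le> C * (K * M) * (A' - A') + ?D"
      using lim' by (intro LIMSEQ_le[of a' A']) auto
    then show ?thesis by simp
  qed
  have "A' \<le> 0"
  proof (rule field_le_epsilon)
    fix e :: real assume e: "0 < e"
    define d where "d = e / (2 * C + 1)"
    have d: "0 < d" using e C by (simp add: d_def)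
    \<comment> \<open>With this \<open>K\<close> and \<open>M = K / d\<close>, both
      \<open>K / M\<close> and \<open>K powr (- 1 / (s - 1))\<close> equal \<open>d\<close>. The
      product \<open>K * M\<close> may be huge, but its term has already disappeared in
      \<open>small\<close>.\<close>
    define K where "K = d powr (- (s - 1))"
    have K: "0 < K" using d by (simp add: K_def)
    have "- (s - 1) * (- 1 / (s - 1)) = 1" using s by (simp add: field_simps)
    then have "K powr (- 1 / (s - 1)) = d" unfolding K_def powr_powr using d by simp
    then have "A' \<le> C * (d + d)"
      using small[of K "K / d"] K d by simp
    also have "\<dots> \<le> (2 * C + 1) * d" using d by (simp add: algebra_simps)
    also have "\<dots> = e" using C by (simp add: d_def)
    finally show "A' \<le> 0 + e" by simp
  qed
  then have "slice_energy v = 0" using A' by (simp add: A_def)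
  then have "AE z in lborel. v z = 0" by (rule slice_energy_eq_0[OF vm v])
  then have "AE z in lborel. z \<in> halfspace \<longrightarrow> u z = 0"
    using uw
  proof eventually_elim
    fix z assume "v z = 0" "z \<in> halfspace \<longrightarrow> u z = w z"
    then show "z \<in> halfspace \<longrightarrow> u z = 0" by (auto simp: v_def flat_0 mem_halfspace_iff)
  qed
  then show ?thesis unfolding AE_completion_iff .
qed

theorem corollary1p2:
  fixes m :: nat and p q \<alpha> :: real
  assumes "1 \<le> m" and "0 < p" and "0 < q" and "0 < \<alpha>" and "\<alpha> < real DIM('a::euclidean_space)"
  shows
    "(\<alpha> < real m \<and> 2 < p + q \<and>
        p + q \<le> (2 * real DIM('a) + 2 * real m) / (real DIM('a) + \<alpha>) \<longrightarrow>
      \<not> (\<exists>(u\<^sub>0 :: 'a \<Rightarrow> real) (u :: 'a \<times> real \<Rightarrow> real).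
            weak_solution m \<alpha> p q u\<^sub>0 u \<and>
            (AE z in lebesgue. z \<in> halfspace \<longrightarrow> 0 \<le> u z) \<and>
            \<not> (AE z in lebesgue. z \<in> halfspace \<longrightarrow> u z = 0)))
     \<and>
     (2 * m < DIM('a) \<and>
        min p q > (real DIM('a) - \<alpha>) / (real DIM('a) - 2 * real m) \<and>
        p + q > (2 * real DIM('a) - \<alpha>) / (real DIM('a) - 2 * real m) \<longrightarrow>
      (\<exists>(u\<^sub>0 :: 'a \<Rightarrow> real) (u :: 'a \<times> real \<Rightarrow> real).
            weak_solution m \<alpha> p q u\<^sub>0 u \<and>
            (\<forall>z\<in>halfspace. 0 < u z)))"
  using no_nontrivial_weak_solution[OF assms(1,4)] weak_solution_exists[OF _ assms(2-5)]
  by blast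

end
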